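(* Let $i\ge 1$, $d=2i$, let $q\ge 1$ be real, and let $\mathbb{F}$ be a field with $\mathrm{char}(\mathbb{F})\ne 2$. Let $P$ be distributed as the $i$-dimensional plaquette random-cluster model $\mu_{\mathbb{T}^d_N}=\mu_{\mathbb{T}^d_N,p,q,i,\mathbb{F}}$, and let $\phi_*:H_i(P;\mathbb{F})\to H_i(\mathbb{T}^d_N;\mathbb{F})$ be the map on homology induced by the inclusion $P\hookrightarrow\mathbb{T}^d_N$. Let $A$ be the event that $\phi_*$ is non-trivial (nonzero) and $S$ the event that $\phi_*$ is surjective, and set $p_{\mathrm{sd}}=p_{\mathrm{sd}}(q)=\frac{\sqrt q}{1+\sqrt q}$. Then, as $N\to\infty$, $$\begin{cases}\mu_{\mathbb{T}^d_N}(A)\to 0 & \text{if } p<p_{\mathrm{sd}}(q),\\ \mu_{\mathbb{T}^d_N}(S)\to 1 & \text{if } p>p_{\mathrm{sd}}(q).\end{cases}$$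
   Context: $\mathbb{T}^d_N$ is the $d$-dimensional torus with the cubical complex structure obtained by dividing $[0,N]^d$ into unit cubes and identifying opposite faces of $[0,N]^d$. For a finite cubical complex $X$, a field $\mathbb{F}$, $p\in[0,1]$ and $q>0$, the $i$-dimensional plaquette random-cluster model on $X$ is the random $i$-complex $P\subset X$ containing the full $(i-1)$-skeleton of $X$ (and no cells of dimension $>i$) with $$\mu_{X,p,q,i,\mathbb{F}}(P)=\frac1Z p^{|P|}(1-p)^{|X^i|-|P|}q^{\mathbf b_{i-1}(P;\mathbb{F})},$$ where $|X^i|$ and $|P|$ are the numbers of $i$-cells of $X$ and $P$, $\mathbf b_{i-1}(P;\mathbb{F})=\dim H_{i-1}(P;\mathbb{F})$, and $Z$ is a normalizing constant. *)

theory Defs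
  imports "HOL-Probability.Probability_Measure" "HOL-Library.Poly_Mapping"
    "Jordan_Normal_Form.VS_Connect"
begin

hide_const (open) Polynomial.smult

text \<open>
  A cell of the cubical torus is a pair \<open>(v, D)\<close> of a corner \<open>v\<close> and a set \<open>D\<close> of directions. It
  stands for the image in the torus of the product over all coordinates \<open>j\<close> of \<open>[v j, v j + 1]\<close>
  (for \<open>j \<in> D\<close>) and of \<open>{v j}\<close> (for \<open>j \<notin> D\<close>), the coordinates of \<open>v\<close> being taken modulo \<open>N\<close>.
\<close>

type_synonym cell = "(nat \<Rightarrow> nat) \<times> nat set"

definition cell_dim :: "cell \<Rightarrow> nat" where
  "cell_dim \<sigma> = card (snd \<sigma>)"

definition torus :: "nat \<Rightarrow> nat \<Rightarrow> cell set" where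
  "torus d N = ({..<d} \<rightarrow>\<^sub>E {..<N}) \<times> Pow {..<d}"

definition cells_of_dim :: "cell set \<Rightarrow> nat \<Rightarrow> cell set" where
  "cells_of_dim X k = {\<sigma> \<in> X. cell_dim \<sigma> = k}"

type_synonym 'f chain = "cell \<Rightarrow>\<^sub>0 'f"

definition scale_chain :: "'f::field \<Rightarrow> 'f chain \<Rightarrow> 'f chain" where
  "scale_chain a c = Poly_Mapping.map ((*) a) c"

definition front_face :: "nat \<Rightarrow> nat \<Rightarrow> cell \<Rightarrow> cell" where
  "front_face N j = (\<lambda>(v, D). (v(j := (v j + 1) mod N), D - {j}))"

definition back_face :: "nat \<Rightarrow> cell \<Rightarrow> cell" where
  "back_face j = (\<lambda>(v, D). (v, D - {j}))"

text \<open>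
  The sign is the one of the product orientation: \<open>j\<close> is preceded in \<open>D\<close> by as many directions as
  the exponent says.
\<close>

definition cell_boundary :: "nat \<Rightarrow> cell \<Rightarrow> 'f::field chain" where
  "cell_boundary N \<sigma> = (\<Sum>j\<in>snd \<sigma>. scale_chain ((- 1) ^ card {k \<in> snd \<sigma>. k < j})
     (Poly_Mapping.single (front_face N j \<sigma>) 1 - Poly_Mapping.single (back_face j \<sigma>) 1))"

definition boundary :: "nat \<Rightarrow> 'f::field chain \<Rightarrow> 'f chain" where
  "boundary N c = (\<Sum>\<sigma>\<in>Poly_Mapping.keys c. scale_chain (Poly_Mapping.lookup c \<sigma>) (cell_boundary N \<sigma>))"

definition chains :: "cell set \<Rightarrow> nat \<Rightarrow> 'f::field chain set" where
  "chains X k = {c. Poly_Mapping.keys c \<subseteq> cells_of_dim X k}"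

definition cycles :: "nat \<Rightarrow> cell set \<Rightarrow> nat \<Rightarrow> 'f::field chain set" where
  "cycles N X k = {c \<in> chains X k. boundary N c = 0}"

definition boundaries :: "nat \<Rightarrow> cell set \<Rightarrow> nat \<Rightarrow> 'f::field chain set" where
  "boundaries N X k = boundary N ` chains X (Suc k)"

definition homology_class :: "nat \<Rightarrow> cell set \<Rightarrow> nat \<Rightarrow> 'f::field chain \<Rightarrow> 'f chain set" where
  "homology_class N X k z = {z + b | b. b \<in> boundaries N X k}"

text \<open>
  The \<open>k\<close>-th homology of a subcomplex \<open>X\<close> of the torus of side \<open>N\<close>: the quotient vector space of
  cycles by boundaries. The components \<open>mult\<close> and \<open>one\<close> of the record play no role for modules.
\<close>

definition homology :: "nat \<Rightarrow> cell set \<Rightarrow> nat \<Rightarrow> ('f::field, 'f chain set) module" where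
  "homology N X k =
    \<lparr>carrier = homology_class N X k ` cycles N X k,
     mult = undefined,
     one = undefined,
     zero = boundaries N X k,
     add = (\<lambda>A B. {a + b | a b. a \<in> A \<and> b \<in> B}),
     smult = (\<lambda>a A. {scale_chain a z + b | z b. z \<in> A \<and> b \<in> boundaries N X k})\<rparr>"

text \<open>
  The map induced by the inclusion of \<open>P\<close> in \<open>X\<close> sends the class of \<open>z\<close> in \<open>P\<close> to the class of \<open>z\<close>
  in \<open>X\<close>, which is the union of the classes in \<open>X\<close> of all representatives.
\<close>

definition incl_homology ::
  "nat \<Rightarrow> cell set \<Rightarrow> nat \<Rightarrow> 'f::field chain set \<Rightarrow> 'f chain set" where
  "incl_homology N X k A = (\<Union>z\<in>A. homology_class N X k z)"

definition betti :: "'f::field itself \<Rightarrow> nat \<Rightarrow> cell set \<Rightarrow> nat \<Rightarrow> nat" where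
  "betti _ N X k = vectorspace.dim class_ring (homology N X k :: ('f, 'f chain set) module)"

definition plaquette_configs :: "cell set \<Rightarrow> nat \<Rightarrow> cell set set" where
  "plaquette_configs X i =
    {P. P \<subseteq> X \<and> {\<sigma> \<in> X. cell_dim \<sigma> < i} \<subseteq> P \<and> (\<forall>\<sigma>\<in>P. cell_dim \<sigma> \<le> i)}"

definition prc_weight ::
  "'f::field itself \<Rightarrow> nat \<Rightarrow> cell set \<Rightarrow> real \<Rightarrow> real \<Rightarrow> nat \<Rightarrow> cell set \<Rightarrow> real" where
  "prc_weight F N X p q i P =
    p ^ card (cells_of_dim P i)
    * (1 - p) ^ (card (cells_of_dim X i) - card (cells_of_dim P i))
    * q ^ betti F N P (i - 1)"

definition prc_measure ::
  "'f::field itself \<Rightarrow> nat \<Rightarrow> cell set \<Rightarrow> real \<Rightarrow> real \<Rightarrow> nat \<Rightarrow> cell set measure" where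
  "prc_measure F N X p q i =
    point_measure (plaquette_configs X i)
      (\<lambda>P. ennreal (prc_weight F N X p q i P / (\<Sum>Q\<in>plaquette_configs X i. prc_weight F N X p q i Q)))"

definition incl_nontrivial :: "'f::field itself \<Rightarrow> nat \<Rightarrow> cell set \<Rightarrow> nat \<Rightarrow> cell set \<Rightarrow> bool" where
  "incl_nontrivial _ N X i P \<longleftrightarrow>
    (\<exists>A \<in> carrier (homology N P i :: ('f, 'f chain set) module).
       incl_homology N X i A \<noteq> \<zero>\<^bsub>homology N X i\<^esub>)"

definition incl_surjective :: "'f::field itself \<Rightarrow> nat \<Rightarrow> cell set \<Rightarrow> nat \<Rightarrow> cell set \<Rightarrow> bool" where
  "incl_surjective _ N X i P \<longleftrightarrow>
    incl_homology N X i ` carrier (homology N P i :: ('f, 'f chain set) module)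
      = carrier (homology N X i)"

definition p_sd :: "real \<Rightarrow> real" where
  "p_sd q = sqrt q / (1 + sqrt q)"

text \<open>
  The quotients above are vector spaces (as \<^const>\<open>vectorspace.dim\<close> presupposes), boundaries are
  cycles, the induced map acts on representatives as expected, and \<^const>\<open>prc_measure\<close> is
  normalised.
\<close>

lemma lookup_scale_chain [simp]:
  "Poly_Mapping.lookup (scale_chain a c) \<sigma> = a * Poly_Mapping.lookup c \<sigma>"
  by (simp add: scale_chain_def Poly_Mapping.map.rep_eq when_def)

lemma scale_chain_simps:
  "scale_chain (a + b) c = scale_chain a c + scale_chain b c"
  "scale_chain a (c + c') = scale_chain a c + scale_chain a c'"
  "scale_chain a (scale_chain b c) = scale_chain (a * b) c"
  "scale_chain 1 c = c" "scale_chain 0 c = 0" "scale_chain a 0 = 0"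
  by (rule poly_mapping_eqI; simp add: lookup_add algebra_simps)+

lemma scale_chain_sum: "scale_chain a (\<Sum>x\<in>S. f x) = (\<Sum>x\<in>S. scale_chain a (f x))"
  by (induction S rule: infinite_finite_induct) (auto simp: scale_chain_simps)

lemma boundary_superset:
  assumes "finite S" "Poly_Mapping.keys c \<subseteq> S"
  shows "boundary N c = (\<Sum>\<sigma>\<in>S. scale_chain (Poly_Mapping.lookup c \<sigma>) (cell_boundary N \<sigma>))"
  unfolding boundary_def using assms
  by (intro sum.mono_neutral_left) (auto simp: in_keys_iff scale_chain_simps)

lemma boundary_add: "boundary N (c + c') = boundary N c + boundary N c'"
proof -
  let ?S = "Poly_Mapping.keys c \<union> Poly_Mapping.keys c'"
  have "Poly_Mapping.keys (c + c') \<subseteq> ?S" by (rule Poly_Mapping.keys_add)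
  then show ?thesis
    by (simp add: boundary_superset[of ?S] lookup_add scale_chain_simps sum.distrib)
qed

lemma boundary_scale: "boundary N (scale_chain a c) = scale_chain a (boundary N c)"
proof -
  have "Poly_Mapping.keys (scale_chain a c) \<subseteq> Poly_Mapping.keys c" by (auto simp: in_keys_iff)
  then show ?thesis
    by (simp add: boundary_superset[of "Poly_Mapping.keys c"] scale_chain_sum scale_chain_simps)
qed

lemma chains_closed:
  "0 \<in> chains X k"
  "c \<in> chains X k \<Longrightarrow> c' \<in> chains X k \<Longrightarrow> c + c' \<in> chains X k"
  "c \<in> chains X k \<Longrightarrow> scale_chain a c \<in> chains X k"
  using Poly_Mapping.keys_add[of c c']
  by (auto simp: chains_def in_keys_iff)

lemma boundary_0 [simp]: "boundary N 0 = 0"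
  by (simp add: boundary_def)

lemma boundaries_closed:
  "0 \<in> boundaries N X k"
  "c \<in> boundaries N X k \<Longrightarrow> c' \<in> boundaries N X k \<Longrightarrow> c + c' \<in> boundaries N X k"
  "c \<in> boundaries N X k \<Longrightarrow> scale_chain a c \<in> boundaries N X k"
  unfolding boundaries_def
  by (force simp: chains_closed boundary_add[symmetric] boundary_scale[symmetric] image_iff
      intro: chains_closed)+

lemma cycles_closed:
  "0 \<in> cycles N X k"
  "c \<in> cycles N X k \<Longrightarrow> c' \<in> cycles N X k \<Longrightarrow> c + c' \<in> cycles N X k"
  "c \<in> cycles N X k \<Longrightarrow> scale_chain a c \<in> cycles N X k"
  unfolding cycles_def
  by (auto simp: chains_closed boundary_add boundary_scale scale_chain_simps)

lemma scale_chain_neg: "scale_chain (-1) c = - c"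
  by (rule poly_mapping_eqI) simp

lemma boundaries_neg: "c \<in> boundaries N X k \<Longrightarrow> - c \<in> boundaries N X k"
  using boundaries_closed(3)[of c N X k "-1"] by (simp add: scale_chain_neg)

lemma homology_ops:
  "add (homology N X k) (homology_class N X k x) (homology_class N X k y) = homology_class N X k (x + y)"
  "smult (homology N X k) a (homology_class N X k x) = homology_class N X k (scale_chain a x)"
  "zero (homology N X k) = homology_class N X k 0"
  "carrier (homology N X k) = homology_class N X k ` cycles N X k"
proof -
  let ?B = "boundaries N X k"
  show "add (homology N X k) (homology_class N X k x) (homology_class N X k y) = homology_class N X k (x + y)"
  proof (rule Set.set_eqI, rule iffI)
    fix w assume "w \<in> add (homology N X k) (homology_class N X k x) (homology_class N X k y)"
    then obtain b b' where "b \<in> ?B" "b' \<in> ?B" "w = (x + b) + (y + b')"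
      by (auto simp: homology_def homology_class_def)
    then show "w \<in> homology_class N X k (x + y)"
      by (auto simp: homology_class_def intro!: exI[of _ "b + b'"] boundaries_closed)
  next
    fix w assume "w \<in> homology_class N X k (x + y)"
    then obtain b where "b \<in> ?B" "w = (x + b) + (y + 0)"
      by (auto simp: homology_class_def algebra_simps)
    then show "w \<in> add (homology N X k) (homology_class N X k x) (homology_class N X k y)"
      unfolding homology_def homology_class_def using boundaries_closed(1)[of N X k]
      by (simp del: add_0_right) blast
  qed
  show "smult (homology N X k) a (homology_class N X k x) = homology_class N X k (scale_chain a x)"
  proof (rule Set.set_eqI, rule iffI)
    fix w assume "w \<in> smult (homology N X k) a (homology_class N X k x)"
    then obtain b b' where "b \<in> ?B" "b' \<in> ?B" "w = scale_chain a (x + b) + b'"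
      by (auto simp: homology_def homology_class_def)
    then show "w \<in> homology_class N X k (scale_chain a x)"
      by (auto simp: homology_class_def scale_chain_simps algebra_simps
          intro!: exI[of _ "scale_chain a b + b'"] boundaries_closed)
  next
    fix w assume "w \<in> homology_class N X k (scale_chain a x)"
    then obtain b where "b \<in> ?B" "w = scale_chain a (x + 0) + b"
      by (auto simp: homology_class_def)
    then show "w \<in> smult (homology N X k) a (homology_class N X k x)"
      unfolding homology_def homology_class_def using boundaries_closed(1)[of N X k]
      by (simp del: add_0_right) blast
  qed
qed (auto simp: homology_def homology_class_def)

lemma vectorspace_homology:
  "vectorspace class_ring (homology N X k :: ('f::field, 'f chain set) module)"
proof -
  let ?H = "homology N X k :: ('f, 'f chain set) module"
  interpret F: field "class_ring :: 'f ring" by (rule class_field)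
  have "abelian_group ?H"
  proof (rule abelian_groupI)
    fix A assume "A \<in> carrier ?H"
    then obtain z where "z \<in> cycles N X k" "A = homology_class N X k z" by (auto simp: homology_ops)
    then show "\<exists>B\<in>carrier ?H. B \<oplus>\<^bsub>?H\<^esub> A = \<zero>\<^bsub>?H\<^esub>"
      by (intro bexI[of _ "homology_class N X k (scale_chain (-1) z)"])
        (auto simp: homology_ops scale_chain_neg intro: cycles_closed(3)[of _ _ _ _ "-1", unfolded scale_chain_neg])
  qed (auto simp: homology_ops add_ac intro!: imageI cycles_closed)
  moreover have "cring (class_ring :: 'f ring)" by unfold_locales
  ultimately have "module class_ring ?H"
    by (intro moduleI) (auto simp: homology_ops scale_chain_simps intro!: imageI cycles_closed)
  then show ?thesis
    by (simp add: vectorspace_def class_field)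
qed

lemma incl_homology_class:
  assumes "P \<subseteq> X"
  shows "incl_homology N X k (homology_class N P k z) = homology_class N X k z"
proof -
  have sub: "boundaries N P k \<subseteq> boundaries N X k"
    using assms by (auto simp: boundaries_def chains_def cells_of_dim_def)
  show ?thesis
  proof (rule Set.set_eqI, rule iffI)
    fix w assume "w \<in> incl_homology N X k (homology_class N P k z)"
    then obtain b b' where "b \<in> boundaries N P k" "b' \<in> boundaries N X k" "w = z + (b + b')"
      by (auto simp: incl_homology_def homology_class_def algebra_simps)
    then show "w \<in> homology_class N X k z"
      unfolding homology_class_def using sub boundaries_closed(2)[of b N X k b'] by auto
  next
    fix w assume "w \<in> homology_class N X k z"
    then show "w \<in> incl_homology N X k (homology_class N P k z)"
      unfolding incl_homology_def homology_class_def using boundaries_closed(1)[of N P k]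
      by (metis (mono_tags, lifting) UN_I add_0_right mem_Collect_eq)
  qed
qed

lemma finite_torus: "finite (torus d N)"
  by (auto simp: torus_def intro!: finite_PiE)

lemma prob_space_prc_measure:
  assumes "finite X" "0 \<le> p" "p \<le> 1" "0 < q"
  shows "prob_space (prc_measure F N X p q i)"
proof -
  let ?C = "plaquette_configs X i" and ?w = "prc_weight F N X p q i"
  have fin: "finite ?C"
    using assms by (auto simp: plaquette_configs_def intro: finite_subset[of _ "Pow X"])
  have nn: "?w P \<ge> 0" for P
    using assms by (auto simp: prc_weight_def)
  have "(\<Sum>P\<in>?C. ?w P) > 0"
  proof -
    define P where "P = (if p = 0 then {\<sigma>\<in>X. cell_dim \<sigma> < i} else {\<sigma>\<in>X. cell_dim \<sigma> \<le> i})"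
    have "P \<in> ?C" by (auto simp: P_def plaquette_configs_def)
    moreover have "cells_of_dim P i = (if p = 0 then {} else cells_of_dim X i)"
      by (auto simp: P_def cells_of_dim_def)
    then have "?w P > 0"
      using assms by (auto simp: prc_weight_def)
    ultimately show ?thesis using fin nn by (meson sum_pos2)
  qed
  then have "(\<Sum>P\<in>?C. ennreal (?w P / (\<Sum>Q\<in>?C. ?w Q))) = 1"
    using nn by (subst sum_ennreal) (auto simp: sum_divide_distrib[symmetric])
  then show ?thesis
    unfolding prc_measure_def using fin
    by (intro prob_spaceI) (simp add: space_point_measure emeasure_point_measure_finite)
qed


lemma boundary_single: "boundary N (Poly_Mapping.single \<sigma> (1::'f::field)) = cell_boundary N \<sigma>"
  by (simp add: boundary_def scale_chain_simps)

lemma boundary_sum: "boundary N (\<Sum>x\<in>S. f x) = (\<Sum>x\<in>S. boundary N (f x))"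
  by (induction S rule: infinite_finite_induct) (auto simp: boundary_add)

lemma boundary_diff: "boundary N (c - c') = boundary N c - boundary N c'"
  using boundary_add[of N c "- c'"] boundary_scale[of N "-1" c'] by (simp add: scale_chain_neg)

lemma scale_chain_diff: "scale_chain a (c - c') = scale_chain a c - scale_chain a c'"
  by (rule poly_mapping_eqI) (simp add: lookup_minus algebra_simps)

lemma boundary_cell_boundary:
  assumes fin: "finite (snd \<sigma>)"
  shows "boundary N (cell_boundary N \<sigma> :: 'f::field chain) = 0"
proof -
  obtain v D where \<sigma>: "\<sigma> = (v, D)" by (cases \<sigma>)
  define s :: "nat set \<Rightarrow> nat \<Rightarrow> 'f" where "s = (\<lambda>D j. (-1) ^ card {k\<in>D. k < j})"
  define e :: "cell \<Rightarrow> 'f chain" where "e = (\<lambda>\<tau>. Poly_Mapping.single \<tau> 1)"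
  define T where "T = (\<lambda>j k. e (front_face N k (front_face N j \<sigma>)) - e (back_face k (front_face N j \<sigma>))
     - (e (front_face N k (back_face j \<sigma>)) - e (back_face k (back_face j \<sigma>))))"
  define g where "g = (\<lambda>j k. scale_chain (s D j * s (D - {j}) k) (T j k))"
  have cb: "cell_boundary N \<tau> = (\<Sum>j\<in>snd \<tau>. scale_chain (s (snd \<tau>) j) (e (front_face N j \<tau>) - e (back_face j \<tau>)))" for \<tau>
    by (simp add: cell_boundary_def s_def e_def)
  have sn: "snd (front_face N j \<sigma>) = D - {j}" "snd (back_face j \<sigma>) = D - {j}" for j
    by (simp_all add: front_face_def back_face_def \<sigma>)
  have "boundary N (cell_boundary N \<sigma>) =
    (\<Sum>j\<in>D. scale_chain (s D j) (cell_boundary N (front_face N j \<sigma>) - cell_boundary N (back_face j \<sigma>)))"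
    unfolding cb[of \<sigma>] boundary_sum boundary_scale boundary_diff e_def boundary_single by (simp add: \<sigma>)
  also have "\<dots> = (\<Sum>j\<in>D. \<Sum>k\<in>D - {j}. g j k)"
    unfolding cb sn g_def T_def
    by (simp add: sum_subtractf[symmetric] scale_chain_diff[symmetric] scale_chain_sum scale_chain_simps)
  also have "\<dots> = (\<Sum>(j,k)\<in>Sigma D (\<lambda>j. D - {j}). g j k)"
    using fin \<sigma> by (subst sum.Sigma) auto
  also have "Sigma D (\<lambda>j. D - {j}) = {(j,k)\<in>D\<times>D. j < k} \<union> {(j,k)\<in>D\<times>D. k < j}"
    by auto
  also have "(\<Sum>(j,k)\<in>\<dots>. g j k) = (\<Sum>(j,k)\<in>{(j,k)\<in>D\<times>D. j < k}. g j k) + (\<Sum>(j,k)\<in>{(j,k)\<in>D\<times>D. k < j}. g j k)"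
    using fin \<sigma> by (intro sum.union_disjoint) (auto intro: finite_subset[of _ "D\<times>D"])
  also have "(\<Sum>(j,k)\<in>{(j,k)\<in>D\<times>D. k < j}. g j k) = (\<Sum>(j,k)\<in>{(j,k)\<in>D\<times>D. j < k}. g k j)"
    by (rule sum.reindex_bij_witness[of _ prod.swap prod.swap]) auto
  also have "(\<Sum>(j,k)\<in>{(j,k)\<in>D\<times>D. j < k}. g j k) + \<dots> = (\<Sum>(j,k)\<in>{(j,k)\<in>D\<times>D. j < k}. g j k + g k j)"
    by (simp add: sum.distrib[symmetric] case_prod_beta)
  also have "\<dots> = 0"
  proof (rule sum.neutral, clarify)
    fix j k assume jk: "j \<in> D" "k \<in> D" "j < k"
    have TT: "T k j = T j k"
      using jk by (simp add: T_def front_face_def back_face_def \<sigma> fun_upd_twist insert_commute Diff_insert2[symmetric] Diff_insert[symmetric] algebra_simps)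
    have "{l \<in> D. l < k} = insert j {l \<in> D - {j}. l < k}" using jk by auto
    moreover have "finite D" using fin \<sigma> by simp
    ultimately have "s D k = - s (D - {j}) k" by (simp add: s_def)
    moreover have "{l \<in> D - {k}. l < j} = {l \<in> D. l < j}" using jk by auto
    then have "s (D - {k}) j = s D j" by (simp add: s_def)
    ultimately show "g j k + g k j = 0"
      by (simp add: g_def TT scale_chain_simps(1)[symmetric] scale_chain_simps(5) mult.commute)
  qed
  finally show ?thesis .
qed

lemma boundaries_subset_cycles_torus:
  assumes "P \<subseteq> torus d N" and closed: "\<And>\<sigma> j. \<sigma> \<in> P \<Longrightarrow> j \<in> snd \<sigma> \<Longrightarrow> front_face N j \<sigma> \<in> P \<and> back_face j \<sigma> \<in> P"
  shows "boundaries N P k \<subseteq> (cycles N P k :: 'f::field chain set)"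
proof -
  have fin: "finite (snd \<sigma>)" if "\<sigma> \<in> P" for \<sigma>
  proof -
    have "snd \<sigma> \<subseteq> {..<d}" using assms(1) that by (cases \<sigma>) (auto simp: torus_def)
    then show ?thesis by (rule finite_subset) simp
  qed
  have cl: "cell_boundary N \<sigma> \<in> (chains P k :: 'f chain set)" if "\<sigma> \<in> cells_of_dim P (Suc k)" for \<sigma>
  proof -
    have s: "(\<Sum>x\<in>S. f x) \<in> (chains P k :: 'f chain set)" if "\<And>x. x \<in> S \<Longrightarrow> f x \<in> chains P k" for S :: "nat set" and f
      using that by (induction S rule: infinite_finite_induct) (auto intro: chains_closed)
    have m: "Poly_Mapping.single \<tau> 1 - Poly_Mapping.single \<tau>' 1 \<in> (chains P k :: 'f chain set)"
      if "\<tau> \<in> cells_of_dim P k" "\<tau>' \<in> cells_of_dim P k" for \<tau> \<tau>'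
      using that keys_diff[of "Poly_Mapping.single \<tau> (1::'f)" "Poly_Mapping.single \<tau>' 1"]
      by (auto simp: chains_def)
    show ?thesis unfolding cell_boundary_def
      by (intro s chains_closed m) (use that closed fin in \<open>auto simp: cells_of_dim_def cell_dim_def front_face_def back_face_def split: prod.splits\<close>)
  qed
  show ?thesis
  proof
    fix b :: "'f chain" assume "b \<in> boundaries N P k"
    then obtain c where c: "c \<in> chains P (Suc k)" "b = boundary N c" by (auto simp: boundaries_def)
    have "boundary N c \<in> chains P k"
    proof -
      have s: "(\<Sum>x\<in>S. f x) \<in> (chains P k :: 'f chain set)" if "\<And>x. x \<in> S \<Longrightarrow> f x \<in> chains P k" for S :: "cell set" and f
        using that by (induction S rule: infinite_finite_induct) (auto intro: chains_closed)
      show ?thesis unfolding boundary_def by (intro s chains_closed cl) (use c in \<open>auto simp: chains_def\<close>)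
    qed
    moreover have "boundary N (boundary N c) = 0"
      unfolding boundary_def[of N c] boundary_sum boundary_scale
      by (rule sum.neutral) (use c fin in \<open>auto simp: chains_def cells_of_dim_def boundary_cell_boundary scale_chain_simps\<close>)
    ultimately show "b \<in> cycles N P k" using c by (simp add: cycles_def)
  qed
qed

end

theory Submission
  imports Defs "HOL-Analysis.L2_Norm" "HOL-Combinatorics.Transposition"
begin

text \<open>
  Passing to the complementary set of dual plaquettes turns the model with odds \<open>x = p / (1 - p)\<close> into
  the one with odds \<open>q / x\<close>, up to a density whose values differ by a factor of at most \<open>q ^ 2 ^ d\<close>:
  the exponent in the density is the rank of a map to the homology of the torus. By Poincare duality \<open>\<phi>\<^sub>*\<close> vanishes for \<open>P\<close> iff it is
  surjective for the dual of \<open>P\<close>. So at the self-dual odds \<open>sqrt q\<close> the map is non-zero with probability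
  bounded below in \<open>N\<close>.

  The image of \<open>\<phi>\<^sub>*\<close> increases with \<open>P\<close>, and the translations, reflections and permutations of the
  torus preserve the measure. As the characteristic is not \<open>2\<close>, no proper non-zero subspace of the
  homology is invariant under all of them. Hence a likely proper image can be moved by a symmetry, and
  positive association gives a larger image at the price of squaring the probability. After at most
  \<open>2 ^ d\<close> rounds \<open>\<phi>\<^sub>*\<close> is surjective, with probability still bounded below in \<open>N\<close>.

  Finally, surjectivity is an increasing event with a large symmetry group, so all influences on it in an
  orbit coincide. An entropy inequality for the martingale that reveals the plaquettes one by one, with
  a monotone coupling replacing independence, bounds the sum of the influences below by a multiple of the
  variance times the logarithm of the orbit size. Therefore the derivative of the probability in the odds
  diverges, and surjectivity becomes almost certain above \<open>sqrt q\<close>. Duality gives the other half.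
\<close>

section \<open>Entropy and influences\<close>

text \<open>Two features that hold uniformly in \<open>N\<close> replace independence. Up to a
  constant, the Betti number is minus the rank of the boundary map on the chosen plaquettes; ranks
  of vectors are submodular, and for q \<ge> 1 this is the lattice condition behind positive
  association. Also, one more plaquette changes the weight by a bounded factor only, so that
  covariances control martingale increments. The obstacle in the entropy argument is that revealing
  an early plaquette alters the law of all later ones. As conditional probabilities increase with
  the history, two histories that differ in one plaquette can be continued jointly with one always
  inside the other. The squared differences of the increments of the two martingales then add up to
  at most the difference of their starting values, and this is just the increment that is being paid
  for. The constants at the self-dual odds depend on \<open>d\<close> and \<open>q\<close> alone
  because the middle homology is generated by at most \<open>2 ^ d\<close> coordinate subtori. This
  number bounds both the exponent of the density and the number of amplification rounds.\<close>

definition xlogx :: "real \<Rightarrow> real" where "xlogx t = t * ln t"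

text \<open>Entropy is at most variance over mean, by ln t \<le> t - 1. With a = u^2 and b = v^2 the
  variance is c (1 - c) (u + v)^2 (u - v)^2, and c (1 - c) (u + v)^2 is at most twice the mean. The
  result is free of \<open>c\<close> and involves only a difference of square roots, which a
  coupling can control.\<close>

lemma two_point_entropy:
  fixes a b c :: real
  assumes "0 \<le> a" "0 \<le> b" "0 \<le> c" "c \<le> 1"
  shows "c * xlogx a + (1 - c) * xlogx b - xlogx (c * a + (1 - c) * b)
    \<le> 2 * (a + b - 2 * sqrt (a * b))"
proof (cases "c * a + (1 - c) * b = 0")
  case True
  then have "c * a = 0" "(1 - c) * b = 0"
    using assms by (smt (verit) mult_nonneg_nonneg)+
  moreover have "0 \<le> (sqrt a - sqrt b)\<^sup>2" by simp
  then have "2 * sqrt (a * b) \<le> a + b"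
    using assms by (simp add: power2_diff real_sqrt_mult)
  ultimately show ?thesis
    using True by (auto simp: xlogx_def)
next
  case False
  define m where "m = c * a + (1 - c) * b"
  have "m > 0" using False assms by (smt (verit) m_def mult_nonneg_nonneg)
  have le: "t * ln t - t * ln m \<le> t * (t / m - 1)" if "0 \<le> t" for t
  proof (cases "t = 0")
    case False
    then have "ln (t / m) \<le> t / m - 1" using that \<open>m > 0\<close> by (intro ln_le_minus_one) simp
    then have "t * (ln t - ln m) \<le> t * (t / m - 1)"
      using that \<open>m > 0\<close> False by (intro mult_left_mono) (auto simp: ln_div)
    then show ?thesis by (simp add: algebra_simps)
  qed simp
  have "c * xlogx a + (1 - c) * xlogx b - xlogx m
      = c * (a * ln a - a * ln m) + (1 - c) * (b * ln b - b * ln m)"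
    by (simp add: xlogx_def m_def algebra_simps)
  also have "\<dots> \<le> c * (a * (a / m - 1)) + (1 - c) * (b * (b / m - 1))"
    using assms by (intro add_mono mult_left_mono le) auto
  also have "\<dots> = (c * a * a + (1 - c) * b * b - m * m) / m"
    using \<open>m > 0\<close> by (simp add: field_simps) (simp add: m_def algebra_simps)
  also have "c * a * a + (1 - c) * b * b - m * m = c * (1 - c) * (a - b)\<^sup>2"
    by (simp add: m_def power2_eq_square algebra_simps)
  also have "c * (1 - c) * (a - b)\<^sup>2 / m \<le> 2 * (a + b - 2 * sqrt (a * b))"
  proof -
    define u where "u = sqrt a"
    define v where "v = sqrt b"
    have uv: "a = u\<^sup>2" "b = v\<^sup>2" "u \<ge> 0" "v \<ge> 0" using assms by (auto simp: u_def v_def)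
    have "c * (1 - c) * (u + v)\<^sup>2 \<le> c * (1 - c) * (2 * (u\<^sup>2 + v\<^sup>2))"
    proof (rule mult_left_mono)
      show "(u + v)\<^sup>2 \<le> 2 * (u\<^sup>2 + v\<^sup>2)"
        using zero_le_power2[of "u - v"] by (simp add: power2_eq_square algebra_simps)
    qed (use assms in simp)
    also have "\<dots> = 2 * ((1 - c) * (c * u\<^sup>2) + c * ((1 - c) * v\<^sup>2))" by (simp add: algebra_simps)
    also have "\<dots> \<le> 2 * (1 * (c * u\<^sup>2) + 1 * ((1 - c) * v\<^sup>2))"
      using assms by (intro mult_left_mono add_mono mult_right_mono) auto
    finally have 1: "c * (1 - c) * (u + v)\<^sup>2 \<le> 2 * m" by (simp add: m_def uv)
    have "c * (1 - c) * (a - b)\<^sup>2 = (u - v)\<^sup>2 * (c * (1 - c) * (u + v)\<^sup>2)"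
      by (simp add: uv power2_eq_square algebra_simps)
    also have "\<dots> \<le> (u - v)\<^sup>2 * (2 * m)" using 1 by (intro mult_left_mono) auto
    also have "\<dots> = 2 * (a + b - 2 * sqrt (a * b)) * m"
      using uv by (simp add: real_sqrt_mult power2_eq_square algebra_simps)
    finally show ?thesis using \<open>m > 0\<close> by (simp add: field_simps)
  qed
  finally show ?thesis by (simp add: m_def)
qed

text \<open>The inequality ln s \<le> s - 1 at s = l / t. The right side is a combination of t and
  t^2, so it survives averaging; \<open>l\<close> is optimized only afterwards, in
  \<open>stage_entropy_lower\<close>.\<close>

lemma xlogx_square_lower:
  assumes "0 < l" "0 \<le> t"
  shows "xlogx (t\<^sup>2) \<ge> t\<^sup>2 * (2 * ln l) + 2 * t\<^sup>2 - 2 * l * t"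
proof (cases "t = 0")
  case False
  with assms have "t > 0" by simp
  have "ln (l / t) \<le> l / t - 1" using assms \<open>t > 0\<close> by (intro ln_le_minus_one) simp
  then have "t\<^sup>2 * (2 * ln l - 2 * ln t) \<le> t\<^sup>2 * (2 * (l / t - 1))"
    using assms \<open>t > 0\<close> by (intro mult_left_mono) (auto simp: ln_div)
  moreover have "t\<^sup>2 * (2 * (l / t - 1)) = 2 * l * t - 2 * t\<^sup>2"
    using \<open>t > 0\<close> by (simp add: power2_eq_square field_simps)
  ultimately show ?thesis using \<open>t > 0\<close> by (simp add: xlogx_def ln_realpow algebra_simps)
qed (simp add: xlogx_def)

text \<open>Three terms, because a monotone coupling of two biased coins has three outcomes: both,
  only the likelier one, neither. The \<open>w k\<close> will be their probabilities.\<close>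

lemma Cauchy_Schwarz_three:
  fixes w x y :: "nat \<Rightarrow> real"
  assumes "\<And>k. 0 \<le> w k" "\<And>k. 0 \<le> x k" "\<And>k. 0 \<le> y k"
  shows "(\<Sum>k<3. w k * sqrt (x k * y k)) \<le> sqrt ((\<Sum>k<3. w k * x k) * (\<Sum>k<3. w k * y k))"
proof -
  have "(\<Sum>k<3. w k * sqrt (x k * y k))
      = (\<Sum>k<3. \<bar>sqrt (w k * x k)\<bar> * \<bar>sqrt (w k * y k)\<bar>)"
    using assms by (intro sum.cong) (auto simp: real_sqrt_mult)
  also have "\<dots> \<le> L2_set (\<lambda>k. sqrt (w k * x k)) {..<3} * L2_set (\<lambda>k. sqrt (w k * y k)) {..<3}"
    by (rule L2_set_mult_ineq)
  also have "\<dots> = sqrt ((\<Sum>k<3. w k * x k) * (\<Sum>k<3. w k * y k))"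
    unfolding L2_set_def real_sqrt_mult[symmetric] by (simp add: assms)
  finally show ?thesis .
qed

text \<open>The list \<open>es\<close> holds the coordinates still to be revealed, \<open>h\<close>
  those already found present, and \<open>c es h\<close> is the probability that the head of
  \<open>es\<close> is present given this history. Of positive association only
  \<open>c_mono\<close> is kept: it makes the monotone coupling possible.\<close>

locale exploration =
  fixes c :: "'a list \<Rightarrow> 'a set \<Rightarrow> real" and f :: "'a set \<Rightarrow> real"
  assumes c_ge_0: "0 \<le> c es h" and c_le_1: "c es h \<le> 1"
    and c_mono: "h \<subseteq> h' \<Longrightarrow> c es h \<le> c es h'"
    and f_ge_0: "0 \<le> f h" and f_le_1: "f h \<le> 1"
    and f_mono: "h \<subseteq> h' \<Longrightarrow> f h \<le> f h'"
begin

fun mean :: "'a list \<Rightarrow> 'a set \<Rightarrow> real" where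
  "mean [] h = f h"
| "mean (e # es) h = c (e # es) h * mean es (insert e h) + (1 - c (e # es) h) * mean es h"

fun delta :: "'a list \<Rightarrow> 'a set \<Rightarrow> real" where
  "delta [] h = 0"
| "delta (e # es) h = mean es (insert e h) - mean es h"

text \<open>The expectation of \<open>G\<close> after \<open>j\<close> further revelations. The
  value 0 for an exhausted list is a mere default.\<close>

fun stage :: "nat \<Rightarrow> ('a list \<Rightarrow> 'a set \<Rightarrow> real) \<Rightarrow> 'a list \<Rightarrow> 'a set \<Rightarrow> real" where
  "stage 0 G es h = G es h"
| "stage (Suc j) G [] h = 0"
| "stage (Suc j) G (e # es) h
    = c (e # es) h * stage j G es (insert e h) + (1 - c (e # es) h) * stage j G es h"

text \<open>The next increment D of the martingale \<open>mean\<close> is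
  \<open>(1 - c) * delta\<close> with probability \<open>c\<close> and \<open>- c * delta\<close>
  otherwise. The three definitions are the conditional expectations of D^2, of |D| and of D^2 ln
  (D^2).\<close>

definition incr_sq :: "'a list \<Rightarrow> 'a set \<Rightarrow> real" where
  "incr_sq es h = c es h * (1 - c es h) * (delta es h)\<^sup>2"

definition incr_abs :: "'a list \<Rightarrow> 'a set \<Rightarrow> real" where
  "incr_abs es h = 2 * (c es h * (1 - c es h) * delta es h)"

definition incr_xlogx :: "'a list \<Rightarrow> 'a set \<Rightarrow> real" where
  "incr_xlogx es h = c es h * xlogx (((1 - c es h) * delta es h)\<^sup>2)
     + (1 - c es h) * xlogx ((c es h * delta es h)\<^sup>2)"

text \<open>The expected squared difference of the \<open>j\<close>-th increments of two coupled
  runs started from \<open>h\<close> and \<open>h'\<close>. The next coordinate is present in both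
  runs, only in the upper one, or in neither, with probabilities c, c' - c and 1 - c'.\<close>

fun couple :: "nat \<Rightarrow> 'a list \<Rightarrow> 'a set \<Rightarrow> 'a set \<Rightarrow> real" where
  "couple 0 es h h' = c es h * ((1 - c es h') * delta es h' - (1 - c es h) * delta es h)\<^sup>2
     + (c es h' - c es h) * ((1 - c es h') * delta es h' + c es h * delta es h)\<^sup>2
     + (1 - c es h') * (c es h' * delta es h' - c es h * delta es h)\<^sup>2"
| "couple (Suc j) [] h h' = 0"
| "couple (Suc j) (e # es) h h' = c (e # es) h * couple j es (insert e h) (insert e h')
     + (c (e # es) h' - c (e # es) h) * couple j es h (insert e h')
     + (1 - c (e # es) h') * couple j es h h'"

lemma mean_mono: "h \<subseteq> h' \<Longrightarrow> mean es h \<le> mean es h'"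
proof (induction es arbitrary: h h')
  case (Cons e es)
  let ?c = "c (e # es) h" and ?c' = "c (e # es) h'"
  have cs: "0 \<le> ?c" "?c \<le> ?c'" "?c' \<le> 1" using c_ge_0 c_le_1 c_mono[OF Cons.prems] by auto
  have m: "mean es (insert e h) \<le> mean es (insert e h')" "mean es h \<le> mean es (insert e h')"
     "mean es h \<le> mean es h'"
    using Cons.prems by (auto intro!: Cons.IH)
  \<comment> \<open>Both means are written as averages over the same three outcomes of the coupling
    and compared outcome by outcome.\<close>
  have "mean (e # es) h = ?c * mean es (insert e h) + (?c' - ?c) * mean es h + (1 - ?c') * mean es h"
    by (simp add: algebra_simps)
  also have "\<dots> \<le> ?c * mean es (insert e h') + (?c' - ?c) * mean es (insert e h') + (1 - ?c') * mean es h'"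
    using cs m by (intro add_mono mult_left_mono) auto
  also have "\<dots> = mean (e # es) h'" by (simp add: algebra_simps)
  finally show ?case .
qed (simp add: f_mono)

lemma mean_ge_0: "0 \<le> mean es h" and mean_le_1: "mean es h \<le> 1"
proof -
  have "0 \<le> mean es h \<and> mean es h \<le> 1"
  proof (induction es arbitrary: h)
    case (Cons e es)
    then show ?case using c_ge_0[of "e # es" h] c_le_1[of "e # es" h]
      by (auto intro!: add_nonneg_nonneg mult_nonneg_nonneg convex_bound_le)
  qed (simp add: f_ge_0 f_le_1)
  then show "0 \<le> mean es h" "mean es h \<le> 1" by auto
qed

lemma delta_ge_0: "0 \<le> delta es h" and delta_le_1: "delta es h \<le> 1"
proof -
  show "0 \<le> delta es h" by (cases es) (auto intro!: mean_mono)
  show "delta es h \<le> 1"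
  proof (cases es)
    case (Cons e es')
    then show ?thesis using mean_ge_0[of es' h] mean_le_1[of es' "insert e h"] by simp
  qed simp
qed

lemma stage_mono:
  assumes "\<And>es h. G es h \<le> G' es h"
  shows "stage j G es h \<le> stage j G' es h"
proof (induction j arbitrary: es h)
  case (Suc j)
  show ?case by (cases es) (auto simp: c_ge_0 c_le_1 intro!: add_mono mult_left_mono Suc)
qed (simp add: assms)

lemma stage_linear:
  "stage j (\<lambda>es h. a * G es h + b * G' es h) es h = a * stage j G es h + b * stage j G' es h"
  by (induction j G es h rule: stage.induct) (auto simp: algebra_simps)

lemma stage_nonneg:
  assumes "\<And>es h. 0 \<le> G es h"
  shows "0 \<le> stage j G es h"
proof (induction j arbitrary: es h)
  case (Suc j)
  show ?case by (cases es) (auto simp: c_ge_0 c_le_1 intro!: add_nonneg_nonneg mult_nonneg_nonneg Suc)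
qed (simp add: assms)

lemma incr_sq_nonneg: "0 \<le> incr_sq es h"
  by (simp add: incr_sq_def c_ge_0 c_le_1)

text \<open>The difference of the two coupled martingales is again a martingale, so its squared
  increments add up to the final mean square minus the initial square. The final difference lies
  between 0 and 1, where a square is at most its root, and its expectation is
  \<open>mean es h' - mean es h\<close>.\<close>

lemma sum_couple:
  "h \<subseteq> h' \<Longrightarrow> (\<Sum>j<length es. couple j es h h') + (mean es h' - mean es h)\<^sup>2 \<le> mean es h' - mean es h"
proof (induction es arbitrary: h h')
  case Nil
  then have "0 \<le> f h' - f h" "f h' - f h \<le> 1"
    using f_mono f_ge_0[of h] f_le_1[of h'] by (auto simp: algebra_simps intro: order_trans)
  then have "(f h' - f h)\<^sup>2 \<le> (f h' - f h) * 1"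
    unfolding power2_eq_square by (intro mult_left_mono)
  then show ?case by simp
next
  case (Cons e es)
  let ?c = "c (e # es) h" and ?c' = "c (e # es) h'"
  define m11 where "m11 = mean es (insert e h') - mean es (insert e h)"
  define m01 where "m01 = mean es (insert e h') - mean es h"
  define m00 where "m00 = mean es h' - mean es h"
  have cs: "0 \<le> ?c" "?c \<le> ?c'" "?c' \<le> 1" using c_ge_0 c_le_1 c_mono[OF Cons.prems] by auto
  have "(\<Sum>j<length (e # es). couple j (e # es) h h')
     = couple 0 (e # es) h h' + (?c * (\<Sum>j<length es. couple j es (insert e h) (insert e h'))
       + (?c' - ?c) * (\<Sum>j<length es. couple j es h (insert e h'))
       + (1 - ?c') * (\<Sum>j<length es. couple j es h h'))"
    by (simp only: length_Cons sum.lessThan_Suc_shift couple.simps(3) sum.distrib sum_distrib_left)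
  also have "\<dots> \<le> couple 0 (e # es) h h' + (?c * (m11 - m11\<^sup>2) + (?c' - ?c) * (m01 - m01\<^sup>2)
      + (1 - ?c') * (m00 - m00\<^sup>2))"
    using cs Cons.prems Cons.IH[of "insert e h" "insert e h'"] Cons.IH[of h "insert e h'"] Cons.IH[of h h']
    unfolding m11_def m01_def m00_def
    by (intro add_left_mono add_mono mult_left_mono) (auto simp: algebra_simps)
  \<comment> \<open>A variance: the mean square of the new difference over the three outcomes minus
    the square of its mean.\<close>
  also have "couple 0 (e # es) h h' = ?c * m11\<^sup>2 + (?c' - ?c) * m01\<^sup>2 + (1 - ?c') * m00\<^sup>2
      - (mean (e # es) h' - mean (e # es) h)\<^sup>2"
    by (simp add: m11_def m01_def m00_def power2_eq_square algebra_simps)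
  finally show ?case
    by (simp add: m11_def m01_def m00_def algebra_simps)
qed

text \<open>Expanding the square leaves twice a mixed moment, to which Cauchy-Schwarz applies.
  Rearranged: the squared difference of the roots of the two averages is at most
  \<open>couple\<close>, as needed after \<open>two_point_entropy\<close>.\<close>

lemma couple_bound:
  "h \<subseteq> h' \<Longrightarrow> j < length es \<Longrightarrow>
     stage j incr_sq es h + stage j incr_sq es h' - couple j es h h'
       \<le> 2 * sqrt (stage j incr_sq es h * stage j incr_sq es h')"
proof (induction j es h h' rule: couple.induct)
  case (1 es h h')
  let ?c = "c es h" and ?c' = "c es h'" and ?d = "delta es h" and ?d' = "delta es h'"
  define w where "w = (\<lambda>k::nat. if k = 0 then ?c else if k = 1 then ?c' - ?c else 1 - ?c')"
  define x where "x = (\<lambda>k::nat. if k = 0 then (1 - ?c) * ?d else - (?c * ?d))"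
  define y where "y = (\<lambda>k::nat. if k < 2 then (1 - ?c') * ?d' else - (?c' * ?d'))"
  have s3: "sum g {..<3} = g 0 + g 1 + g 2" for g :: "nat \<Rightarrow> real"
    by (simp add: numeral_3_eq_3 numeral_2_eq_2)
  have w0: "w k \<ge> 0" for k using c_mono[OF 1(1)] by (auto simp: w_def c_ge_0 c_le_1)
  have v: "incr_sq es h = (\<Sum>k<3. w k * (x k)\<^sup>2)" "incr_sq es h' = (\<Sum>k<3. w k * (y k)\<^sup>2)"
    "couple 0 es h h' = (\<Sum>k<3. w k * (y k - x k)\<^sup>2)"
    by (simp_all add: s3 w_def x_def y_def incr_sq_def power2_eq_square algebra_simps)
  have "incr_sq es h + incr_sq es h' - couple 0 es h h' = 2 * (\<Sum>k<3. w k * (x k * y k))"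
    unfolding v s3 power2_eq_square by (simp add: algebra_simps)
  also have "\<dots> \<le> 2 * (\<Sum>k<3. w k * sqrt ((x k)\<^sup>2 * (y k)\<^sup>2))"
    using w0 by (intro mult_left_mono sum_mono) (auto simp: real_sqrt_mult abs_mult[symmetric])
  also have "\<dots> \<le> 2 * sqrt (incr_sq es h * incr_sq es h')"
    unfolding v using w0 by (intro mult_left_mono Cauchy_Schwarz_three) auto
  finally show ?case by simp
next
  case (3 j e es h h')
  let ?c = "c (e # es) h" and ?c' = "c (e # es) h'"
  define w where "w = (\<lambda>k::nat. if k = 0 then ?c else if k = 1 then ?c' - ?c else 1 - ?c')"
  define x where "x = (\<lambda>k::nat. stage j incr_sq es (if k = 0 then insert e h else h))"
  define y where "y = (\<lambda>k::nat. stage j incr_sq es (if k < 2 then insert e h' else h'))"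
  define D where "D = (\<lambda>k::nat. couple j es (if k = 0 then insert e h else h) (if k < 2 then insert e h' else h'))"
  have s3: "sum g {..<3} = g 0 + g 1 + g 2" for g :: "nat \<Rightarrow> real"
    by (simp add: numeral_3_eq_3 numeral_2_eq_2)
  have w0: "w k \<ge> 0" for k using c_mono[OF 3(4)] by (auto simp: w_def c_ge_0 c_le_1)
  have xy: "x k \<ge> 0" "y k \<ge> 0" for k by (auto simp: x_def y_def intro!: stage_nonneg incr_sq_nonneg)
  have v: "stage (Suc j) incr_sq (e # es) h = (\<Sum>k<3. w k * x k)"
    "stage (Suc j) incr_sq (e # es) h' = (\<Sum>k<3. w k * y k)"
    "couple (Suc j) (e # es) h h' = (\<Sum>k<3. w k * D k)"
    by (simp_all add: s3 w_def x_def y_def D_def algebra_simps)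
  have IH: "x k + y k - D k \<le> 2 * sqrt (x k * y k)" for k
    using 3 by (auto simp: x_def y_def D_def)
  have "(\<Sum>k<3. w k * x k) + (\<Sum>k<3. w k * y k) - (\<Sum>k<3. w k * D k) = (\<Sum>k<3. w k * (x k + y k - D k))"
    unfolding s3 by (simp add: algebra_simps)
  also have "\<dots> \<le> (\<Sum>k<3. w k * (2 * sqrt (x k * y k)))"
    using w0 IH by (intro sum_mono mult_left_mono)
  also have "\<dots> = 2 * (\<Sum>k<3. w k * sqrt (x k * y k))" by (simp add: sum_distrib_left algebra_simps)
  also have "\<dots> \<le> 2 * sqrt ((\<Sum>k<3. w k * x k) * (\<Sum>k<3. w k * y k))"
    using w0 xy by (intro mult_left_mono Cauchy_Schwarz_three) auto
  finally show ?case unfolding v .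
qed auto

text \<open>The terms are entropies of squared increments. Revealing the first coordinate splits
  each later one into an average of entropies over the two histories and the entropy of a two-valued
  function. The latter is at most twice \<open>couple\<close>, and these add up to at most
  \<open>2 * delta\<close> by \<open>sum_couple\<close>. The first increment costs another
  \<open>2 * delta\<close>, whence the factor 4.\<close>

lemma sum_entropy_le:
  "(\<Sum>j<length es. stage j incr_xlogx es h - xlogx (stage j incr_sq es h))
     \<le> 4 * (\<Sum>j<length es. stage j delta es h)"
proof (induction es arbitrary: h)
  case (Cons e es)
  let ?c = "c (e # es) h" and ?d = "delta (e # es) h"
  let ?v = "\<lambda>j h. stage j incr_sq es h" and ?F = "\<lambda>j h. stage j incr_xlogx es h"
  have cs: "0 \<le> ?c" "?c \<le> 1" using c_ge_0 c_le_1 by auto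
  define a b where "a = ((1 - ?c) * ?d)\<^sup>2" and "b = (?c * ?d)\<^sup>2"
  have "incr_xlogx (e # es) h - xlogx (incr_sq (e # es) h)
      = ?c * xlogx a + (1 - ?c) * xlogx b - xlogx (?c * a + (1 - ?c) * b)"
    by (simp only: incr_xlogx_def incr_sq_def a_def b_def)
      (simp add: power2_eq_square algebra_simps)
  also have "\<dots> \<le> 2 * (a + b - 2 * sqrt (a * b))"
    using cs by (intro two_point_entropy) (auto simp: a_def b_def)
  \<comment> \<open>The roots of \<open>a\<close> and \<open>b\<close> are
    \<open>(1 - c) * delta\<close> and \<open>c * delta\<close>; they differ by
    \<open>(1 - 2 * c) * delta\<close>.\<close>
  also have "\<dots> = 2 * ((1 - 2 * ?c)\<^sup>2 * ?d * ?d)"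
    using cs delta_ge_0[of "e # es" h]
    by (simp add: a_def b_def real_sqrt_mult del: delta.simps) (simp add: power2_eq_square algebra_simps del: delta.simps)
  also have "\<dots> \<le> 2 * (1 * ?d * 1)"
    using cs delta_ge_0[of "e # es" h] delta_le_1[of "e # es" h]
    by (intro mult_left_mono mult_mono abs_square_le_1[THEN iffD2]) auto
  finally have first: "incr_xlogx (e # es) h - xlogx (incr_sq (e # es) h) \<le> 2 * ?d" by simp
  have step: "stage (Suc j) incr_xlogx (e # es) h - xlogx (stage (Suc j) incr_sq (e # es) h)
     \<le> ?c * (?F j (insert e h) - xlogx (?v j (insert e h))) + (1 - ?c) * (?F j h - xlogx (?v j h))
       + 2 * couple j es h (insert e h)" if "j < length es" for j
  proof -
    have "?c * xlogx (?v j (insert e h)) + (1 - ?c) * xlogx (?v j h)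
       - xlogx (?c * ?v j (insert e h) + (1 - ?c) * ?v j h)
      \<le> 2 * (?v j (insert e h) + ?v j h - 2 * sqrt (?v j (insert e h) * ?v j h))"
      using cs by (intro two_point_entropy stage_nonneg incr_sq_nonneg)
    also have "\<dots> \<le> 2 * couple j es h (insert e h)"
      using couple_bound[OF subset_insertI that, of h e] by (simp add: mult.commute)
    finally show ?thesis by (simp add: algebra_simps)
  qed
  have "(\<Sum>j<length (e # es). stage j incr_xlogx (e # es) h - xlogx (stage j incr_sq (e # es) h))
     = (incr_xlogx (e # es) h - xlogx (incr_sq (e # es) h))
      + (\<Sum>j<length es. stage (Suc j) incr_xlogx (e # es) h - xlogx (stage (Suc j) incr_sq (e # es) h))"
    by (simp only: length_Cons sum.lessThan_Suc_shift stage.simps(1))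
  also have "\<dots> \<le> 2 * ?d + (\<Sum>j<length es. ?c * (?F j (insert e h) - xlogx (?v j (insert e h)))
       + (1 - ?c) * (?F j h - xlogx (?v j h)) + 2 * couple j es h (insert e h))"
    by (intro add_mono first sum_mono step) auto
  also have "\<dots> = 2 * ?d + ?c * (\<Sum>j<length es. ?F j (insert e h) - xlogx (?v j (insert e h)))
      + (1 - ?c) * (\<Sum>j<length es. ?F j h - xlogx (?v j h)) + 2 * (\<Sum>j<length es. couple j es h (insert e h))"
    by (simp add: sum.distrib sum_distrib_left del: delta.simps)
  also have "\<dots> \<le> 2 * ?d + ?c * (4 * (\<Sum>j<length es. stage j delta es (insert e h)))
      + (1 - ?c) * (4 * (\<Sum>j<length es. stage j delta es h)) + 2 * ?d"
  proof -
    have "(\<Sum>j<length es. couple j es h (insert e h)) \<le> ?d"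
      using sum_couple[OF subset_insertI, of es h e] zero_le_power2[of "mean es (insert e h) - mean es h"]
      unfolding delta.simps by linarith
    then show ?thesis using cs by (intro add_mono mult_left_mono Cons.IH) auto
  qed
  also have "\<dots> = 4 * (stage 0 delta (e # es) h + (\<Sum>j<length es. stage (Suc j) delta (e # es) h))"
    by (simp only: stage.simps sum.distrib sum_distrib_left[symmetric]) (simp add: algebra_simps)
  also have "\<dots> = 4 * (\<Sum>j<length (e # es). stage j delta (e # es) h)"
    by (simp only: length_Cons sum.lessThan_Suc_shift)
  finally show ?case .
qed simp

text \<open>Orthogonality of martingale increments: their variances add up to the variance of
  \<open>f\<close>, which for a 0-1 valued \<open>f\<close> is expressed by the mean.\<close>

lemma sum_incr_sq:
  assumes "\<And>h. f h * f h = f h"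
  shows "(\<Sum>j<length es. stage j incr_sq es h) = mean es h * (1 - mean es h)"
proof (induction es arbitrary: h)
  case (Cons e es)
  have "(\<Sum>j<length (e # es). stage j incr_sq (e # es) h) = incr_sq (e # es) h +
     (\<Sum>j<length es. stage (Suc j) incr_sq (e # es) h)"
    by (simp only: length_Cons sum.lessThan_Suc_shift stage.simps(1))
  also have "\<dots> = incr_sq (e # es) h + (c (e # es) h * (\<Sum>j<length es. stage j incr_sq es (insert e h))
      + (1 - c (e # es) h) * (\<Sum>j<length es. stage j incr_sq es h))"
    by (simp only: stage.simps sum.distrib sum_distrib_left[symmetric])
  also have "\<dots> = mean (e # es) h * (1 - mean (e # es) h)"
    unfolding Cons.IH by (simp add: incr_sq_def power2_eq_square algebra_simps)
  finally show ?case .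
qed (use assms in \<open>simp add: algebra_simps\<close>)

text \<open>Let v and a be the averaged second and first absolute moments of the increment. The
  choice l = v / a gives the lower bound v ln (v / a^2). Then ln t \<le> t - 1 at t = V a^2 / (A v)
  trades the logarithm depending on \<open>j\<close> for the fixed ln (V / A) and terms that can be
  summed over \<open>j\<close>.\<close>

lemma stage_entropy_lower:
  assumes "0 < A" "0 < V"
  shows "stage j incr_xlogx es h - xlogx (stage j incr_sq es h)
     \<ge> stage j incr_sq es h * ln (V / A) + stage j incr_sq es h - V * (stage j incr_abs es h)\<^sup>2 / A"
proof -
  let ?v = "stage j incr_sq es h" and ?a = "stage j incr_abs es h" and ?F = "stage j incr_xlogx es h"
  have F: "?F \<ge> (2 * ln l + 2) * ?v - 2 * l * ?a" if "0 < l" for l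
  proof -
    have "(2 * ln l + 2) * incr_sq es h + (- 2 * l) * incr_abs es h \<le> incr_xlogx es h" for es h
    proof -
      let ?c = "c es h" and ?d = "delta es h"
      have cs: "0 \<le> ?c" "?c \<le> 1" "0 \<le> ?d" using c_ge_0 c_le_1 delta_ge_0 by auto
      have "?c * (((1 - ?c) * ?d)\<^sup>2 * (2 * ln l) + 2 * ((1 - ?c) * ?d)\<^sup>2 - 2 * l * ((1 - ?c) * ?d))
        + (1 - ?c) * ((?c * ?d)\<^sup>2 * (2 * ln l) + 2 * (?c * ?d)\<^sup>2 - 2 * l * (?c * ?d)) \<le> incr_xlogx es h"
        unfolding incr_xlogx_def using cs that
        by (intro add_mono mult_left_mono xlogx_square_lower) auto
      then show ?thesis
        by (simp add: incr_sq_def incr_abs_def power2_eq_square algebra_simps)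
    qed
    from stage_mono[where j=j and es=es and h=h, OF this] show ?thesis
      unfolding stage_linear by simp
  qed
  have v0: "?v \<ge> 0" and a0: "?a \<ge> 0"
    by (auto intro!: stage_nonneg simp: incr_sq_nonneg incr_abs_def c_ge_0 c_le_1 delta_ge_0)
  show ?thesis
  proof (cases "?v = 0")
    case True
    have "?F \<ge> 0"
    proof (rule ccontr)
      assume "\<not> 0 \<le> ?F"
      \<comment> \<open>For v = 0 the bound \<open>F\<close> says that ?F is at least
        \<open>- 2 * l * ?a\<close> for every positive \<open>l\<close>; this \<open>l\<close> is
        small enough to contradict a negative ?F.\<close>
      define l where "l = - ?F / (4 * (?a + 1))"
      have "l > 0" using \<open>\<not> 0 \<le> ?F\<close> a0 unfolding l_def by (intro divide_pos_pos) auto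
      have "2 * l * ?a \<le> 2 * l * (?a + 1)" using \<open>l > 0\<close> by simp
      also have "\<dots> = - ?F / 2" using a0 by (simp add: l_def field_simps)
      finally show False using F[OF \<open>l > 0\<close>] True \<open>\<not> 0 \<le> ?F\<close> by simp
    qed
    then show ?thesis using True assms by (simp add: xlogx_def) (smt (verit) divide_nonneg_pos mult_nonneg_nonneg zero_le_power2)
  next
    case False
    with v0 have v: "?v > 0" by simp
    have a: "?a > 0"
    proof (rule ccontr)
      assume "\<not> ?a > 0"
      then have "?a = 0" using a0 by simp
      have "stage j incr_sq es h \<le> stage j incr_abs es h"
      proof (rule stage_mono)
        fix es h
        have "delta es h * delta es h \<le> delta es h * 1"
          by (intro mult_left_mono delta_ge_0 delta_le_1)
        then have "c es h * (1 - c es h) * (delta es h)\<^sup>2 \<le> c es h * (1 - c es h) * delta es h"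
          unfolding power2_eq_square by (intro mult_left_mono) (auto simp: c_ge_0 c_le_1)
        moreover have "0 \<le> c es h * (1 - c es h) * delta es h"
          by (simp add: c_ge_0 c_le_1 delta_ge_0)
        ultimately show "incr_sq es h \<le> incr_abs es h"
          unfolding incr_sq_def incr_abs_def by linarith
      qed
      then show False using \<open>?a = 0\<close> v by simp
    qed
    have "?F \<ge> (2 * ln (?v / ?a) + 2) * ?v - 2 * (?v / ?a) * ?a" using F[of "?v / ?a"] v a by simp
    then have 1: "?F - xlogx ?v \<ge> ?v * (2 * ln (?v / ?a) - ln ?v)"
      using a by (simp add: xlogx_def algebra_simps)
    have "ln (V * ?a\<^sup>2 / (A * ?v)) \<le> V * ?a\<^sup>2 / (A * ?v) - 1"
      using assms v a by (intro ln_le_minus_one) auto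
    then have "?v * ln (V * ?a\<^sup>2 / (A * ?v)) \<le> ?v * (V * ?a\<^sup>2 / (A * ?v) - 1)"
      using v by (intro mult_left_mono) auto
    also have "\<dots> = V * ?a\<^sup>2 / A - ?v" using v assms by (simp add: field_simps)
    also have "ln (V * ?a\<^sup>2 / (A * ?v)) = ln (V / A) - (2 * ln (?v / ?a) - ln ?v)"
      using assms v a by (simp add: ln_div ln_mult ln_realpow)
    finally show ?thesis using 1 by (simp add: algebra_simps)
  qed
qed

text \<open>Summed over \<open>j\<close>, the second moments give \<open>V\<close> and the squared
  first moments at most \<open>A\<close>, so the two correction terms of
  \<open>stage_entropy_lower\<close> together are nonnegative. This is an inequality of Talagrand
  type: if all influences are small, so is \<open>A\<close>, and the logarithm forces their sum to
  be large.\<close>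

theorem entropy_influence:
  assumes boolean: "\<And>h. f h * f h = f h"
    and "0 < A" and A: "(\<Sum>j<length es. (stage j delta es h)\<^sup>2) \<le> A"
    and V: "V = mean es h * (1 - mean es h)" "0 < V"
  shows "V * ln (V / A) \<le> 4 * (\<Sum>j<length es. stage j delta es h)"
proof -
  have abs: "0 \<le> stage j incr_abs es h" "stage j incr_abs es h \<le> stage j delta es h" for j
  proof -
    show "0 \<le> stage j incr_abs es h"
      by (auto intro!: stage_nonneg simp: incr_abs_def c_ge_0 c_le_1 delta_ge_0)
    show "stage j incr_abs es h \<le> stage j delta es h"
    proof (rule stage_mono)
      fix es h
      have "2 * (c es h * (1 - c es h)) \<le> 1"
        using zero_le_power2[of "2 * c es h - 1"] by (simp add: power2_eq_square algebra_simps)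
      then have "(2 * (c es h * (1 - c es h))) * delta es h \<le> 1 * delta es h"
        by (intro mult_right_mono delta_ge_0)
      then show "incr_abs es h \<le> delta es h" by (simp add: incr_abs_def mult.assoc)
    qed
  qed
  have "(\<Sum>j<length es. (stage j incr_abs es h)\<^sup>2) \<le> A"
    using abs A by (smt (verit) sum_mono power_mono)
  then have *: "V * (\<Sum>j<length es. (stage j incr_abs es h)\<^sup>2) / A \<le> V"
    using assms by (simp add: field_simps)
  have "V * ln (V / A) \<le> V * ln (V / A) + V - V * (\<Sum>j<length es. (stage j incr_abs es h)\<^sup>2) / A"
    using * by simp
  also have "\<dots> = (\<Sum>j<length es. stage j incr_sq es h * ln (V / A) + stage j incr_sq es h
      - V * (stage j incr_abs es h)\<^sup>2 / A)"
    unfolding sum.distrib sum_subtractf sum_distrib_right[symmetric] sum_distrib_left[symmetric]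
      sum_divide_distrib[symmetric] sum_incr_sq[OF boolean] V(1) by simp
  also have "\<dots> \<le> (\<Sum>j<length es. stage j incr_xlogx es h - xlogx (stage j incr_sq es h))"
    using assms by (intro sum_mono stage_entropy_lower) auto
  also have "\<dots> \<le> 4 * (\<Sum>j<length es. stage j delta es h)" by (rule sum_entropy_le)
  finally show ?thesis .
qed

end

section \<open>Positive association\<close>

lemma sum_Pow_insert:
  fixes g :: "'a set \<Rightarrow> real"
  assumes "finite S" "e \<notin> S"
  shows "(\<Sum>A\<in>Pow (insert e S). g A) = (\<Sum>A\<in>Pow S. g (insert e A) + g A)"
proof -
  have "(\<Sum>A\<in>Pow (insert e S). g A) = (\<Sum>A\<in>Pow S. g A) + (\<Sum>A\<in>insert e ` Pow S. g A)"
    unfolding Pow_insert using assms by (intro sum.union_disjoint) auto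
  also have "(\<Sum>A\<in>insert e ` Pow S. g A) = (\<Sum>A\<in>Pow S. g (insert e A))"
    using assms by (subst sum.reindex) (auto simp: inj_on_def)
  finally show ?thesis by (simp add: sum.distrib)
qed

text \<open>The Ahlswede-Daykin inequality over a single element. Put t = c1 d0. The mixed products
  x = a0 b1 and y = a1 b0 are at most t and x y is at most t c0 d1, so (t - x) (t - y) \<ge> 0
  yields x + y \<le> t + c0 d1.\<close>

lemma four_functions_two_points:
  fixes a0 a1 b0 b1 c0 c1 d0 d1 :: real
  assumes nn: "0 \<le> a0" "0 \<le> a1" "0 \<le> b0" "0 \<le> b1" "0 \<le> c0" "0 \<le> c1" "0 \<le> d0" "0 \<le> d1"
    and le: "a0 * b0 \<le> c0 * d0" "a0 * b1 \<le> c1 * d0" "a1 * b0 \<le> c1 * d0" "a1 * b1 \<le> c1 * d1"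
  shows "(a1 + a0) * (b1 + b0) \<le> (c1 + c0) * (d1 + d0)"
proof (cases "c1 * d0 = 0")
  case True
  then have "a0 * b1 \<le> 0" "a1 * b0 \<le> 0" using le by linarith+
  moreover have "0 \<le> a0 * b1" "0 \<le> a1 * b0" using nn by simp_all
  ultimately have "a0 * b1 = 0" "a1 * b0 = 0" by linarith+
  moreover have "0 \<le> c0 * d1" using nn by simp
  ultimately show ?thesis using le True unfolding distrib_left distrib_right by linarith
next
  case False
  then have pos: "c1 * d0 > 0" using nn by simp
  define t where "t = c1 * d0"
  have t: "t > 0" using pos by (simp add: t_def)
  have "(a0 * b1) * (a1 * b0) = (a0 * b0) * (a1 * b1)" by simp
  also have "\<dots> \<le> (c0 * d0) * (c1 * d1)" using nn by (intro mult_mono[OF le(1) le(4)]) auto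
  also have "\<dots> = t * (c0 * d1)" by (simp add: t_def)
  finally have 1: "(a0 * b1) * (a1 * b0) \<le> t * (c0 * d1)" .
  have "0 \<le> (t - a0 * b1) * (t - a1 * b0)"
    using le by (intro mult_nonneg_nonneg) (auto simp: t_def)
  then have "t * (a0 * b1 + a1 * b0) \<le> t * t + (a0 * b1) * (a1 * b0)"
    by (simp add: algebra_simps)
  also have "\<dots> \<le> t * (t + c0 * d1)" using 1 by (simp add: algebra_simps)
  finally have "a0 * b1 + a1 * b0 \<le> t + c0 * d1" using t by simp
  then show ?thesis using le by (simp add: t_def algebra_simps)
qed

text \<open>The Ahlswede-Daykin four functions theorem. Summing out one element from each of the
  four functions preserves the hypothesis, by the two-point case.\<close>

lemma four_functions:
  fixes \<alpha> \<beta> \<gamma> \<delta> :: "'a set \<Rightarrow> real"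
  assumes "finite S"
    and "\<And>A. A \<subseteq> S \<Longrightarrow> 0 \<le> \<alpha> A" "\<And>A. A \<subseteq> S \<Longrightarrow> 0 \<le> \<beta> A"
      "\<And>A. A \<subseteq> S \<Longrightarrow> 0 \<le> \<gamma> A" "\<And>A. A \<subseteq> S \<Longrightarrow> 0 \<le> \<delta> A"
    and "\<And>A B. A \<subseteq> S \<Longrightarrow> B \<subseteq> S \<Longrightarrow> \<alpha> A * \<beta> B \<le> \<gamma> (A \<union> B) * \<delta> (A \<inter> B)"
  shows "(\<Sum>A\<in>Pow S. \<alpha> A) * (\<Sum>A\<in>Pow S. \<beta> A) \<le> (\<Sum>A\<in>Pow S. \<gamma> A) * (\<Sum>A\<in>Pow S. \<delta> A)"
  using assms
proof (induction S arbitrary: \<alpha> \<beta> \<gamma> \<delta> rule: finite_induct)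
  case (insert e S)
  have ins: "A \<subseteq> S \<Longrightarrow> insert e A \<subseteq> insert e S" "A \<subseteq> S \<Longrightarrow> A \<subseteq> insert e S" for A by auto
  show ?case
    unfolding sum_Pow_insert[OF insert(1,2)]
  proof (rule insert.IH)
    fix A B assume AB: "A \<subseteq> S" "B \<subseteq> S"
    then have e: "insert e A \<inter> B = A \<inter> B" "A \<inter> insert e B = A \<inter> B" using insert(2) by auto
    show "(\<alpha> (insert e A) + \<alpha> A) * (\<beta> (insert e B) + \<beta> B)
       \<le> (\<gamma> (insert e (A \<union> B)) + \<gamma> (A \<union> B)) * (\<delta> (insert e (A \<inter> B)) + \<delta> (A \<inter> B))"
      using insert.prems(5)[of A B] insert.prems(5)[of A "insert e B"]
        insert.prems(5)[of "insert e A" B] insert.prems(5)[of "insert e A" "insert e B"] AB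
      by (intro four_functions_two_points insert.prems ins) (auto simp: e)
  qed (auto intro!: add_nonneg_nonneg insert.prems)
qed simp

lemma fraction_le_fraction:
  fixes a b a' b' :: real
  assumes "0 < a" "0 < b" "0 < a'" "0 < b'" "a * b' \<le> a' * b"
  shows "a / (a + b) \<le> a' / (a' + b')"
proof (rule mult_imp_le_div_pos)
  have "a * (a' + b') / (a + b) \<le> a'"
    using assms by (intro mult_imp_div_pos_le) (auto simp: algebra_simps)
  then show "a / (a + b) * (a' + b') \<le> a'" by simp
qed (use assms in simp)

text \<open>The conditions are imposed on all sets, not only on subsets of \<open>E\<close>, so that
  histories need no side conditions.\<close>

locale fkg_weight =
  fixes E :: "'a set" and w :: "'a set \<Rightarrow> real"
  assumes fin: "finite E" and w_pos: "0 < w A"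
    and w_lattice: "w A * w B \<le> w (A \<union> B) * w (A \<inter> B)"
begin

text \<open>The partition function with \<open>h\<close> imposed and the coordinates in
  \<open>S\<close> free.\<close>

definition part :: "'a set \<Rightarrow> 'a set \<Rightarrow> real" where
  "part S h = (\<Sum>B\<in>Pow S. w (h \<union> B))"

definition cond_ex :: "('a set \<Rightarrow> real) \<Rightarrow> 'a set \<Rightarrow> 'a set \<Rightarrow> real" where
  "cond_ex g S h = (\<Sum>B\<in>Pow S. g (h \<union> B) * w (h \<union> B)) / part S h"

definition ex :: "('a set \<Rightarrow> real) \<Rightarrow> real" where
  "ex g = (\<Sum>A\<in>Pow E. g A * w A) / (\<Sum>A\<in>Pow E. w A)"

definition pr :: "('a set \<Rightarrow> bool) \<Rightarrow> real" where
  "pr Q = ex (\<lambda>A. of_bool (Q A))"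

definition cov :: "('a set \<Rightarrow> real) \<Rightarrow> 'a \<Rightarrow> real" where
  "cov f e = ex (\<lambda>A. f A * of_bool (e \<in> A)) - ex f * ex (\<lambda>A. of_bool (e \<in> A))"

text \<open>The history \<open>h\<close> is cut down to the coordinates that precede \<open>es\<close>, so that monotonicity
  in \<open>h\<close> needs no side condition.\<close>

definition cond_prob :: "'a list \<Rightarrow> 'a set \<Rightarrow> real" where
  "cond_prob es h = (case es of [] \<Rightarrow> 0 | e # es' \<Rightarrow>
     (let k = h - set es; a = part (set es') (insert e k - set es'); b = part (set es') (k - set es') in a / (a + b)))"

lemma part_pos: "finite S \<Longrightarrow> 0 < part S h"
  unfolding part_def by (intro sum_pos) (auto simp: w_pos)

lemma norm_pos: "0 < (\<Sum>A\<in>Pow E. w A)"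
  using part_pos[OF fin, of "{}"] by (simp add: part_def)

lemma ex_eq_cond_ex: "ex g = cond_ex g E {}"
  by (simp add: ex_def cond_ex_def part_def)

lemma ex_add: "ex (\<lambda>A. g A + g' A) = ex g + ex g'"
  by (simp add: ex_def algebra_simps sum.distrib add_divide_distrib)

lemma ex_diff: "ex (\<lambda>A. g A - g' A) = ex g - ex g'"
  by (simp add: ex_def algebra_simps sum_subtractf diff_divide_distrib)

lemma ex_const [simp]: "ex (\<lambda>A. a) = a"
  using norm_pos by (simp add: ex_def sum_distrib_left[symmetric])

lemma ex_sum: "ex (\<lambda>A. \<Sum>i\<in>I. g i A) = (\<Sum>i\<in>I. ex (g i))"
proof -
  have "(\<Sum>A\<in>Pow E. (\<Sum>i\<in>I. g i A) * w A) = (\<Sum>i\<in>I. \<Sum>A\<in>Pow E. g i A * w A)"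
    by (simp add: sum_distrib_right sum.swap[of _ "Pow E"])
  then show ?thesis by (simp add: ex_def sum_divide_distrib)
qed

lemma ex_mono: "(\<And>A. A \<subseteq> E \<Longrightarrow> g A \<le> g' A) \<Longrightarrow> ex g \<le> ex g'"
  unfolding ex_def using norm_pos
  by (intro divide_right_mono sum_mono mult_right_mono) (auto simp: w_pos less_imp_le)

lemma ex_cong: "(\<And>A. A \<subseteq> E \<Longrightarrow> g A = g' A) \<Longrightarrow> ex g = ex g'"
  unfolding ex_def by (auto intro!: arg_cong2[of _ _ _ _ "(/)"] sum.cong)

lemma pr_mono: "(\<And>A. A \<subseteq> E \<Longrightarrow> Q A \<Longrightarrow> Q' A) \<Longrightarrow> pr Q \<le> pr Q'"
  unfolding pr_def by (intro ex_mono) auto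

lemma pr_nonneg: "0 \<le> pr Q" and pr_le_1: "pr Q \<le> 1"
proof -
  show "0 \<le> pr Q" using ex_mono[of "\<lambda>_. 0" "\<lambda>A. of_bool (Q A)"] by (auto simp: pr_def)
  show "pr Q \<le> 1" using ex_mono[of "\<lambda>A. of_bool (Q A)" "\<lambda>_. 1"] by (auto simp: pr_def)
qed

lemma pr_not: "pr (\<lambda>A. \<not> Q A) = 1 - pr Q"
proof -
  have "pr (\<lambda>A. \<not> Q A) = ex (\<lambda>A. 1 - of_bool (Q A))" unfolding pr_def by (rule ex_cong) auto
  then show ?thesis unfolding ex_diff by (simp add: pr_def)
qed

lemma pr_disj_le: "pr (\<lambda>A. Q A \<or> Q' A) \<le> pr Q + pr Q'"
  unfolding pr_def ex_add[symmetric] by (rule ex_mono) auto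

text \<open>The four functions theorem for \<open>f * w\<close>, \<open>g * w\<close>,
  \<open>f * g * w\<close> and \<open>w\<close>.\<close>

lemma fkg:
  assumes "\<And>A. 0 \<le> f A" "\<And>A. 0 \<le> g A"
    and "\<And>A B. A \<subseteq> B \<Longrightarrow> f A \<le> f B" "\<And>A B. A \<subseteq> B \<Longrightarrow> g A \<le> g B"
  shows "ex f * ex g \<le> ex (\<lambda>A. f A * g A)"
proof -
  have "(\<Sum>A\<in>Pow E. f A * w A) * (\<Sum>A\<in>Pow E. g A * w A)
     \<le> (\<Sum>A\<in>Pow E. f A * g A * w A) * (\<Sum>A\<in>Pow E. w A)"
  proof (rule four_functions[OF fin])
    fix A B
    have "(f A * w A) * (g B * w B) = (f A * g B) * (w A * w B)" by simp
    also have "\<dots> \<le> (f (A \<union> B) * g (A \<union> B)) * (w (A \<union> B) * w (A \<inter> B))"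
      using assms w_pos
      by (intro mult_mono[OF mult_mono w_lattice]) (auto simp: less_imp_le intro!: mult_nonneg_nonneg)
    finally show "f A * w A * (g B * w B) \<le> f (A \<union> B) * g (A \<union> B) * w (A \<union> B) * w (A \<inter> B)" by simp
  qed (use assms w_pos in \<open>auto intro!: mult_nonneg_nonneg simp: less_imp_le\<close>)
  then show ?thesis using norm_pos by (simp add: ex_def divide_simps mult_ac)
qed

lemma pr_conj_ge:
  assumes "\<And>A B. A \<subseteq> B \<Longrightarrow> Q A \<Longrightarrow> Q B" "\<And>A B. A \<subseteq> B \<Longrightarrow> Q' A \<Longrightarrow> Q' B"
  shows "pr Q * pr Q' \<le> pr (\<lambda>A. Q A \<and> Q' A)"
  unfolding pr_def of_bool_conj
  by (rule fkg) (use assms in \<open>simp_all add: of_bool_def\<close>)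

lemma cov_nonneg:
  assumes "\<And>A. 0 \<le> f A" "\<And>A B. A \<subseteq> B \<Longrightarrow> f A \<le> f B"
  shows "0 \<le> cov f e"
  unfolding cov_def diff_ge_0_iff_ge
  by (rule fkg) (use assms in \<open>auto simp: of_bool_def\<close>)

lemma cond_prob_Cons:
  assumes "e \<notin> set es" "h \<inter> set (e # es) = {}"
  shows "cond_prob (e # es) h = part (set es) (insert e h) / part (set (e # es)) h"
proof -
  have "h - set (e # es) = h" "insert e h - set es = insert e h" "h - set es = h" using assms by auto
  moreover have "part (set (e # es)) h = part (set es) (insert e h) + part (set es) h"
    unfolding part_def using assms by (simp add: sum_Pow_insert sum.distrib)
  ultimately show ?thesis by (simp add: cond_prob_def Let_def)
qed

text \<open>The value depends only on coordinates that precede \<open>es\<close>. So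
  \<open>cond_prob es\<close> may be evaluated at a complete configuration and enter
  \<open>fkg\<close> as an increasing function there.\<close>

lemma cond_prob_history: "cond_prob es (h \<union> B) = cond_prob es h" if "B \<subseteq> set es"
proof -
  have "(h \<union> B) - set es = h - set es" using that by auto
  then show ?thesis by (cases es) (simp_all add: cond_prob_def Let_def)
qed

lemma cond_prob_01: "0 \<le> cond_prob es h" "cond_prob es h \<le> 1"
  using part_pos[of "set (tl es)"]
  by (auto simp: cond_prob_def Let_def add_pos_pos less_imp_le split: list.split)

text \<open>After cross-multiplication, products of partition functions are compared by the four
  functions theorem with \<open>w\<close> in all four places. Unions extend the larger history with
  \<open>e\<close>, intersections the smaller history without it.\<close>

lemma cond_prob_mono:
  assumes "h \<subseteq> h'"
  shows "cond_prob es h \<le> cond_prob es h'"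
proof (cases es)
  case (Cons e es')
  let ?S = "set es'"
  let ?k = "h - set es" and ?k' = "h' - set es"
  have "part ?S (insert e ?k - ?S) * part ?S (?k' - ?S) \<le> part ?S (insert e ?k' - ?S) * part ?S (?k - ?S)"
    unfolding part_def
  proof (rule four_functions)
    fix A B assume AB: "A \<subseteq> ?S" "B \<subseteq> ?S"
    have "(insert e ?k - ?S \<union> A) \<union> (?k' - ?S \<union> B) = insert e ?k' - ?S \<union> (A \<union> B)"
      using AB assms by auto
    moreover have "(insert e ?k - ?S \<union> A) \<inter> (?k' - ?S \<union> B) = ?k - ?S \<union> (A \<inter> B)"
      using AB assms Cons by auto
    ultimately show "w (insert e ?k - ?S \<union> A) * w (?k' - ?S \<union> B)
        \<le> w (insert e ?k' - ?S \<union> (A \<union> B)) * w (?k - ?S \<union> A \<inter> B)"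
      using w_lattice[of "insert e ?k - ?S \<union> A" "?k' - ?S \<union> B"] by simp
  qed (auto simp: w_pos less_imp_le)
  moreover have "cond_prob es h = part ?S (insert e (h - set es) - ?S)
      / (part ?S (insert e (h - set es) - ?S) + part ?S (h - set es - ?S))" for h
    by (simp add: cond_prob_def Let_def Cons)
  ultimately show ?thesis
    by (simp only:) (intro fraction_le_fraction part_pos finite_set)
qed (simp add: cond_prob_def)

lemma cond_ex_Cons:
  assumes "e \<notin> set es" "h \<inter> set (e # es) = {}"
  shows "cond_ex g (set (e # es)) h = cond_prob (e # es) h * cond_ex g (set es) (insert e h)
     + (1 - cond_prob (e # es) h) * cond_ex g (set es) h"
proof -
  define p a b where "p = part (set (e # es)) h" and "a = part (set es) (insert e h)" and "b = part (set es) h"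
  have p: "p = a + b"
    unfolding p_def a_def b_def part_def using assms by (simp add: sum_Pow_insert sum.distrib)
  have pos: "a > 0" "b > 0" by (auto intro: part_pos simp: a_def b_def)
  then have "1 - a / p = b / p" by (simp add: p field_simps)
  moreover have "(\<Sum>B\<in>Pow (set (e # es)). g (h \<union> B) * w (h \<union> B))
     = (\<Sum>B\<in>Pow (set es). g (insert e h \<union> B) * w (insert e h \<union> B)) + (\<Sum>B\<in>Pow (set es). g (h \<union> B) * w (h \<union> B))"
    using assms by (simp add: sum_Pow_insert sum.distrib)
  ultimately show ?thesis
    unfolding cond_prob_Cons[OF assms] cond_ex_def p_def[symmetric] a_def[symmetric] b_def[symmetric] using pos
    by (simp add: add_divide_distrib)
qed

lemma cond_ex_cong:
  "(\<And>B. B \<subseteq> S \<Longrightarrow> g (h \<union> B) = g' (h \<union> B)) \<Longrightarrow> cond_ex g S h = cond_ex g' S h"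
  unfolding cond_ex_def by (auto intro!: arg_cong2[of _ _ _ _ "(/)"] sum.cong)

lemma cond_ex_scale: "cond_ex (\<lambda>A. a * g A) S h = a * cond_ex g S h"
  by (simp add: cond_ex_def sum_distrib_left mult.assoc)

lemma cond_ex_1: "finite S \<Longrightarrow> cond_ex (\<lambda>_. 1) S h = 1"
  using part_pos[of S h] by (simp add: cond_ex_def part_def)

end

section \<open>Influences bounded by covariances\<close>

locale fkg_event = fkg_weight E w for E :: "'a set" and w +
  fixes f :: "'a set \<Rightarrow> real" and K :: real
  assumes f_ge_0: "0 \<le> f A" and f_le_1: "f A \<le> 1" and f_mono: "A \<subseteq> B \<Longrightarrow> f A \<le> f B"
    and K: "1 \<le> K" "w (insert e A) \<le> K * w A" "w A \<le> K * w (insert e A)"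
begin

sublocale exploration cond_prob f
  by unfold_locales (auto simp: cond_prob_01 cond_prob_mono f_ge_0 f_le_1 f_mono)

lemma mean_eq_cond_ex:
  "distinct es \<Longrightarrow> h \<inter> set es = {} \<Longrightarrow> mean es h = cond_ex f (set es) h"
proof (induction es arbitrary: h)
  case (Cons e es)
  then have "mean es (insert e h) = cond_ex f (set es) (insert e h)" "mean es h = cond_ex f (set es) h"
    by auto
  moreover have "e \<notin> set es" "h \<inter> set (e # es) = {}" using Cons.prems by auto
  note cond_ex_Cons[OF this, of f]
  ultimately show ?case by (simp only: mean.simps)
next
  case Nil
  have "w h \<noteq> 0" using w_pos[of h] by simp
  then show ?case by (simp add: cond_ex_def part_def)
qed

text \<open>The tower property: averaging conditional expectations over \<open>j\<close> revelations
  gives the expectation of the function that belongs to the remaining list.\<close>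

lemma stage_eq_cond_ex:
  assumes base: "\<And>es h. distinct es \<Longrightarrow> h \<inter> set es = {} \<Longrightarrow> es \<noteq> [] \<Longrightarrow> G es h = cond_ex (g es) (set es) h"
  shows "distinct es \<Longrightarrow> h \<inter> set es = {} \<Longrightarrow> j < length es \<Longrightarrow>
    stage j G es h = cond_ex (g (drop j es)) (set es) h"
proof (induction j arbitrary: es h)
  case 0
  then show ?case by (simp add: base)
next
  case (Suc j)
  then obtain e es' where es: "es = e # es'" by (cases es) auto
  have "stage j G es' (insert e h) = cond_ex (g (drop j es')) (set es') (insert e h)"
    "stage j G es' h = cond_ex (g (drop j es')) (set es') h"
    using Suc.prems by (auto intro!: Suc.IH simp: es)
  moreover have "e \<notin> set es'" "h \<inter> set (e # es') = {}" using Suc.prems by (auto simp: es)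
  note cond_ex_Cons[OF this, of "g (drop j es')"]
  ultimately show ?case by (simp only: es stage.simps drop_Suc_Cons)
qed

lemma coordinate_cond_ex:
  assumes "distinct (e # es)" "h \<inter> set (e # es) = {}"
  shows "cond_ex (\<lambda>A. g A * of_bool (e \<in> A)) (set (e # es)) h
    = cond_prob (e # es) h * cond_ex g (set es) (insert e h)"
proof -
  have "cond_ex (\<lambda>A. g A * of_bool (e \<in> A)) (set es) (insert e h) = cond_ex g (set es) (insert e h)"
    by (intro cond_ex_cong) auto
  moreover have "cond_ex (\<lambda>A. g A * of_bool (e \<in> A)) (set es) h = cond_ex (\<lambda>A. 0 * g A) (set es) h"
    using assms by (intro cond_ex_cong) auto
  moreover have "e \<notin> set es" using assms by simp
  note cond_ex_Cons[OF this assms(2), of "\<lambda>A. g A * of_bool (e \<in> A)"]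
  moreover have "cond_ex (\<lambda>A. 0) (set es) h = 0" by (simp add: cond_ex_def)
  ultimately show ?thesis by (simp del: list.set)
qed

lemma stage_coordinate:
  assumes "distinct es" "h \<inter> set es = {}" "j < length es"
  shows "stage j (\<lambda>es h. cond_prob es h * mean (tl es) (insert (hd es) h)) es h
      = cond_ex (\<lambda>A. f A * of_bool (es ! j \<in> A)) (set es) h"
proof -
  have "cond_prob es h * mean (tl es) (insert (hd es) h) = cond_ex (\<lambda>A. f A * of_bool (hd es \<in> A)) (set es) h"
    if "distinct es" "h \<inter> set es = {}" "es \<noteq> []" for es :: "'a list" and h
  proof -
    obtain e es' where es: "es = e # es'" using \<open>es \<noteq> []\<close> by (cases es) auto
    have "mean es' (insert e h) = cond_ex f (set es') (insert e h)"
      using that by (intro mean_eq_cond_ex) (auto simp: es)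
    then show ?thesis using that(1,2) unfolding es by (simp only: coordinate_cond_ex list.sel)
  qed
  from stage_eq_cond_ex[of _ "\<lambda>es A. f A * of_bool (hd es \<in> A)", OF this assms] show ?thesis
    using assms by (simp add: hd_drop_conv_nth)
qed

lemma stage_coordinate_prob:
  assumes "distinct es" "h \<inter> set es = {}" "j < length es"
  shows "stage j cond_prob es h = cond_ex (\<lambda>A. of_bool (es ! j \<in> A)) (set es) h"
proof -
  have "cond_prob es h = cond_ex (\<lambda>A. of_bool (hd es \<in> A)) (set es) h"
    if "distinct es" "h \<inter> set es = {}" "es \<noteq> []" for es :: "'a list" and h
  proof -
    obtain e es' where es: "es = e # es'" using \<open>es \<noteq> []\<close> by (cases es) auto
    show ?thesis using coordinate_cond_ex[of e es' h "\<lambda>_. 1"] that(1,2)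
      unfolding es by (simp only: cond_ex_1 finite_set list.sel mult_1_left mult_1_right)
  qed
  from stage_eq_cond_ex[of _ "\<lambda>es A. of_bool (hd es \<in> A)", OF this assms] show ?thesis
    using assms by (simp add: hd_drop_conv_nth)
qed

lemma stage_cond_prob_mean:
  assumes "distinct es" "h \<inter> set es = {}" "j < length es"
  shows "stage j (\<lambda>es h. cond_prob es h * mean es h) es h
      = cond_ex (\<lambda>A. f A * cond_prob (drop j es) A) (set es) h"
proof (rule stage_eq_cond_ex[of _ "\<lambda>es A. f A * cond_prob es A", OF _ assms])
  fix es :: "'a list" and h assume "distinct es" "h \<inter> set es = {}"
  moreover have "cond_ex (\<lambda>A. f A * cond_prob es A) (set es) h = cond_ex (\<lambda>A. cond_prob es h * f A) (set es) h"
    by (intro cond_ex_cong) (simp add: cond_prob_history)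
  ultimately show "cond_prob es h * mean es h = cond_ex (\<lambda>A. f A * cond_prob es A) (set es) h"
    by (simp add: mean_eq_cond_ex cond_ex_scale)
qed

lemma stage_cond_prob:
  assumes "distinct es" "h \<inter> set es = {}" "j < length es"
  shows "stage j cond_prob es h = cond_ex (\<lambda>A. cond_prob (drop j es) A) (set es) h"
proof (rule stage_eq_cond_ex[of _ cond_prob, OF _ assms])
  fix es :: "'a list" and h
  have "cond_ex (\<lambda>A. cond_prob es A) (set es) h = cond_ex (\<lambda>A. cond_prob es h * 1) (set es) h"
    by (intro cond_ex_cong) (simp add: cond_prob_history)
  also have "\<dots> = cond_prob es h"
    unfolding cond_ex_scale by (simp add: cond_ex_1)
  finally show "cond_prob es h = cond_ex (cond_prob es) (set es) h" ..
qed

text \<open>Finite energy: the partition functions with and without \<open>e\<close> differ by a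
  factor of at most \<open>K\<close>, so presence and absence both have conditional probability at
  least \<open>1 / (1 + K)\<close>.\<close>

lemma cond_prob_bounds:
  "1 / (1 + K)\<^sup>2 \<le> cond_prob (e # es) h * (1 - cond_prob (e # es) h)"
proof -
  let ?S = "set es" and ?k = "h - set (e # es)"
  define a where "a = part ?S (insert e ?k - ?S)"
  define b where "b = part ?S (?k - ?S)"
  have pos: "a > 0" "b > 0" by (auto simp: a_def b_def intro: part_pos)
  have "a \<le> K * b \<and> b \<le> K * a"
  proof (cases "e \<in> ?S")
    case True
    then have "insert e ?k - ?S = ?k - ?S" by auto
    then have "a = b" by (simp add: a_def b_def)
    then show ?thesis using pos K(1) by auto
  next
    case False
    then have e: "insert e ?k - ?S \<union> B = insert e (?k - ?S \<union> B)" for B by auto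
    show ?thesis
      unfolding a_def b_def part_def sum_distrib_left e by (auto intro!: sum_mono K)
  qed
  then have "(a + b) \<le> (1 + K) * a" "(a + b) \<le> (1 + K) * b" by (simp_all add: algebra_simps)
  then have "1 / (1 + K) \<le> a / (a + b)" "1 / (1 + K) \<le> b / (a + b)"
    using pos K(1) by (simp_all add: field_simps)
  then have "1 / (1 + K) * (1 / (1 + K)) \<le> a / (a + b) * (b / (a + b))"
    using K(1) pos by (intro mult_mono) auto
  moreover have "1 - a / (a + b) = b / (a + b)" using pos by (simp add: field_simps)
  moreover have "cond_prob (e # es) h = a / (a + b)" by (simp add: cond_prob_def Let_def a_def b_def)
  ultimately show ?thesis by (simp add: power2_eq_square)
qed

text \<open>Given the past, c (1 - c) \<open>delta\<close> is the covariance of \<open>f\<close>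
  with the presence of the next coordinate, and c (1 - c) is bounded below. Its average is E[f 1_e]
  - E[f c]. Since \<open>f\<close> and the conditional probability c are both increasing, E[f c] is
  at least E[f] E[c] = E[f] P(e), which turns the average into an upper bound by the unconditional
  covariance.\<close>

lemma stage_delta_le_cov:
  assumes "distinct es" "set es = E" "j < length es"
  shows "stage j delta es {} \<le> (1 + K)\<^sup>2 * cov f (es ! j)"
proof -
  have c2: "1 / (1 + K)\<^sup>2 * delta es h + 0 * delta es h
      \<le> 1 * (cond_prob es h * mean (tl es) (insert (hd es) h)) + (-1) * (cond_prob es h * mean es h)"
    if "es \<noteq> []" for es :: "'a list" and h
  proof -
    obtain e es' where es: "es = e # es'" using \<open>es \<noteq> []\<close> by (cases es) auto
    have "1 / (1 + K)\<^sup>2 * delta es h \<le> cond_prob es h * (1 - cond_prob es h) * delta es h"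
      unfolding es by (intro mult_right_mono cond_prob_bounds delta_ge_0)
    then show ?thesis by (simp add: es algebra_simps)
  qed
  \<comment> \<open>For the empty list both sides are 0 by the defaults of \<open>delta\<close> and
    \<open>cond_prob\<close>.\<close>
  have c3: "1 / (1 + K)\<^sup>2 * delta es h + 0 * delta es h
      \<le> 1 * (cond_prob es h * mean (tl es) (insert (hd es) h)) + (-1) * (cond_prob es h * mean es h)" for es h
    using c2[of es h] by (cases "es = []") (auto simp: cond_prob_def)
  have "1 / (1 + K)\<^sup>2 * stage j delta es {}
     \<le> stage j (\<lambda>es h. cond_prob es h * mean (tl es) (insert (hd es) h)) es {}
      - stage j (\<lambda>es h. cond_prob es h * mean es h) es {}"
    using stage_mono[where j=j and es=es and h="{}", OF c3] unfolding stage_linear by simp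
  also have "\<dots> = ex (\<lambda>A. f A * of_bool (es ! j \<in> A)) - ex (\<lambda>A. f A * cond_prob (drop j es) A)"
    using assms by (simp add: stage_coordinate stage_cond_prob_mean ex_eq_cond_ex)
  also have "\<dots> \<le> ex (\<lambda>A. f A * of_bool (es ! j \<in> A)) - ex f * ex (\<lambda>A. cond_prob (drop j es) A)"
    by (intro diff_left_mono fkg f_ge_0 f_mono cond_prob_01 cond_prob_mono)
  also have "ex (\<lambda>A. cond_prob (drop j es) A) = ex (\<lambda>A. of_bool (es ! j \<in> A))"
    using stage_cond_prob[of es "{}" j] stage_coordinate_prob[of es "{}" j] assms
    by (simp add: ex_eq_cond_ex)
  finally show ?thesis using K(1) by (simp add: cov_def field_simps)
qed

text \<open>\<open>entropy_influence\<close> with every averaged \<open>delta\<close> replaced by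
  its bound from \<open>stage_delta_le_cov\<close>; squaring that bound produces the fourth power of
  \<open>1 + K\<close>.\<close>

theorem influence_inequality:
  assumes boolean: "\<And>A. f A * f A = f A"
    and "0 < A" and A: "(1 + K) ^ 4 * (\<Sum>e\<in>E. (cov f e)\<^sup>2) \<le> A"
    and V: "V = ex f * (1 - ex f)" "0 < V"
  shows "V * ln (V / A) \<le> 4 * (1 + K)\<^sup>2 * (\<Sum>e\<in>E. cov f e)"
proof -
  obtain es where es: "set es = E" "distinct es" using finite_distinct_list[OF fin] by blast
  have sum_es: "(\<Sum>j<length es. g (es ! j)) = (\<Sum>e\<in>E. g e)" for g :: "'a \<Rightarrow> real"
    using es sum.reindex_bij_betw[OF bij_betw_nth[of es "{..<length es}" "set es"], of g] by auto
  have d: "0 \<le> stage j delta es {}" for j by (intro stage_nonneg delta_ge_0)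
  have "(\<Sum>j<length es. (stage j delta es {})\<^sup>2) \<le> (\<Sum>j<length es. ((1 + K)\<^sup>2 * cov f (es ! j))\<^sup>2)"
    using d es by (intro sum_mono power_mono stage_delta_le_cov) auto
  also have "\<dots> = (1 + K) ^ 4 * (\<Sum>e\<in>E. (cov f e)\<^sup>2)"
    by (simp add: sum_es[symmetric] power_mult_distrib sum_distrib_left flip: power_mult)
  finally have 1: "(\<Sum>j<length es. (stage j delta es {})\<^sup>2) \<le> A" using A by simp
  have "mean es {} = ex f" using es by (simp add: mean_eq_cond_ex ex_eq_cond_ex)
  then have "V * ln (V / A) \<le> 4 * (\<Sum>j<length es. stage j delta es {})"
    using assms 1 by (intro entropy_influence[OF boolean]) auto
  also have "\<dots> \<le> 4 * (\<Sum>j<length es. (1 + K)\<^sup>2 * cov f (es ! j))"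
    using es by (intro mult_left_mono sum_mono stage_delta_le_cov) auto
  also have "\<dots> = 4 * (1 + K)\<^sup>2 * (\<Sum>e\<in>E. cov f e)"
    by (simp add: sum_es[symmetric] sum_distrib_left mult.assoc)
  finally show ?thesis .
qed

end

section \<open>Amplification and sharp thresholds\<close>

text \<open>A partial sum that grows by steps smaller than \<delta> cannot jump over the interval
  from \<delta> to 2 \<delta>.\<close>

lemma subset_sum_between:
  fixes p :: "'b \<Rightarrow> real"
  assumes "finite S" "\<And>s. s \<in> S \<Longrightarrow> p s < \<delta>" "\<delta> \<le> sum p S" "0 < \<delta>"
  shows "\<exists>T\<subseteq>S. \<delta> \<le> sum p T \<and> sum p T < 2 * \<delta>"
  using assms
proof (induction S rule: finite_induct)
  case (insert s S)
  show ?case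
  proof (cases "\<delta> \<le> sum p S")
    case True
    with insert show ?thesis by (meson insertCI subset_insertI2)
  next
    case False
    then have "sum p (insert s S) < 2 * \<delta>" using insert(1,2) insert.prems(1)[of s] by simp
    with insert.prems show ?thesis by blast
  qed
qed auto

text \<open>The 64 is the square of the 8 in the case distinction of
  \<open>amplify_step\<close>.\<close>

fun amplified :: "nat \<Rightarrow> real \<Rightarrow> real" where
  "amplified 0 \<epsilon> = \<epsilon>"
| "amplified (Suc n) \<epsilon> = (amplified n \<epsilon>)\<^sup>2 / 64"

lemma amplified_pos: "0 < \<epsilon> \<Longrightarrow> 0 < amplified n \<epsilon>"
  by (induction n) auto

context fkg_weight begin

lemma pr_sum_values:
  assumes "finite U"
  shows "(\<Sum>u\<in>U. pr (\<lambda>A. W A = u)) = pr (\<lambda>A. W A \<in> U)"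
proof -
  have "(\<Sum>u\<in>U. of_bool (W A = u)) = (of_bool (W A \<in> U) :: real)" for A
    using assms by (simp add: of_bool_def)
  then show ?thesis unfolding pr_def by (simp add: ex_sum[symmetric])
qed

text \<open>Suppose that height exactly \<open>k\<close> is likely. If a single value of
  \<open>W\<close> is likely, it occurs below \<open>W C\<close> together with the set
  \<open>U\<close> of \<open>moved\<close>. If every value is unlikely, the values split into two
  families of comparable mass, and members of both occur below \<open>W C\<close>. In either case
  positive association bounds the probability by a product, and \<open>W C\<close> contains more
  than one value of height \<open>k\<close> can hold.\<close>

lemma amplify_step:
  fixes W :: "'a set \<Rightarrow> 'b set" and ht :: "'b set \<Rightarrow> nat"
  assumes W_mono: "\<And>A B. A \<subseteq> B \<Longrightarrow> W A \<subseteq> W B"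
    and bot: "\<And>A. A \<subseteq> E \<Longrightarrow> Bot \<subseteq> W A"
    and ht: "\<And>A B. A \<subseteq> E \<Longrightarrow> B \<subseteq> E \<Longrightarrow> W A \<subset> W B \<Longrightarrow> ht (W A) < ht (W B)"
    and moved: "\<And>A. A \<subseteq> E \<Longrightarrow> W A \<noteq> Bot \<Longrightarrow> W A \<noteq> Top \<Longrightarrow>
      \<exists>U. \<not> U \<subseteq> W A \<and> pr (\<lambda>C. W A \<subseteq> W C) \<le> pr (\<lambda>C. U \<subseteq> W C)"
    and \<epsilon>: "0 < \<epsilon>" "\<epsilon> \<le> pr (\<lambda>A. W A = Top \<or> W A \<noteq> Bot \<and> k \<le> ht (W A))"
  shows "\<epsilon>\<^sup>2 / 64 \<le> pr (\<lambda>A. W A = Top \<or> W A \<noteq> Bot \<and> Suc k \<le> ht (W A))"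
proof -
  define D where "D = (\<lambda>k A. W A = Top \<or> W A \<noteq> Bot \<and> k \<le> ht (W A))"
  define G where "G = {A. A \<subseteq> E \<and> W A \<noteq> Bot \<and> W A \<noteq> Top \<and> ht (W A) = k}"
  have sq: "(\<epsilon> / 8) * (\<epsilon> / 8) = \<epsilon>\<^sup>2 / 64" by (simp add: power2_eq_square)
  have "pr (D k) \<le> pr (\<lambda>A. D (Suc k) A \<or> W A \<in> W ` G)"
    by (rule pr_mono) (auto simp: D_def G_def)
  also have "\<dots> \<le> pr (D (Suc k)) + pr (\<lambda>A. W A \<in> W ` G)" by (rule pr_disj_le)
  finally have le: "\<epsilon> \<le> pr (D (Suc k)) + pr (\<lambda>A. W A \<in> W ` G)" using \<epsilon> by (simp add: D_def)
  have "finite G" using fin by (simp add: G_def)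
  have above: "D (Suc k) C" if "C \<subseteq> E" "A \<in> G" "W A \<subset> W C" for A C
    using ht[of A C] bot[of A] that by (auto simp: D_def G_def)
  have incr: "\<exists>u\<in>V. u \<subseteq> W B" if "A \<subseteq> B" "\<exists>u\<in>V. u \<subseteq> W A" for A B V
    using that(2) W_mono[OF that(1)] by blast
  \<comment> \<open>In the third case a family of mass between \<epsilon>/8 and \<epsilon>/4 can be
    cut off the total of at least \<epsilon>/2, which leaves at least \<epsilon>/4 for the other
    family.\<close>
  consider "pr (D (Suc k)) \<ge> \<epsilon> / 2" | u where "u \<in> W ` G" "pr (\<lambda>A. W A = u) \<ge> \<epsilon> / 8"
    | "pr (\<lambda>A. W A \<in> W ` G) \<ge> \<epsilon> / 2" "\<And>u. u \<in> W ` G \<Longrightarrow> pr (\<lambda>A. W A = u) < \<epsilon> / 8"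
    using le by force
  then have "\<epsilon>\<^sup>2 / 64 \<le> pr (D (Suc k))"
  proof cases
    case 1
    have "\<epsilon> \<le> 1" using \<epsilon>(2) pr_le_1 by (rule order_trans)
    then have "\<epsilon> * \<epsilon> \<le> \<epsilon> * 1" using \<epsilon> by (intro mult_left_mono) auto
    with 1 \<epsilon>(1) show ?thesis unfolding power2_eq_square by linarith
  next
    case 2
    then obtain A where A: "A \<in> G" "u = W A" by auto
    then obtain U where U: "\<not> U \<subseteq> W A" "pr (\<lambda>C. W A \<subseteq> W C) \<le> pr (\<lambda>C. U \<subseteq> W C)"
      using moved[of A] by (auto simp: G_def)
    have 1: "\<epsilon> / 8 \<le> pr (\<lambda>C. W A \<subseteq> W C)"
      using 2 A pr_mono[of "\<lambda>C. W C = u" "\<lambda>C. W A \<subseteq> W C"] by auto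
    have "(\<epsilon> / 8) * (\<epsilon> / 8) \<le> pr (\<lambda>C. W A \<subseteq> W C) * pr (\<lambda>C. U \<subseteq> W C)"
      using 1 U \<epsilon> by (intro mult_mono pr_nonneg) auto
    also have "\<dots> \<le> pr (\<lambda>C. W A \<subseteq> W C \<and> U \<subseteq> W C)"
    proof (rule pr_conj_ge)
      show "W A \<subseteq> W D" if "C \<subseteq> D" "W A \<subseteq> W C" for C D using W_mono[OF that(1)] that(2) by blast
      show "U \<subseteq> W D" if "C \<subseteq> D" "U \<subseteq> W C" for C D using W_mono[OF that(1)] that(2) by blast
    qed
    also have "\<dots> \<le> pr (D (Suc k))"
      using U A by (intro pr_mono above[of _ A]) auto
    finally show ?thesis unfolding sq .
  next
    case 3
    have total: "sum (\<lambda>u. pr (\<lambda>A. W A = u)) (W ` G) \<ge> \<epsilon> / 2"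
      using 3 \<open>finite G\<close> by (simp add: pr_sum_values)
    then have "\<epsilon> / 8 \<le> sum (\<lambda>u. pr (\<lambda>A. W A = u)) (W ` G)" using \<epsilon>(1) by simp
    then obtain V where V: "V \<subseteq> W ` G" "\<epsilon> / 8 \<le> (\<Sum>u\<in>V. pr (\<lambda>A. W A = u))"
        "(\<Sum>u\<in>V. pr (\<lambda>A. W A = u)) < 2 * (\<epsilon> / 8)"
      using subset_sum_between[of "W ` G" "\<lambda>u. pr (\<lambda>A. W A = u)" "\<epsilon> / 8"] 3(2) \<open>finite G\<close> \<epsilon>(1) by auto
    have finV: "finite V" "finite (W ` G - V)" using finite_subset[OF V(1)] \<open>finite G\<close> by auto
    have "(\<Sum>u\<in>W ` G - V. pr (\<lambda>A. W A = u)) = (\<Sum>u\<in>W ` G. pr (\<lambda>A. W A = u)) - (\<Sum>u\<in>V. pr (\<lambda>A. W A = u))"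
      using V(1) \<open>finite G\<close> by (intro sum_diff) auto
    then have V': "\<epsilon> / 8 \<le> (\<Sum>u\<in>W ` G - V. pr (\<lambda>A. W A = u))" using V(3) total \<epsilon>(1) by linarith
    have ge: "(\<Sum>u\<in>S. pr (\<lambda>A. W A = u)) \<le> pr (\<lambda>C. \<exists>u\<in>S. u \<subseteq> W C)" if "finite S" for S
      using that by (auto simp: pr_sum_values intro!: pr_mono)
    have "(\<epsilon> / 8) * (\<epsilon> / 8) \<le> pr (\<lambda>C. \<exists>u\<in>V. u \<subseteq> W C) * pr (\<lambda>C. \<exists>u\<in>W ` G - V. u \<subseteq> W C)"
    proof (intro mult_mono pr_nonneg)
      show "\<epsilon> / 8 \<le> pr (\<lambda>C. \<exists>u\<in>V. u \<subseteq> W C)" by (rule order_trans[OF V(2) ge[OF finV(1)]])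
      show "\<epsilon> / 8 \<le> pr (\<lambda>C. \<exists>u\<in>W ` G - V. u \<subseteq> W C)" by (rule order_trans[OF V' ge[OF finV(2)]])
      show "0 \<le> \<epsilon> / 8" using \<epsilon>(1) by simp
    qed
    also have "\<dots> \<le> pr (\<lambda>C. (\<exists>u\<in>V. u \<subseteq> W C) \<and> (\<exists>u\<in>W ` G - V. u \<subseteq> W C))"
      by (rule pr_conj_ge) (erule incr, assumption)+
    also have "\<dots> \<le> pr (D (Suc k))"
    proof (rule pr_mono)
      fix C assume C: "C \<subseteq> E" "(\<exists>u\<in>V. u \<subseteq> W C) \<and> (\<exists>u\<in>W ` G - V. u \<subseteq> W C)"
      then obtain u v where uv: "u \<in> V" "u \<subseteq> W C" "v \<in> W ` G" "v \<notin> V" "v \<subseteq> W C" by auto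
      then obtain A B where AB: "A \<in> G" "u = W A" "B \<in> G" "v = W B"
        using subsetD[OF V(1) uv(1)] by (metis imageE)
      then have AB: "A \<in> G" "B \<in> G" "W A \<noteq> W B" "W A \<subseteq> W C" "W B \<subseteq> W C"
        using uv by auto
      \<comment> \<open>Two different values of equal height cannot be nested, so
        \<open>W C\<close>, which contains both, is strictly larger than \<open>W A\<close>.\<close>
      have "W A \<noteq> W C"
      proof
        assume "W A = W C"
        then have "ht (W B) < ht (W A)" using AB by (intro ht) (auto simp: G_def)
        then show False using AB by (simp add: G_def)
      qed
      then show "D (Suc k) C" using AB C by (intro above[of C A]) auto
    qed
    finally show ?thesis unfolding sq .
  qed
  then show ?thesis by (simp add: D_def)
qed

text \<open>Each round raises the guaranteed height by one. No height exceeds \<open>H\<close>, so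
  after \<open>Suc H\<close> rounds only the top value remains.\<close>

theorem amplify:
  fixes W :: "'a set \<Rightarrow> 'b set" and ht :: "'b set \<Rightarrow> nat"
  assumes W_mono: "\<And>A B. A \<subseteq> B \<Longrightarrow> W A \<subseteq> W B"
    and bot: "\<And>A. A \<subseteq> E \<Longrightarrow> Bot \<subseteq> W A"
    and ht: "\<And>A B. A \<subseteq> E \<Longrightarrow> B \<subseteq> E \<Longrightarrow> W A \<subset> W B \<Longrightarrow> ht (W A) < ht (W B)"
    and ht_le: "\<And>A. A \<subseteq> E \<Longrightarrow> ht (W A) \<le> H"
    and moved: "\<And>A. A \<subseteq> E \<Longrightarrow> W A \<noteq> Bot \<Longrightarrow> W A \<noteq> Top \<Longrightarrow>
      \<exists>U. \<not> U \<subseteq> W A \<and> pr (\<lambda>C. W A \<subseteq> W C) \<le> pr (\<lambda>C. U \<subseteq> W C)"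
    and \<epsilon>: "0 < \<epsilon>" "\<epsilon> \<le> pr (\<lambda>A. W A \<noteq> Bot)"
  shows "amplified (Suc H) \<epsilon> \<le> pr (\<lambda>A. W A = Top)"
proof -
  have "amplified k \<epsilon> \<le> pr (\<lambda>A. W A = Top \<or> W A \<noteq> Bot \<and> k \<le> ht (W A))" for k
  proof (induction k)
    case 0
    have "pr (\<lambda>A. W A \<noteq> Bot) \<le> pr (\<lambda>A. W A = Top \<or> W A \<noteq> Bot \<and> 0 \<le> ht (W A))"
      by (rule pr_mono) simp
    with \<epsilon>(2) show ?case by simp
  next
    case (Suc k)
    show ?case unfolding amplified.simps
      by (rule amplify_step[OF W_mono bot ht moved amplified_pos[OF \<epsilon>(1)] Suc])
  qed
  from this[of "Suc H"] show ?thesis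
  proof (rule order_trans)
    show "pr (\<lambda>A. W A = Top \<or> W A \<noteq> Bot \<and> Suc H \<le> ht (W A)) \<le> pr (\<lambda>A. W A = Top)"
      using ht_le by (intro pr_mono) (metis not_less_eq_eq)
  qed
qed

lemma ex_reindex:
  assumes g: "bij_betw g (Pow E) (Pow E)" and "\<And>A. A \<subseteq> E \<Longrightarrow> w (g A) = w A"
  shows "ex (\<lambda>A. f (g A)) = ex f"
proof -
  have "(\<Sum>A\<in>Pow E. f (g A) * w A) = (\<Sum>A\<in>Pow E. f (g A) * w (g A))"
    using assms by (intro sum.cong) auto
  also have "\<dots> = (\<Sum>A\<in>Pow E. f A * w A)" by (rule sum.reindex_bij_betw[OF g])
  finally show ?thesis by (simp add: ex_def)
qed

lemma pr_reindex:
  assumes "bij_betw g (Pow E) (Pow E)" and "\<And>A. A \<subseteq> E \<Longrightarrow> w (g A) = w A"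
  shows "pr (\<lambda>A. Q (g A)) = pr Q"
  unfolding pr_def using ex_reindex[OF assms, of "\<lambda>A. of_bool (Q A)"] by simp

end

text \<open>\<open>r\<close> is a matroid rank: it grows by at most one per element, and an element
  spanned by a set is spanned by every larger set. The second property is submodularity in the form
  in which linear spans provide it.\<close>

locale rank_model =
  fixes E :: "'a set" and r :: "'a set \<Rightarrow> nat" and q :: real
  assumes fin_E: "finite E" and rank_Int: "r (A \<inter> E) = r A"
    and rank_insert: "r (insert e A) = r A \<or> r (insert e A) = Suc (r A)"
    and rank_closed: "A \<subseteq> A' \<Longrightarrow> r (insert e A) = r A \<Longrightarrow> r (insert e A') = r A'"
    and q: "1 \<le> q"
begin

text \<open>Here \<open>x\<close> stands for the odds p / (1 - p), and the Betti number appears, up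
  to a constant, as minus the rank.\<close>

definition weight :: "real \<Rightarrow> 'a set \<Rightarrow> real" where
  "weight x A = x ^ card (A \<inter> E) * (1 / q) ^ r A"

text \<open>When elements are added one at a time, the gain in rank over a larger set never exceeds
  the gain over a smaller one.\<close>

lemma rank_submodular: "r (A \<union> B) + r (A \<inter> B) \<le> r A + r B"
proof -
  have "r (A \<union> D) + r C \<le> r A + r (C \<union> D)" if "finite D" "C \<subseteq> A" for A C D
    using that
  proof (induction D rule: finite_induct)
    case (insert e D)
    have "r (insert e (A \<union> D)) = r (A \<union> D)" if "r (insert e (C \<union> D)) = r (C \<union> D)"
      using that insert by (intro rank_closed[of "C \<union> D" "A \<union> D"]) auto
    then show ?case
      using insert rank_insert[of e "A \<union> D"] rank_insert[of e "C \<union> D"] by auto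
  qed simp
  note that = this
  have "r ((A \<inter> E) \<union> (B \<inter> E)) + r (A \<inter> B \<inter> E) \<le> r (A \<inter> E) + r ((A \<inter> B \<inter> E) \<union> (B \<inter> E))"
  proof (rule that)
    show "finite (B \<inter> E)" using fin_E by simp
    show "A \<inter> B \<inter> E \<subseteq> A \<inter> E" by blast
  qed
  moreover have "(A \<inter> E) \<union> (B \<inter> E) = (A \<union> B) \<inter> E" "(A \<inter> B \<inter> E) \<union> (B \<inter> E) = B \<inter> E" by auto
  ultimately show ?thesis by (simp only: rank_Int)
qed

text \<open>The cardinality is modular, and since 1 / q \<le> 1 the submodular rank in the exponent
  gives the lattice condition. This is where q \<ge> 1 enters.\<close>

lemma fkg_weight: "0 < x \<Longrightarrow> fkg_weight E (weight x)"
proof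
  fix A B assume x: "0 < x"
  show "finite E" by (rule fin_E)
  show "0 < weight x A" using x q by (simp add: weight_def)
  have "(A \<union> B) \<inter> E = (A \<inter> E) \<union> (B \<inter> E)" "(A \<inter> B) \<inter> E = (A \<inter> E) \<inter> (B \<inter> E)" by auto
  then have c: "card (A \<inter> E) + card (B \<inter> E) = card ((A \<union> B) \<inter> E) + card ((A \<inter> B) \<inter> E)"
    using card_Un_Int[of "A \<inter> E" "B \<inter> E"] fin_E by simp
  have "weight x A * weight x B = x ^ (card (A \<inter> E) + card (B \<inter> E)) * (1 / q) ^ (r A + r B)"
    by (simp add: weight_def power_add)
  also have "\<dots> \<le> x ^ (card (A \<inter> E) + card (B \<inter> E)) * (1 / q) ^ (r (A \<union> B) + r (A \<inter> B))"
    using x q rank_submodular[of A B] by (intro mult_left_mono power_decreasing) auto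
  also have "\<dots> = weight x (A \<union> B) * weight x (A \<inter> B)"
    by (simp add: weight_def c power_add)
  finally show "weight x A * weight x B \<le> weight x (A \<union> B) * weight x (A \<inter> B)" .
qed

abbreviation "expectation x \<equiv> fkg_weight.ex E (weight x)"
abbreviation "prob x \<equiv> fkg_weight.pr E (weight x)"
abbreviation "covariance x \<equiv> fkg_weight.cov E (weight x)"

text \<open>The weight is multiplied by \<open>x\<close>, by \<open>x / q\<close> if the rank grows,
  or by 1 if \<open>e\<close> is already there or outside \<open>E\<close>.\<close>

lemma weight_insert_bounds:
  assumes "0 < x" "x \<le> K" "q \<le> x * K" "1 \<le> K"
  shows "weight x (insert e A) \<le> K * weight x A" "weight x A \<le> K * weight x (insert e A)"
proof -
  have w: "0 < weight x A" using assms fkg_weight[of x] by (simp add: fkg_weight.w_pos)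
  have *: "weight x (insert e A) = weight x A \<or> weight x (insert e A) = x * weight x A
      \<or> weight x (insert e A) = x / q * weight x A"
  proof (cases "e \<in> E \<and> e \<notin> A")
    case True
    then have "card (insert e A \<inter> E) = Suc (card (A \<inter> E))" using fin_E by simp
    then show ?thesis using rank_insert[of e A] by (auto simp: weight_def)
  next
    case False
    then have "insert e A \<inter> E = A \<inter> E" by auto
    then show ?thesis using rank_Int[of A] rank_Int[of "insert e A"] by (simp add: weight_def)
  qed
  have "1 * 1 \<le> q * 1" "1 \<le> x * K" using q assms by auto
  moreover have "x / q \<le> x" using assms q by (simp add: divide_le_eq)
  moreover have "1 \<le> K * (x / q)" using assms q by (simp add: le_divide_eq mult.commute)
  ultimately have b: "x / q \<le> K" "1 \<le> K * (x / q)" "1 \<le> K * x" "x \<le> K"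
    using assms by (auto simp: mult.commute)
  have le: "b * weight x A \<le> K * weight x A" if "b \<le> K" for b
    using that w by (intro mult_right_mono) auto
  have ge: "weight x A \<le> K * (b * weight x A)" if "1 \<le> K * b" for b
    using mult_right_mono[OF that, of "weight x A"] w by (simp add: mult.assoc)
  from * have "\<exists>b. weight x (insert e A) = b * weight x A \<and> b \<le> K \<and> 1 \<le> K * b"
  proof (elim disjE)
    assume "weight x (insert e A) = weight x A"
    then show ?thesis using assms(4) by (intro exI[of _ 1]) simp
  next
    assume "weight x (insert e A) = x * weight x A"
    then show ?thesis using b by (intro exI[of _ x]) simp
  next
    assume "weight x (insert e A) = x / q * weight x A"
    then show ?thesis using b by (intro exI[of _ "x / q"]) simp
  qed
  then show "weight x (insert e A) \<le> K * weight x A" "weight x A \<le> K * weight x (insert e A)"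
    using le ge by auto
qed

text \<open>Russo's formula in the odds: the logarithmic derivative of the weight is the cardinality
  over \<open>x\<close>, so the derivative is the covariance with the cardinality, a sum over single
  elements.\<close>

lemma expectation_deriv:
  assumes "0 < x"
  shows "((\<lambda>x. expectation x f) has_real_derivative (\<Sum>e\<in>E. covariance x f e) / x) (at x)"
proof -
  define N where "N = (\<lambda>g x. \<Sum>A\<in>Pow E. g A * weight x A)"
  define c where "c = (\<lambda>A. real (card (A \<inter> E)))"
  interpret fkg_weight E "weight x" by (rule fkg_weight[OF assms])
  have dw: "((\<lambda>x. weight x A) has_real_derivative c A * weight x A / x) (at x)" for A
  proof -
    have "real n * x ^ (n - Suc 0) = real n * x ^ n / x" for n
      using assms by (cases n) auto
    then have "((\<lambda>x. x ^ n) has_real_derivative real n * x ^ n / x) (at x)" for n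
      using DERIV_pow[of n x UNIV] by simp
    from DERIV_cmult_right[OF this, of "card (A \<inter> E)" "(1 / q) ^ r A"]
    show ?thesis unfolding weight_def c_def by (simp add: mult.assoc)
  qed
  have dN: "(N g has_real_derivative N (\<lambda>A. g A * c A) x / x) (at x)" for g
    unfolding N_def sum_divide_distrib
    by (rule DERIV_sum, rule DERIV_cong[OF DERIV_cmult[OF dw]]) simp
  have N0: "N (\<lambda>_. 1) x \<noteq> 0" using norm_pos by (simp add: N_def)
  have e: "expectation y g = N g y / N (\<lambda>_. 1) y" if "0 < y" for y g
    using that by (simp add: fkg_weight.ex_def[OF fkg_weight] N_def)
  have c: "c A = (\<Sum>e\<in>E. of_bool (e \<in> A))" for A
    unfolding c_def using fin_E by (simp add: Int_commute)
  have cov_sum: "expectation x (\<lambda>A. f A * c A) - expectation x f * expectation x c = (\<Sum>e\<in>E. covariance x f e)"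
    unfolding c cov_def sum_subtractf sum_distrib_left ex_sum ..
  have alg: "(a / x * n - b * (d / x)) / (n * n) = (a / n - b / n * (d / n)) / x" if "n \<noteq> 0" for a b d n :: real
    using that assms by (simp add: field_simps)
  have "((\<lambda>x. N f x / N (\<lambda>_. 1) x) has_real_derivative
     (N (\<lambda>A. f A * c A) x / x * N (\<lambda>_. 1) x - N f x * (N (\<lambda>A. 1 * c A) x / x)) / (N (\<lambda>_. 1) x * N (\<lambda>_. 1) x)) (at x)"
    by (rule DERIV_divide[OF dN dN N0])
  then have "((\<lambda>x. N f x / N (\<lambda>_. 1) x) has_real_derivative (\<Sum>e\<in>E. covariance x f e) / x) (at x)"
    unfolding cov_sum[symmetric] e[OF assms] alg[OF N0] mult_1 .
  then show ?thesis
    \<comment> \<open>The quotient formula for the expectation is available for positive odds only,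
      hence the open half-line.\<close>
    by (rule has_field_derivative_transform_within_open[of _ _ _ "{0<..}"])
      (use assms in \<open>simp_all add: e\<close>)
qed

text \<open>Otherwise the expectation stays between \<epsilon> and 1 - \<epsilon> on the whole
  interval, and the variance is at least \<epsilon>^2. The mean value theorem yields a point
  \<open>y\<close> where the covariances sum to at most \<open>L\<close>. Each shares its value with
  an orbit of at least \<open>m\<close> elements, so it is at most L / m, and the squares sum to at
  most L^2 / m. Then \<open>influence_inequality\<close> bounds \<open>m\<close>, against the
  hypothesis \<open>m\<close>.\<close>

theorem sharp_threshold:
  assumes f_bool: "\<And>A. f A = 0 \<or> f A = 1" and f_mono: "\<And>A B. A \<subseteq> B \<Longrightarrow> f A \<le> f B"
    and x: "sqrt q \<le> x0" "x0 < x1"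
    and \<epsilon>: "0 < \<epsilon>" "\<epsilon> \<le> expectation x0 f"
    and L: "L = x1 / (x1 - x0)"
    and orbit: "\<And>e x. 0 < x \<Longrightarrow> e \<in> E \<Longrightarrow> m \<le> card {e' \<in> E. covariance x f e' = covariance x f e}"
    and m: "((1 + x1) ^ 4 * L\<^sup>2 / \<epsilon>\<^sup>2) * exp (4 * (1 + x1)\<^sup>2 * L / \<epsilon>\<^sup>2) < real m"
  shows "1 - \<epsilon> < expectation x1 f"
proof (rule ccontr)
  assume neg: "\<not> 1 - \<epsilon> < expectation x1 f"
  have f01: "0 \<le> f A" "f A \<le> 1" "f A * f A = f A" for A using f_bool[of A] by auto
  have "1 \<le> sqrt q" using real_sqrt_le_mono[OF q] by simp
  then have x01: "1 \<le> x0" "0 < x0" "1 < x1" using x by linarith+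
  have cov_nn: "0 \<le> covariance y f e" if "0 < y" for y e
    using fkg_weight.cov_nonneg[OF fkg_weight[OF that] f01(1) f_mono] .
  have "\<exists>y>x0. y < x1 \<and> expectation x1 f - expectation x0 f = (x1 - x0) * ((\<Sum>e\<in>E. covariance y f e) / y)"
    by (rule MVT2[OF x(2)]) (use x01 in \<open>auto intro: expectation_deriv\<close>)
  then obtain y where y: "x0 < y" "y < x1"
    "expectation x1 f - expectation x0 f = (x1 - x0) * ((\<Sum>e\<in>E. covariance y f e) / y)"
    by blast
  have "0 < y" using y x01 by simp
  have mono: "expectation a f \<le> expectation b f" if "0 < a" "a \<le> b" for a b
    using that(2)
  proof (rule DERIV_nonneg_imp_nondecreasing)
    fix z assume "a \<le> z" "z \<le> b"
    then have "0 < z" using that by simp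
    then show "\<exists>D. ((\<lambda>x. expectation x f) has_real_derivative D) (at z) \<and> 0 \<le> D"
      using expectation_deriv[of z f] cov_nn[of z] by (auto intro!: exI divide_nonneg_pos sum_nonneg)
  qed
  interpret fkg_event E "weight y" f x1
  proof (intro fkg_event.intro fkg_event_axioms.intro fkg_weight[OF \<open>0 < y\<close>] f01 f_mono)
    \<comment> \<open>Both \<open>y\<close> and \<open>x1\<close> are at least
      \<open>sqrt q\<close>, so \<open>x1\<close> serves as the constant \<open>K\<close> for the
      weight at \<open>y\<close>.\<close>
    have "q = sqrt q * sqrt q" using q by simp
    also have "\<dots> \<le> y * x1" using x y q \<open>0 < y\<close> by (intro mult_mono) auto
    finally have "q \<le> y * x1" .
    then show "weight y (insert e A) \<le> x1 * weight y A" "weight y A \<le> x1 * weight y (insert e A)" for e A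
      using y x01 \<open>0 < y\<close> by (auto intro!: weight_insert_bounds)
    show "1 \<le> x1" using x01 by simp
  qed auto
  define S where "S = (\<Sum>e\<in>E. cov f e)"
  have bounds: "\<epsilon> \<le> ex f" "ex f \<le> 1 - \<epsilon>"
    using mono[of x0 y] mono[of y x1] \<epsilon> neg y x01 by auto
  have S_L: "S \<le> L"
  proof -
    have "expectation x1 f - expectation x0 f \<le> 1" using neg \<epsilon> by simp
    then have "(x1 - x0) * (S / y) \<le> 1" using y by (simp add: S_def)
    then have "S * (x1 - x0) \<le> y" using \<open>0 < y\<close> by (simp add: pos_divide_le_eq mult.commute)
    then have "S \<le> y / (x1 - x0)" using x by (simp add: pos_le_divide_eq)
    also have "\<dots> \<le> L" unfolding L using x y by (intro divide_right_mono) auto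
    finally show ?thesis .
  qed
  have cov0: "0 \<le> cov f e" for e by (rule cov_nn[OF \<open>0 < y\<close>])
  have S0: "0 \<le> S" unfolding S_def by (intro sum_nonneg cov0)
  have L0: "0 < L" unfolding L using x x01 by simp
  have m0: "0 < real m" by (rule le_less_trans[OF _ m]) simp
  have cov_le: "cov f e \<le> L / m" if "e \<in> E" for e
  proof -
    have "real m * cov f e \<le> real (card {e' \<in> E. cov f e' = cov f e}) * cov f e"
      using orbit[OF \<open>0 < y\<close> that] by (intro mult_right_mono cov0) auto
    also have "\<dots> = (\<Sum>e'\<in>{e' \<in> E. cov f e' = cov f e}. cov f e')" by simp
    also have "\<dots> \<le> S" unfolding S_def using fin_E by (intro sum_mono2 cov0) auto
    finally have "cov f e * real m \<le> L" using S_L by (simp add: mult.commute)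
    then show ?thesis using m0 by (simp add: pos_le_divide_eq)
  qed
  have sq: "(\<Sum>e\<in>E. (cov f e)\<^sup>2) \<le> L\<^sup>2 / m"
  proof -
    have "(\<Sum>e\<in>E. (cov f e)\<^sup>2) \<le> (\<Sum>e\<in>E. L / m * cov f e)"
      unfolding power2_eq_square by (intro sum_mono mult_right_mono cov_le cov0) auto
    also have "\<dots> = L / m * S" by (simp add: S_def sum_distrib_left)
    also have "\<dots> \<le> L / m * L" using S_L L0 by (intro mult_left_mono) auto
    finally show ?thesis by (simp add: power2_eq_square)
  qed
  define A where "A = (1 + x1) ^ 4 * (L\<^sup>2 / m)"
  have A0: "A > 0" unfolding A_def using L0 m0 x01 by (intro mult_pos_pos divide_pos_pos zero_less_power) auto
  define V where "V = ex f * (1 - ex f)"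
  have "\<epsilon> * \<epsilon> \<le> V" unfolding V_def using bounds \<epsilon> by (intro mult_mono) auto
  then have V: "\<epsilon>\<^sup>2 \<le> V" "0 < \<epsilon>\<^sup>2" using \<epsilon> by (auto simp: power2_eq_square)
  then have "0 < V" by linarith
  have "V * ln (V / A) \<le> 4 * (1 + x1)\<^sup>2 * S"
    unfolding S_def
  proof (rule influence_inequality)
    show "(1 + x1) ^ 4 * (\<Sum>e\<in>E. (cov f e)\<^sup>2) \<le> A"
      unfolding A_def using sq x01 by (intro mult_left_mono) auto
  qed (use f01 A0 V_def \<open>0 < V\<close> in auto)
  also have "\<dots> \<le> 4 * (1 + x1)\<^sup>2 * L" using S_L by (intro mult_left_mono) auto
  finally have up: "V * ln (V / A) \<le> 4 * (1 + x1)\<^sup>2 * L" .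
  have "\<epsilon>\<^sup>2 * ln (\<epsilon>\<^sup>2 / A) \<le> 4 * (1 + x1)\<^sup>2 * L"
  proof (cases "\<epsilon>\<^sup>2 / A \<le> 1")
    case True
    then have "ln (\<epsilon>\<^sup>2 / A) \<le> 0"
      using ln_le_zero_iff[of "\<epsilon>\<^sup>2 / A"] divide_pos_pos[OF V(2) A0] by blast
    then have "\<epsilon>\<^sup>2 * ln (\<epsilon>\<^sup>2 / A) \<le> 0" using V by (intro mult_nonneg_nonpos) auto
    also have "0 \<le> 4 * (1 + x1)\<^sup>2 * L" using L0 by simp
    finally show ?thesis .
  next
    case False
    have "\<epsilon>\<^sup>2 / A \<le> V / A" using A0 V by (intro divide_right_mono) auto
    then have "ln (\<epsilon>\<^sup>2 / A) \<le> ln (V / A)"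
      using divide_pos_pos[OF V(2) A0] divide_pos_pos[OF \<open>0 < V\<close> A0] ln_le_cancel_iff by blast
    moreover have "0 \<le> ln (\<epsilon>\<^sup>2 / A)" using False by (intro ln_ge_zero) linarith
    ultimately have "\<epsilon>\<^sup>2 * ln (\<epsilon>\<^sup>2 / A) \<le> V * ln (V / A)"
      using V \<open>0 < V\<close> by (intro mult_mono) auto
    with up show ?thesis by simp
  qed
  then have "ln (\<epsilon>\<^sup>2 / A) \<le> 4 * (1 + x1)\<^sup>2 * L / \<epsilon>\<^sup>2"
    using V(2) by (simp add: pos_le_divide_eq mult.commute)
  then have "\<epsilon>\<^sup>2 / A \<le> exp (4 * (1 + x1)\<^sup>2 * L / \<epsilon>\<^sup>2)"
    using A0 V(2) by (metis divide_pos_pos exp_le_cancel_iff exp_ln)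
  then have "\<epsilon>\<^sup>2 \<le> A * exp (4 * (1 + x1)\<^sup>2 * L / \<epsilon>\<^sup>2)"
    using A0 by (simp add: pos_divide_le_eq mult.commute)
  then have "real m * \<epsilon>\<^sup>2 \<le> real m * (A * exp (4 * (1 + x1)\<^sup>2 * L / \<epsilon>\<^sup>2))"
    using m0 by (intro mult_left_mono) auto
  also have "\<dots> = (1 + x1) ^ 4 * L\<^sup>2 * exp (4 * (1 + x1)\<^sup>2 * L / \<epsilon>\<^sup>2)"
    using m0 by (simp add: A_def)
  finally have "real m \<le> (1 + x1) ^ 4 * L\<^sup>2 * exp (4 * (1 + x1)\<^sup>2 * L / \<epsilon>\<^sup>2) / \<epsilon>\<^sup>2"
    using V(2) by (simp add: pos_le_divide_eq)
  with m show False by simp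
qed

lemma covariance_symmetric:
  assumes "0 < x" and g: "bij_betw g E E" and r: "\<And>A. A \<subseteq> E \<Longrightarrow> r (g ` A) = r A"
    and f: "\<And>A. A \<subseteq> E \<Longrightarrow> f (g ` A) = f A" and e: "e \<in> E"
  shows "covariance x f (g e) = covariance x f e"
proof -
  interpret fkg_weight E "weight x" by (rule fkg_weight[OF assms(1)])
  have b: "bij_betw ((`) g) (Pow E) (Pow E)" using g by (rule bij_betw_Pow)
  have w: "weight x (g ` A) = weight x A" if "A \<subseteq> E" for A
  proof -
    have "g ` A \<subseteq> E" using that bij_betw_imp_surj_on[OF g] by blast
    moreover have "card (g ` A) = card A"
      using that bij_betw_imp_inj_on[OF g] by (meson card_image inj_on_subset)
    ultimately show ?thesis using that r by (simp add: weight_def Int_absorb2)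
  qed
  have in_image: "g e \<in> g ` A \<longleftrightarrow> e \<in> A" if "A \<subseteq> E" for A
    using bij_betw_imp_inj_on[OF g] e that by (auto dest: inj_onD)
  have "ex (\<lambda>A. h (g ` A)) = ex h" for h by (rule ex_reindex[OF b w])
  note this[of "\<lambda>A. f A * of_bool (g e \<in> A)"] this[of f] this[of "\<lambda>A. of_bool (g e \<in> A)"]
  then have "cov f (g e)
      = ex (\<lambda>A. f (g ` A) * of_bool (g e \<in> g ` A)) - ex (\<lambda>A. f (g ` A)) * ex (\<lambda>A. of_bool (g e \<in> g ` A))"
    unfolding cov_def by simp
  also have "\<dots> = cov f e"
    unfolding cov_def by (intro arg_cong2[of _ _ _ _ "(-)"] arg_cong2[of _ _ _ _ "(*)"] ex_cong) (auto simp: f in_image)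
  finally show ?thesis .
qed

end

section \<open>Chains as a vector space\<close>

context vector_space begin

lemma dim_insert_finite:
  assumes "finite S"
  shows "dim (insert x S) = (if x \<in> span S then dim S else Suc (dim S))"
proof -
  obtain B where B: "B \<subseteq> S" "independent B" "S \<subseteq> span B" "card B = dim S"
    by (rule basis_exists)
  have "finite B" using B(1) assms finite_subset by blast
  have sp: "span B = span S" using B(1,3) by (simp add: span_mono span_minimal subset_antisym)
  show ?thesis
  proof (cases "x \<in> span S")
    case True
    then have "span (insert x S) = span S" by (rule span_redundant)
    then have "dim (insert x S) = dim S" by (rule span_eq_dim)
    with True show ?thesis by simp
  next
    case False
    then have "independent (insert x B)" using B(2) sp independent_insertI by simp
    moreover have "insert x B \<subseteq> insert x S" using B(1) by auto
    moreover have "insert x S \<subseteq> span (insert x B)"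
      using B(3) span_mono[of B "insert x B"] span_base[of x "insert x B"] by auto
    ultimately have "card (insert x B) = dim (insert x S)" by (intro basis_card_eq_dim)
    moreover have "x \<notin> B" using False sp span_base by auto
    ultimately show ?thesis using False B(4) \<open>finite B\<close> by simp
  qed
qed

text \<open>The space of all chains has infinite dimension, so dimension counts need a finite
  spanning set \<open>T\<close>.\<close>

lemma finite_basis_exists:
  assumes "V \<subseteq> span T" "finite T"
  obtains B where "B \<subseteq> V" "independent B" "V \<subseteq> span B" "card B = dim V" "finite B"
proof -
  obtain B where B: "B \<subseteq> V" "independent B" "V \<subseteq> span B" "card B = dim V"
    by (rule basis_exists)
  moreover have "finite B" using independent_span_bound[OF assms(2) B(2)] B(1) assms(1) by auto
  ultimately show ?thesis using that by blast
qed

lemma dim_psubset_finite: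
  assumes "subspace U" "U \<subset> V" "V \<subseteq> span T" "finite T"
  shows "dim U < dim V"
proof -
  obtain B where B: "B \<subseteq> U" "independent B" "U \<subseteq> span B" "card B = dim U" "finite B"
  proof (rule finite_basis_exists)
    show "U \<subseteq> span T" using assms by blast
  qed (use assms(4) in auto)
  obtain C where C: "V \<subseteq> span C" "card C = dim V" "finite C"
    using finite_basis_exists[OF assms(3,4)] by metis
  obtain x where x: "x \<in> V" "x \<notin> U" using assms(2) by blast
  have "span B = U" using B(1,3) assms(1) by (simp add: span_minimal subset_antisym)
  then have "independent (insert x B)" "x \<notin> B" using x B(1,2) independent_insertI by auto
  moreover have "insert x B \<subseteq> span C" using x B(1) C(1) assms(2) by auto
  ultimately have "card (insert x B) \<le> card C" using independent_span_bound[OF C(3)] by blast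
  then show ?thesis using B C \<open>x \<notin> B\<close> by simp
qed

lemma dim_le_add_card:
  assumes "B \<subseteq> span T" "finite T" "V \<subseteq> span (B \<union> S)" "finite S"
  shows "dim V \<le> dim B + card S"
proof -
  obtain C where C: "B \<subseteq> span C" "card C = dim B" "finite C"
    using finite_basis_exists[OF assms(1,2)] by metis
  have "B \<union> S \<subseteq> span (C \<union> S)"
    using C(1) span_mono[of C "C \<union> S"] span_superset[of "C \<union> S"] by auto
  then have "span (B \<union> S) \<subseteq> span (C \<union> S)" by (simp add: span_minimal)
  then have "dim V \<le> card (C \<union> S)" using assms C by (intro dim_le_card) auto
  also have "\<dots> \<le> dim B + card S" using card_Un_le[of C S] C by simp
  finally show ?thesis .
qed

lemma dim_mono_finite:
  assumes "U \<subseteq> span V" "V \<subseteq> span T" "finite T"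
  shows "dim U \<le> dim V"
  using dim_le_add_card[of V T U "{}"] assms by simp

end

interpretation chain: vector_space "scale_chain :: 'f::field \<Rightarrow> 'f chain \<Rightarrow> 'f chain"
  by unfold_locales (rule scale_chain_simps)+

interpretation chain_functional: vector_space_pair
  "scale_chain :: 'f::field \<Rightarrow> 'f chain \<Rightarrow> 'f chain" "(*) :: 'f \<Rightarrow> 'f \<Rightarrow> 'f"
  by unfold_locales (simp_all add: algebra_simps)

abbreviation key_set :: "'f::field chain \<Rightarrow> cell set" where "key_set \<equiv> Poly_Mapping.keys"
abbreviation coef :: "'f::field chain \<Rightarrow> cell \<Rightarrow> 'f" where "coef \<equiv> Poly_Mapping.lookup"

definition cell_chain :: "cell \<Rightarrow> 'f::field chain" where
  "cell_chain \<sigma> = Poly_Mapping.single \<sigma> 1"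

definition lin :: "(cell \<Rightarrow> 'f::field chain) \<Rightarrow> 'f chain \<Rightarrow> 'f chain" where
  "lin F c = (\<Sum>\<sigma>\<in>key_set c. scale_chain (coef c \<sigma>) (F \<sigma>))"

definition supp :: "cell set \<Rightarrow> 'f::field chain set" where
  "supp P = {c. key_set c \<subseteq> P}"

text \<open>The bilinear form for which the cells are orthonormal; through it chains also serve as
  cochains.\<close>

definition pairing :: "'f::field chain \<Rightarrow> 'f chain \<Rightarrow> 'f" where
  "pairing c y = (\<Sum>\<sigma>\<in>key_set c. coef c \<sigma> * coef y \<sigma>)"

lemma coef_sum [simp]: "coef (\<Sum>x\<in>S. f x) \<sigma> = (\<Sum>x\<in>S. coef (f x) \<sigma>)"
  by (induction S rule: infinite_finite_induct) (auto simp: lookup_add)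

lemma coef_add [simp]: "coef (a + b) \<sigma> = coef a \<sigma> + coef b \<sigma>"
  by (simp add: lookup_add)

lemma coef_diff [simp]: "coef (a - b) \<sigma> = coef a \<sigma> - coef b \<sigma>"
  by (simp add: lookup_minus)

lemma coef_cell_chain: "coef (cell_chain \<sigma>) \<tau> = of_bool (\<sigma> = \<tau>)"
  by (simp add: cell_chain_def lookup_single when_def)

lemma supp_iff: "c \<in> supp P \<longleftrightarrow> (\<forall>\<sigma>. \<sigma> \<notin> P \<longrightarrow> coef c \<sigma> = 0)"
  by (auto simp: supp_def in_keys_iff)

lemma suppD: "c \<in> supp P \<Longrightarrow> \<sigma> \<notin> P \<Longrightarrow> coef c \<sigma> = 0"
  unfolding supp_iff by blast

lemma supp_keysD: "c \<in> supp P \<Longrightarrow> \<sigma> \<in> key_set c \<Longrightarrow> \<sigma> \<in> P"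
  by (auto simp: supp_def)

lemma supp_mono: "P \<subseteq> Q \<Longrightarrow> supp P \<subseteq> supp Q"
  by (auto simp: supp_def)

lemma subspace_supp: "chain.subspace (supp P)"
  by (auto simp: chain.subspace_def supp_iff)

lemma lin_superset:
  assumes "finite S" "c \<in> supp S"
  shows "lin F c = (\<Sum>\<sigma>\<in>S. scale_chain (coef c \<sigma>) (F \<sigma>))"
  unfolding lin_def using assms
  by (intro sum.mono_neutral_left) (auto simp: in_keys_iff scale_chain_simps supp_def)

lemma lin_add: "lin F (c + c') = lin F c + lin F c'"
proof -
  let ?S = "key_set c \<union> key_set c'"
  have "c \<in> supp ?S" "c' \<in> supp ?S" "c + c' \<in> supp ?S"
    using Poly_Mapping.keys_add[of c c'] by (auto simp: supp_def)
  then show ?thesis by (simp add: lin_superset[of ?S] scale_chain_simps sum.distrib)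
qed

lemma lin_scale: "lin F (scale_chain a c) = scale_chain a (lin F c)"
proof -
  have "scale_chain a c \<in> supp (key_set c)" "c \<in> supp (key_set c)" by (auto simp: supp_iff in_keys_iff)
  then show ?thesis by (simp add: lin_superset[of "key_set c"] scale_chain_sum scale_chain_simps)
qed

lemma lin_0 [simp]: "lin F 0 = 0" by (simp add: lin_def)

lemma lin_sum: "lin F (\<Sum>x\<in>S. f x) = (\<Sum>x\<in>S. lin F (f x))"
  by (induction S rule: infinite_finite_induct) (auto simp: lin_add)

lemma lin_diff: "lin F (c - c') = lin F c - lin F c'"
  using lin_add[of F c "- c'"] lin_scale[of F "-1" c'] by (simp add: scale_chain_neg)

lemma lin_cell_chain: "lin F (cell_chain \<sigma>) = F \<sigma>"
  by (simp add: lin_def cell_chain_def scale_chain_simps)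

lemma lin_lin: "lin F (lin G c) = lin (\<lambda>\<sigma>. lin F (G \<sigma>)) c"
  unfolding lin_def[of G] lin_def[of "\<lambda>\<sigma>. lin F (G \<sigma>)"] lin_sum lin_scale ..

lemma lin_id: "lin cell_chain c = c"
  by (rule poly_mapping_eqI) (auto simp: lin_def coef_cell_chain sum.delta in_keys_iff of_bool_def
      if_distrib cong: if_cong)

lemma boundary_lin: "boundary N c = lin (cell_boundary N) c"
  by (simp add: boundary_def lin_def)

lemma lin_fun_diff: "lin (\<lambda>\<sigma>. F \<sigma> - G \<sigma>) c = lin F c - lin G c"
  by (simp add: lin_def scale_chain_diff sum_subtractf)

lemma lin_cong: "(\<And>\<sigma>. \<sigma> \<in> key_set c \<Longrightarrow> F \<sigma> = G \<sigma>) \<Longrightarrow> lin F c = lin G c"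
  by (simp add: lin_def)

lemma lin_in_subspace:
  assumes "chain.subspace V" "\<And>\<sigma>. \<sigma> \<in> key_set c \<Longrightarrow> F \<sigma> \<in> V"
  shows "lin F c \<in> V"
  unfolding lin_def using assms by (intro chain.subspace_sum chain.subspace_scale)

lemma cell_chain_in_supp: "cell_chain \<sigma> \<in> supp P \<longleftrightarrow> \<sigma> \<in> P"
  by (simp add: supp_def cell_chain_def)

lemma supp_eq_span:
  assumes "finite P"
  shows "supp P = (chain.span (cell_chain ` P) :: 'f::field chain set)"
proof
  show "supp P \<subseteq> (chain.span (cell_chain ` P) :: 'f chain set)"
  proof
    fix c :: "'f chain" assume "c \<in> supp P"
    then have "lin cell_chain c \<in> chain.span (cell_chain ` P)"
      by (intro lin_in_subspace chain.subspace_span chain.span_base) (auto simp: supp_def)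
    then show "c \<in> chain.span (cell_chain ` P)" by (simp add: lin_id)
  qed
  show "chain.span (cell_chain ` P) \<subseteq> (supp P :: 'f chain set)"
    by (intro chain.span_minimal subspace_supp) (auto simp: cell_chain_in_supp)
qed

lemma pairing_superset:
  assumes "finite S" "c \<in> supp S"
  shows "pairing c y = (\<Sum>\<sigma>\<in>S. coef c \<sigma> * coef y \<sigma>)"
  unfolding pairing_def using assms
  by (intro sum.mono_neutral_left) (auto simp: in_keys_iff supp_def)

text \<open>Extend the functional that is 1 at \<open>x\<close> and 0 on a basis of
  \<open>U\<close>, and record its values on the cells of \<open>P\<close>. On chains supported in
  the finite set \<open>P\<close> every functional is a \<open>pairing\<close> with such a
  record.\<close>

lemma separation:
  fixes U :: "'f::field chain set"
  assumes "chain.subspace U" "U \<subseteq> supp P" "x \<in> supp P" "x \<notin> U" "finite P"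
  shows "\<exists>y\<in>supp P. (\<forall>u\<in>U. pairing u y = 0) \<and> pairing x y \<noteq> 0"
proof -
  obtain B where B: "B \<subseteq> U" "chain.independent B" "U \<subseteq> chain.span B"
    by (rule chain.basis_exists)
  have "chain.span B = U" using B(1,3) assms(1) by (simp add: chain.span_minimal subset_antisym)
  then have "x \<notin> chain.span B" using assms(4) by simp
  then have "chain.independent (insert x B)" using B(2) by (rule chain.independent_insertI)
  then obtain g where g: "Vector_Spaces.linear scale_chain (*) g" "\<forall>b\<in>insert x B. g b = of_bool (b = x)"
    using chain_functional.linear_independent_extend[of "insert x B" "\<lambda>b. of_bool (b = x)"] by blast
  have g0: "g u = 0" if "u \<in> U" for u
    using chain_functional.linear_eq_0_on_span[OF g(1), of B u] g(2) that B(1,3) assms(4) by auto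
  define y where "y = (\<Sum>\<sigma>\<in>P. scale_chain (g (cell_chain \<sigma>)) (cell_chain \<sigma>))"
  have y: "coef y \<sigma> = (if \<sigma> \<in> P then g (cell_chain \<sigma>) else 0)" for \<sigma>
    using assms(5) by (simp add: y_def coef_cell_chain of_bool_def if_distrib sum.delta' cong: if_cong)
  have "pairing u y = g u" if "u \<in> supp P" for u
  proof -
    have "g u = g (lin cell_chain u)" by (simp add: lin_id)
    also have "\<dots> = (\<Sum>\<sigma>\<in>P. g (scale_chain (coef u \<sigma>) (cell_chain \<sigma>)))"
      using that assms(5) by (simp add: lin_superset[of P] chain_functional.linear_sum[OF g(1)])
    also have "\<dots> = pairing u y"
      using that assms(5)
      by (simp add: pairing_superset[of P] y chain_functional.linear_scale[OF g(1)])
    finally show ?thesis ..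
  qed
  moreover have "y \<in> supp P" by (simp add: supp_iff y)
  ultimately show ?thesis using assms g0 g(2) by (intro bexI[of _ y]) auto
qed

lemma dim_lin_image_le:
  fixes S :: "'f::field chain set"
  assumes "finite S"
  shows "chain.dim (lin F ` S) \<le> chain.dim S"
proof -
  obtain B where B: "B \<subseteq> S" "S \<subseteq> chain.span B" "card B = chain.dim S"
    by (rule chain.basis_exists)
  have "finite B" using B(1) assms finite_subset by blast
  have sub: "chain.subspace {c. lin F c \<in> chain.span (lin F ` B)}"
    using chain.subspace_span[of "lin F ` B"]
    by (auto simp: chain.subspace_def lin_add lin_scale)
  have "chain.span B \<subseteq> {c. lin F c \<in> chain.span (lin F ` B)}"
    using chain.span_superset[of "lin F ` B"] by (intro chain.span_minimal sub) auto
  then have "lin F ` S \<subseteq> chain.span (lin F ` B)" using B(2) by auto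
  then have "chain.dim (lin F ` S) \<le> card (lin F ` B)"
    using \<open>finite B\<close> by (intro chain.dim_le_card) auto
  also have "\<dots> \<le> card B" using \<open>finite B\<close> by (rule card_image_le)
  finally show ?thesis using B(3) by simp
qed

section \<open>The complex of the torus and its symmetries\<close>

definition face_sign :: "nat set \<Rightarrow> nat \<Rightarrow> 'f::field" where
  "face_sign D j = (- 1) ^ card {k \<in> D. k < j}"

lemma face_sign_sq [simp]: "face_sign D j * face_sign D j = 1"
  by (simp add: face_sign_def flip: power_mult_distrib)

lemma cell_boundary_eq:
  "cell_boundary N \<sigma> = (\<Sum>j\<in>snd \<sigma>. scale_chain (face_sign (snd \<sigma>) j)
     (cell_chain (front_face N j \<sigma>) - cell_chain (back_face j \<sigma>)))"
  by (simp add: cell_boundary_def face_sign_def cell_chain_def)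

definition incidence :: "nat \<Rightarrow> cell \<Rightarrow> cell \<Rightarrow> 'f::field" where
  "incidence N \<sigma> \<rho> = coef (cell_boundary N \<sigma>) \<rho>"

lemma incidence_eq:
  "incidence N \<sigma> \<rho> = (\<Sum>j\<in>snd \<sigma>. face_sign (snd \<sigma>) j *
     (of_bool (front_face N j \<sigma> = \<rho>) - of_bool (back_face j \<sigma> = \<rho>)))"
  by (simp add: incidence_def cell_boundary_eq coef_cell_chain)

lemma coef_boundary:
  assumes "finite S" "c \<in> supp S"
  shows "coef (boundary N c) \<rho> = (\<Sum>\<sigma>\<in>S. coef c \<sigma> * incidence N \<sigma> \<rho>)"
  using assms by (simp add: boundary_lin lin_superset incidence_def)

locale torus_complex =
  fixes N d :: nat
  assumes N_pos: "0 < N"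
begin

abbreviation "X \<equiv> torus d N"

lemma finite_X: "finite X" by (rule finite_torus)

lemma in_X_iff: "(v, D) \<in> X \<longleftrightarrow> v \<in> {..<d} \<rightarrow>\<^sub>E {..<N} \<and> D \<subseteq> {..<d}"
  by (simp add: torus_def)

lemma fun_upd_PiE: "v \<in> {..<d} \<rightarrow>\<^sub>E {..<N} \<Longrightarrow> j < d \<Longrightarrow> a < N \<Longrightarrow> v(j := a) \<in> {..<d} \<rightarrow>\<^sub>E {..<N}"
  by (auto simp: PiE_def extensional_def Pi_def)

lemma finite_dirs: "\<sigma> \<in> X \<Longrightarrow> finite (snd \<sigma>)"
  by (cases \<sigma>) (auto simp: in_X_iff intro: finite_subset)

lemma faces_in_X: "\<sigma> \<in> X \<Longrightarrow> j \<in> snd \<sigma> \<Longrightarrow> front_face N j \<sigma> \<in> X \<and> back_face j \<sigma> \<in> X"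
proof -
  assume \<sigma>: "\<sigma> \<in> X" "j \<in> snd \<sigma>"
  obtain v D where vD: "\<sigma> = (v, D)" by (cases \<sigma>)
  then have v: "v \<in> {..<d} \<rightarrow>\<^sub>E {..<N}" "D \<subseteq> {..<d}" "j < d" using \<sigma> by (auto simp: in_X_iff)
  then have "v(j := (v j + 1) mod N) \<in> {..<d} \<rightarrow>\<^sub>E {..<N}"
    using N_pos by (intro fun_upd_PiE) auto
  then show ?thesis using v vD by (auto simp: front_face_def back_face_def in_X_iff)
qed

lemma cell_boundary_supp: "\<sigma> \<in> cells_of_dim X (Suc k) \<Longrightarrow> cell_boundary N \<sigma> \<in> supp (cells_of_dim X k)"
  unfolding cell_boundary_eq
  by (intro chain.subspace_sum subspace_supp chain.subspace_scale chain.subspace_diff)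
    (use faces_in_X in \<open>auto simp: cell_chain_in_supp cells_of_dim_def cell_dim_def front_face_def
      back_face_def finite_dirs split: prod.splits\<close>)

lemma incidence_outside: "\<sigma> \<in> X \<Longrightarrow> \<rho> \<notin> X \<Longrightarrow> incidence N \<sigma> \<rho> = 0"
  using faces_in_X[of \<sigma>] unfolding incidence_eq by (intro sum.neutral) auto

abbreviation "cells k \<equiv> cells_of_dim X k"

lemma finite_cells: "finite (cells k)"
  using finite_X by (simp add: cells_of_dim_def)

lemma cells_subset: "cells k \<subseteq> X" by (auto simp: cells_of_dim_def)

lemma C_supp_X: "c \<in> supp (cells k) \<Longrightarrow> c \<in> supp X"
  using supp_mono[OF cells_subset] by blast

abbreviation "C k \<equiv> (supp (cells k) :: 'f::field chain set)"

lemma chains_eq: "chains P k = supp (cells_of_dim P k)"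
  by (simp add: chains_def supp_def)

lemma boundary_in_C: "c \<in> C (Suc k) \<Longrightarrow> boundary N c \<in> C k"
  unfolding boundary_lin
  by (intro lin_in_subspace subspace_supp cell_boundary_supp) (auto simp: supp_def)

definition Z :: "nat \<Rightarrow> 'f::field chain set" where "Z k = {c \<in> C k. boundary N c = 0}"
definition B :: "nat \<Rightarrow> 'f::field chain set" where "B k = boundary N ` C (Suc k)"

lemma Z_eq_cycles: "Z k = cycles N X k" by (simp add: Z_def cycles_def chains_eq)
lemma B_eq_boundaries: "B k = boundaries N X k" by (simp add: B_def boundaries_def chains_eq)

lemma B_subset_Z: "B k \<subseteq> Z k"
  unfolding Z_eq_cycles B_eq_boundaries using faces_in_X
  by (intro boundaries_subset_cycles_torus[of _ d]) auto

lemma subspace_Z: "chain.subspace (Z k)"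
  by (simp add: chain.subspace_def Z_eq_cycles cycles_closed)

lemma subspace_B: "chain.subspace (B k)"
  by (simp add: chain.subspace_def B_eq_boundaries boundaries_closed)

end

section \<open>Signed symmetries of the cell complex\<close>

definition push :: "(cell \<Rightarrow> cell) \<Rightarrow> (cell \<Rightarrow> 'f::field) \<Rightarrow> 'f chain \<Rightarrow> 'f chain" where
  "push g s = lin (\<lambda>\<sigma>. scale_chain (s \<sigma>) (cell_chain (g \<sigma>)))"

lemma coef_push:
  assumes "finite S" "inj_on g S" "c \<in> supp S" "\<sigma> \<in> S"
  shows "coef (push g s c) (g \<sigma>) = s \<sigma> * coef c \<sigma>"
proof -
  have "coef (push g s c) (g \<sigma>) = (\<Sum>\<tau>\<in>S. coef c \<tau> * (s \<tau> * of_bool (g \<tau> = g \<sigma>)))"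
    by (simp only: push_def lin_superset[OF assms(1,3)] coef_sum lookup_scale_chain coef_cell_chain)
  also have "\<dots> = (\<Sum>\<tau>\<in>S. if \<tau> = \<sigma> then s \<sigma> * coef c \<sigma> else 0)"
    using assms by (intro sum.cong) (auto dest: inj_onD)
  finally show ?thesis using assms by simp
qed

lemma push_supp: "c \<in> supp P \<Longrightarrow> push g s c \<in> supp (g ` P)"
  unfolding push_def
  by (intro lin_in_subspace subspace_supp chain.subspace_scale) (auto simp: cell_chain_in_supp dest: supp_keysD)

lemma push_0 [simp]: "push g s 0 = 0" by (simp add: push_def)

text \<open>The signs \<open>s\<close> record where \<open>g\<close> reverses orientations.
  Coefficient by coefficient, \<open>compat\<close> says that \<open>G\<close> commutes with the
  boundary.\<close>

locale cell_symmetry = torus_complex N d for N d :: nat +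
  fixes g :: "cell \<Rightarrow> cell" and s :: "cell \<Rightarrow> 'f::field"
  assumes g_bij: "bij_betw g X X"
    and s_sq: "s \<sigma> * s \<sigma> = 1"
    and g_dim: "\<sigma> \<in> X \<Longrightarrow> cell_dim (g \<sigma>) = cell_dim \<sigma>"
    and compat: "\<sigma> \<in> X \<Longrightarrow> \<rho> \<in> X \<Longrightarrow> s \<sigma> * incidence N (g \<sigma>) (g \<rho>) = s \<rho> * incidence N \<sigma> \<rho>"
begin

abbreviation "G \<equiv> push g s"

text \<open>The inverse of \<open>G\<close>; the same signs serve since each is its own
  inverse.\<close>

definition pull :: "'f chain \<Rightarrow> 'f chain" where
  "pull = lin (\<lambda>\<sigma>. scale_chain (s (the_inv_into X g \<sigma>)) (cell_chain (the_inv_into X g \<sigma>)))"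

lemma g_inj: "inj_on g X" and g_image: "g ` X = X"
  using g_bij by (auto simp: bij_betw_def)

lemma coef_G: "c \<in> supp X \<Longrightarrow> \<sigma> \<in> X \<Longrightarrow> coef (G c) (g \<sigma>) = s \<sigma> * coef c \<sigma>"
  using finite_X g_inj by (rule coef_push)

lemma pull_G: "c \<in> supp X \<Longrightarrow> pull (G c) = c"
proof -
  assume c: "c \<in> supp X"
  have "pull (G c) = lin (\<lambda>\<sigma>. lin (\<lambda>\<sigma>. scale_chain (s (the_inv_into X g \<sigma>)) (cell_chain (the_inv_into X g \<sigma>)))
      (scale_chain (s \<sigma>) (cell_chain (g \<sigma>)))) c"
    by (simp add: pull_def push_def lin_lin)
  also have "\<dots> = lin cell_chain c"
    using c g_inj by (intro lin_cong) (auto simp: lin_scale lin_cell_chain the_inv_into_f_f supp_def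
        scale_chain_simps s_sq)
  finally show ?thesis by (simp add: lin_id)
qed

lemma G_pull: "c \<in> supp X \<Longrightarrow> G (pull c) = c"
proof -
  assume c: "c \<in> supp X"
  have "G (pull c) = lin (\<lambda>\<sigma>. lin (\<lambda>\<sigma>. scale_chain (s \<sigma>) (cell_chain (g \<sigma>)))
     (scale_chain (s (the_inv_into X g \<sigma>)) (cell_chain (the_inv_into X g \<sigma>)))) c"
    by (simp add: pull_def push_def lin_lin)
  also have "\<dots> = lin cell_chain c"
    using c g_inj g_image by (intro lin_cong) (auto simp: lin_scale lin_cell_chain f_the_inv_into_f supp_def
        scale_chain_simps s_sq)
  finally show ?thesis by (simp add: lin_id)
qed

lemma cells_image: "g ` cells k = cells k"
proof -
  have "g ` cells k \<subseteq> cells k" using g_image g_dim by (auto simp: cells_of_dim_def)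
  moreover have "\<sigma> \<in> g ` cells k" if "\<sigma> \<in> cells k" for \<sigma>
    using that g_image g_dim by (auto simp: cells_of_dim_def)
      (metis (mono_tags, lifting) g_dim g_image imageE imageI mem_Collect_eq)
  ultimately show ?thesis by blast
qed

lemma G_C: "c \<in> supp (cells k) \<Longrightarrow> G c \<in> supp (cells k)"
  using push_supp[of c "cells k" g s] by (simp add: cells_image)

lemma pull_supp:
  assumes "c \<in> supp (g ` P)" "P \<subseteq> X"
  shows "pull c \<in> supp P"
  unfolding pull_def
proof (intro lin_in_subspace subspace_supp chain.subspace_scale)
  fix \<sigma> assume "\<sigma> \<in> key_set c"
  then obtain \<tau> where "\<tau> \<in> P" "\<sigma> = g \<tau>" using assms by (auto simp: supp_def)
  then show "cell_chain (the_inv_into X g \<sigma>) \<in> supp P"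
    using assms(2) g_inj by (auto simp: the_inv_into_f_f cell_chain_in_supp)
qed

lemma pull_C: "c \<in> supp (cells k) \<Longrightarrow> pull c \<in> supp (cells k)"
  using pull_supp[of c "cells k"] cells_subset by (simp add: cells_image)

lemma boundary_G:
  assumes "c \<in> supp X"
  shows "boundary N (G c) = G (boundary N c)"
proof (rule poly_mapping_eqI)
  fix \<rho>
  have Gc: "G c \<in> supp X" using push_supp[OF assms, of g s] g_image by simp
  have bX: "boundary N c \<in> supp X" if "c \<in> supp X" for c
    unfolding supp_iff using that finite_X
    by (auto simp: coef_boundary[of X] incidence_outside intro!: sum.neutral)
  show "coef (boundary N (G c)) \<rho> = coef (G (boundary N c)) \<rho>"
  proof (cases "\<rho> \<in> X")
    case False
    have "G (boundary N c) \<in> supp X" using push_supp[OF bX[OF assms], of g s] g_image by simp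
    then show ?thesis using False bX[OF Gc] by (simp add: suppD)
  next
    case True
    then obtain \<rho>' where \<rho>': "\<rho>' \<in> X" "\<rho> = g \<rho>'" using g_image by blast
    have "coef (boundary N (G c)) \<rho> = (\<Sum>\<sigma>\<in>X. coef (G c) \<sigma> * incidence N \<sigma> (g \<rho>'))"
      using Gc finite_X by (simp add: coef_boundary \<rho>')
    also have "\<dots> = (\<Sum>\<sigma>\<in>X. coef (G c) (g \<sigma>) * incidence N (g \<sigma>) (g \<rho>'))"
      by (rule sum.reindex_bij_betw[OF g_bij, symmetric])
    also have "\<dots> = (\<Sum>\<sigma>\<in>X. s \<rho>' * (coef c \<sigma> * incidence N \<sigma> \<rho>'))"
      using assms \<rho>' compat by (intro sum.cong) (auto simp: coef_G algebra_simps)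
    also have "\<dots> = s \<rho>' * coef (boundary N c) \<rho>'"
      using assms finite_X by (simp add: coef_boundary sum_distrib_left)
    also have "\<dots> = coef (G (boundary N c)) \<rho>"
      using coef_G[OF bX[OF assms] \<rho>'(1)] \<rho>' by simp
    finally show ?thesis .
  qed
qed

lemma G_Z: "G ` Z k = Z k"
proof
  show "G ` Z k \<subseteq> Z k"
    using G_C by (auto simp: Z_def boundary_G[OF C_supp_X])
  show "Z k \<subseteq> G ` Z k"
  proof
    fix z :: "'f chain" assume z: "z \<in> Z k"
    then have zC: "z \<in> supp (cells k)" "boundary N z = 0" by (auto simp: Z_def)
    have p: "pull z \<in> supp (cells k)" by (rule pull_C[OF zC(1)])
    have bX: "boundary N (pull z) \<in> supp X"
      unfolding supp_iff using C_supp_X[OF p] finite_X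
      by (auto simp: coef_boundary[of X] incidence_outside intro!: sum.neutral)
    have "G (boundary N (pull z)) = 0"
      using boundary_G[OF C_supp_X[OF p]] G_pull[OF C_supp_X[OF zC(1)]] zC by simp
    then have "boundary N (pull z) = 0" using pull_G[OF bX] by (simp add: pull_def)
    with p have "pull z \<in> Z k" by (simp add: Z_def)
    then show "z \<in> G ` Z k" using G_pull[OF C_supp_X[OF zC(1)]] by (metis imageI)
  qed
qed

lemma G_B: "G ` B k = B k"
proof
  show "G ` B k \<subseteq> B k"
  proof
    fix b :: "'f chain" assume "b \<in> G ` B k"
    then obtain c where "c \<in> supp (cells (Suc k))" "b = G (boundary N c)" by (auto simp: B_def)
    then show "b \<in> B k" using boundary_G[OF C_supp_X] G_C unfolding B_def by (metis imageI)
  qed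
  show "B k \<subseteq> G ` B k"
  proof
    fix b :: "'f chain" assume "b \<in> B k"
    then obtain c where c: "c \<in> supp (cells (Suc k))" "b = boundary N c" by (auto simp: B_def)
    have "b = G (boundary N (pull c))"
      using boundary_G[OF C_supp_X[OF pull_C[OF c(1)]]] G_pull[OF C_supp_X[OF c(1)]] c by simp
    then show "b \<in> G ` B k" using pull_C[OF c(1)] by (auto simp: B_def)
  qed
qed

lemma G_supp: "P \<subseteq> X \<Longrightarrow> G ` supp P = supp (g ` P)"
proof
  assume P: "P \<subseteq> X"
  show "G ` supp P \<subseteq> supp (g ` P)" using push_supp by blast
  show "supp (g ` P) \<subseteq> G ` supp P"
  proof
    fix c :: "'f chain" assume c: "c \<in> supp (g ` P)"
    have "supp (g ` P) \<subseteq> (supp X :: 'f chain set)" using P g_image by (intro supp_mono) blast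
    then have "G (pull c) = c" using c G_pull by blast
    then show "c \<in> G ` supp P" using pull_supp[OF c P] by (metis imageI)
  qed
qed

lemma inj_G: "inj_on G (supp X)"
  by (metis inj_onI pull_G)

lemma G_cell_boundary:
  assumes "\<sigma> \<in> X"
  shows "cell_boundary N (g \<sigma>) = scale_chain (s \<sigma>) (G (cell_boundary N \<sigma>))"
proof -
  have "cell_chain \<sigma> \<in> supp X" using assms by (simp add: cell_chain_in_supp)
  from boundary_G[OF this] have "scale_chain (s \<sigma>) (cell_boundary N (g \<sigma>)) = G (cell_boundary N \<sigma>)"
    by (simp add: push_def boundary_lin lin_cell_chain lin_scale)
  then show ?thesis by (metis s_sq scale_chain_simps(3,4))
qed

end

section \<open>Homology of the torus\<close>

text \<open>Of two distinct directions exactly one precedes the other, so exactly one of the two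
  signs changes when the other direction is inserted or removed. The side faces of a prism cancel
  for this reason.\<close>

lemma face_sign_exchange:
  assumes "j \<notin> D" "k \<in> D" "finite D"
  shows "face_sign D j * face_sign (insert j D) k + face_sign D k * face_sign (D - {k}) j = (0 :: 'f::field)"
proof (cases "k < j")
  case True
  then have "{l \<in> insert j D. l < k} = {l \<in> D. l < k}" "{l \<in> D. l < j} = insert k {l \<in> D - {k}. l < j}"
    using assms by auto
  then show ?thesis using assms(3) by (simp add: face_sign_def)
next
  case False
  then have "{l \<in> insert j D. l < k} = insert j {l \<in> D. l < k}" "{l \<in> D - {k}. l < j} = {l \<in> D. l < j}"
    using assms by (auto, metis nat_neq_iff)
  then show ?thesis using assms by (simp add: face_sign_def)
qed

text \<open>The prism traced by a cell that slides in direction \<open>j\<close> down to coordinate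
  0. A cell extended in that direction has a degenerate prism, hence 0.\<close>

definition sweep :: "nat \<Rightarrow> cell \<Rightarrow> 'f::field chain" where
  "sweep j = (\<lambda>(v, D). if j \<in> D then 0
     else scale_chain (face_sign D j) (\<Sum>u<v j. cell_chain (v(j := u), insert j D)))"

text \<open>The normal form reached after sweeping in the directions below \<open>m\<close>.\<close>

definition normalized :: "nat \<Rightarrow> 'f::field chain \<Rightarrow> bool" where
  "normalized m z \<longleftrightarrow> (\<forall>v D l. (v, D) \<in> key_set z \<longrightarrow> l < m \<longrightarrow> l \<notin> D \<longrightarrow> v l = 0)"

context torus_complex begin

text \<open>The prism identity: the ends of the prism telescope over \<open>u\<close>, and its side
  faces cancel against the prisms over the faces of the cell by
  \<open>face_sign_exchange\<close>.\<close>

lemma sweep_homotopy_off: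
  assumes X: "(v, D) \<in> X" and j: "j < d" "j \<notin> D"
  shows "boundary N (sweep j (v, D)) + lin (sweep j) (cell_boundary N (v, D))
    = (cell_chain (v, D) - cell_chain (v(j := 0), D) :: 'f::field chain)"
proof -
  define D' where "D' = insert j D"
  define s where "s = (face_sign D j :: 'f)"
  define R where "R = (\<lambda>k u. cell_chain (front_face N k (v(j := u), D')) - cell_chain (back_face k (v(j := u), D')) :: 'f chain)"
  have fin: "finite D" using finite_dirs[OF X] by simp
  have D'j: "D' - {j} = D" using j by (auto simp: D'_def)
  have "{k \<in> D'. k < j} = {k \<in> D. k < j}" by (auto simp: D'_def)
  then have s': "face_sign D' j = s" by (simp add: face_sign_def s_def)
  have ss: "s * s = 1" by (simp add: s_def)
  have vj: "v j < N" using X j by (auto simp: in_X_iff)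
  have cb: "cell_boundary N (v(j := u), D') = scale_chain s (cell_chain (v(j := Suc u), D) - cell_chain (v(j := u), D))
     + (\<Sum>k\<in>D. scale_chain (face_sign D' k) (R k u))" if "u < v j" for u
  proof -
    have "cell_boundary N (v(j := u), D') = scale_chain (face_sign D' j) (R j u) + (\<Sum>k\<in>D. scale_chain (face_sign D' k) (R k u))"
      unfolding cell_boundary_eq R_def snd_conv using fin j by (subst (1) D'_def) simp
    moreover have "R j u = cell_chain (v(j := Suc u), D) - cell_chain (v(j := u), D)"
      using that vj by (simp add: R_def front_face_def back_face_def D'j)
    ultimately show ?thesis by (simp add: s')
  qed
  have "boundary N (sweep j (v, D)) = scale_chain s (\<Sum>u<v j. cell_boundary N (v(j := u), D'))"
    using j by (simp add: sweep_def boundary_scale boundary_sum s_def D'_def cell_chain_def boundary_single)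
  also have "(\<Sum>u<v j. cell_boundary N (v(j := u), D'))
      = (\<Sum>u<v j. scale_chain s (cell_chain (v(j := Suc u), D) - cell_chain (v(j := u), D)))
       + (\<Sum>u<v j. \<Sum>k\<in>D. scale_chain (face_sign D' k) (R k u))"
    by (simp add: cb sum.distrib)
  also have "(\<Sum>u<v j. scale_chain s (cell_chain (v(j := Suc u), D) - cell_chain (v(j := u), D)))
      = scale_chain s (cell_chain (v, D) - cell_chain (v(j := 0), D))"
    unfolding scale_chain_sum[symmetric] sum_lessThan_telescope[of "\<lambda>u. cell_chain (v(j := u), D)"] by simp
  also have "(\<Sum>u<v j. \<Sum>k\<in>D. scale_chain (face_sign D' k) (R k u)) = (\<Sum>k\<in>D. scale_chain (face_sign D' k) (\<Sum>u<v j. R k u))"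
    by (subst sum.swap) (simp add: scale_chain_sum)
  finally have b: "boundary N (sweep j (v, D)) = (cell_chain (v, D) - cell_chain (v(j := 0), D))
      + (\<Sum>k\<in>D. scale_chain (s * face_sign D' k) (\<Sum>u<v j. R k u))"
    by (simp only: scale_chain_simps(2-4) scale_chain_sum ss)
  have sw: "sweep j (front_face N k (v, D)) - sweep j (back_face k (v, D))
      = scale_chain (face_sign (D - {k}) j) (\<Sum>u<v j. R k u)" if "k \<in> D" for k
  proof -
    have "k \<noteq> j" using that j by auto
    then have "insert j (D - {k}) = D' - {k}" by (auto simp: D'_def)
    then show ?thesis using \<open>k \<noteq> j\<close> j
      by (simp add: sweep_def front_face_def back_face_def R_def sum_subtractf scale_chain_diff fun_upd_twist[of k j])
  qed
  have "lin (sweep j) (cell_boundary N (v, D))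
      = (\<Sum>k\<in>D. scale_chain (face_sign D k) (sweep j (front_face N k (v, D)) - sweep j (back_face k (v, D))))"
    unfolding cell_boundary_eq lin_sum lin_scale lin_diff lin_cell_chain by simp
  also have "\<dots> = (\<Sum>k\<in>D. scale_chain (face_sign D k * face_sign (D - {k}) j) (\<Sum>u<v j. R k u))"
    by (intro sum.cong) (simp_all add: sw scale_chain_simps)
  finally have "boundary N (sweep j (v, D)) + lin (sweep j) (cell_boundary N (v, D))
     = (cell_chain (v, D) - cell_chain (v(j := 0), D))
      + (\<Sum>k\<in>D. scale_chain (s * face_sign D' k + face_sign D k * face_sign (D - {k}) j) (\<Sum>u<v j. R k u))"
    by (simp add: b sum.distrib scale_chain_simps(1))
  also have "(\<Sum>k\<in>D. scale_chain (s * face_sign D' k + face_sign D k * face_sign (D - {k}) j) (\<Sum>u<v j. R k u)) = 0"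
    using fin j by (intro sum.neutral) (simp add: s_def D'_def face_sign_exchange scale_chain_simps)
  finally show ?thesis by (simp only: add_0_right)
qed

text \<open>The prism over the cell vanishes, and the prisms over its two faces in direction
  \<open>j\<close> consist of translates of the cell along \<open>j\<close>. Knowing this support is
  enough to see that directions already normalized stay so.\<close>

lemma sweep_homotopy_on:
  assumes X: "(v, D) \<in> X" and j: "j \<in> D"
  shows "cell_chain (v, D) - boundary N (sweep j (v, D)) - lin (sweep j) (cell_boundary N (v, D))
    \<in> (supp {(v(j := u), D) | u. True} :: 'f::field chain set)"
proof -
  let ?Y = "{(v(j := u), D) | u. True}"
  have "lin (sweep j) (cell_boundary N (v, D)) \<in> (supp ?Y :: 'f chain set)"
    unfolding cell_boundary_eq lin_sum lin_scale lin_diff lin_cell_chain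
  proof (intro chain.subspace_sum chain.subspace_scale subspace_supp)
    fix k assume k: "k \<in> snd (v, D)"
    show "sweep j (front_face N k (v, D)) - sweep j (back_face k (v, D)) \<in> (supp ?Y :: 'f chain set)"
    proof (cases "k = j")
      case True
      have D: "insert j D = D" using j by auto
      have "cell_chain (v(j := u), D) \<in> (supp ?Y :: 'f chain set)" for u
        by (auto simp: cell_chain_in_supp)
      then show ?thesis
        unfolding True by (auto simp: sweep_def front_face_def back_face_def D
            intro!: chain.subspace_diff chain.subspace_scale chain.subspace_sum subspace_supp)
    next
      case False
      then show ?thesis using j
        by (simp add: sweep_def front_face_def back_face_def chain.subspace_0[OF subspace_supp])
    qed
  qed
  moreover have "cell_chain (v, D) \<in> (supp ?Y :: 'f chain set)"
    unfolding cell_chain_in_supp by (auto intro: exI[of _ "v j"])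
  ultimately show ?thesis
    using j by (intro chain.subspace_diff subspace_supp) (auto simp: sweep_def chain.subspace_0[OF subspace_supp])
qed

lemma sweep_in_C:
  assumes "\<sigma> \<in> cells k" "j < d"
  shows "sweep j \<sigma> \<in> (supp (cells (Suc k)) :: 'f::field chain set)"
proof (cases "j \<in> snd \<sigma>")
  case False
  obtain v D where vD: "\<sigma> = (v, D)" by (cases \<sigma>)
  have v: "v \<in> {..<d} \<rightarrow>\<^sub>E {..<N}" "D \<subseteq> {..<d}" "card D = k"
    using assms by (auto simp: vD cells_of_dim_def cell_dim_def in_X_iff)
  then have "finite D" "v j < N" using assms(2) finite_subset by auto
  then have "(v(j := u), insert j D) \<in> cells (Suc k)" if "u < v j" for u
    using v that assms(2) False vD fun_upd_PiE[OF v(1) assms(2), of u]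
    by (simp add: cells_of_dim_def cell_dim_def in_X_iff)
  then show ?thesis using False vD
    by (auto simp: sweep_def cell_chain_in_supp
        intro!: chain.subspace_scale chain.subspace_sum subspace_supp)
qed (cases \<sigma>, simp add: sweep_def chain.subspace_0[OF subspace_supp])

text \<open>Subtracting the boundary of the swept cycle amounts to applying \<open>\<pi>\<close>
  cell by cell, because the cycle has no boundary. The two homotopy lemmas locate the image of every
  cell.\<close>

lemma normalize_step:
  fixes z :: "'f::field chain"
  assumes z: "z \<in> Z k" "normalized j z" and j: "j < d"
  shows "\<exists>z'. z - z' \<in> B k \<and> z' \<in> Z k \<and> normalized (Suc j) z'"
proof -
  define \<pi> where "\<pi> = (\<lambda>\<sigma>. cell_chain \<sigma> - boundary N (sweep j \<sigma>) - lin (sweep j) (cell_boundary N \<sigma>) :: 'f chain)"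
  define t where "t = lin (sweep j) z"
  have zC: "z \<in> supp (cells k)" "boundary N z = 0" using z by (auto simp: Z_def)
  have "lin \<pi> z = z - boundary N t - lin (sweep j) (boundary N z)"
    unfolding \<pi>_def lin_fun_diff lin_id t_def boundary_lin lin_lin ..
  then have z': "lin \<pi> z = z - boundary N t" using zC by simp
  have "t \<in> supp (cells (Suc k))"
    unfolding t_def by (intro lin_in_subspace subspace_supp sweep_in_C[OF _ j] supp_keysD[OF zC(1)])
  then have bt: "boundary N t \<in> B k" by (simp add: B_def)
  have "lin \<pi> z \<in> Z k"
    unfolding z' using z(1) bt B_subset_Z by (intro chain.subspace_diff[OF subspace_Z]) auto
  moreover have "normalized (Suc j) (lin \<pi> z)"
  proof -
    let ?Y = "{(w, D') | w D'. \<forall>l<Suc j. l \<notin> D' \<longrightarrow> w l = 0}"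
    have "lin \<pi> z \<in> supp ?Y"
    proof (intro lin_in_subspace subspace_supp)
      fix \<sigma> assume \<sigma>: "\<sigma> \<in> key_set z"
      obtain v D where vD: "\<sigma> = (v, D)" by (cases \<sigma>)
      have X: "(v, D) \<in> X" using supp_keysD[OF zC(1) \<sigma>] cells_subset vD by blast
      have norm: "v l = 0" if "l < j" "l \<notin> D" for l using z(2) \<sigma> that by (auto simp: normalized_def vD)
      show "\<pi> \<sigma> \<in> supp ?Y"
      proof (cases "j \<in> D")
        case True
        have "\<pi> \<sigma> \<in> supp {(v(j := u), D) | u. True}"
          unfolding \<pi>_def vD by (rule sweep_homotopy_on[OF X True])
        moreover have "{(v(j := u), D) | u. True} \<subseteq> ?Y" using norm True by (auto simp: less_Suc_eq)
        from supp_mono[OF this] have "supp {(v(j := u), D) | u. True} \<subseteq> (supp ?Y :: 'f chain set)" .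
        ultimately show ?thesis by (rule subsetD[rotated])
      next
        case False
        have "\<pi> \<sigma> = cell_chain (v, D) - (boundary N (sweep j (v, D)) + lin (sweep j) (cell_boundary N (v, D)))"
          by (simp add: \<pi>_def vD)
        also have "\<dots> = cell_chain (v(j := 0), D)" unfolding sweep_homotopy_off[OF X j False] by simp
        finally show ?thesis using norm by (auto simp: cell_chain_in_supp less_Suc_eq)
      qed
    qed
    from supp_keysD[OF this] show ?thesis unfolding normalized_def by fast
  qed
  moreover have "z - lin \<pi> z \<in> B k" using bt by (simp add: z')
  ultimately show ?thesis by blast
qed

lemma normalize:
  fixes z :: "'f::field chain"
  assumes "z \<in> Z k" "m \<le> d"
  shows "\<exists>z'. z - z' \<in> B k \<and> z' \<in> Z k \<and> normalized m z'"
  using assms(2)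
proof (induction m)
  case 0
  show ?case using assms(1) chain.subspace_0[OF subspace_B] by (intro exI[of _ z]) (auto simp: normalized_def)
next
  case (Suc m)
  then obtain z' where z': "z - z' \<in> B k" "z' \<in> Z k" "normalized m z'" by auto
  from normalize_step[OF z'(2,3)] Suc.prems obtain z''
    where z'': "z' - z'' \<in> B k" "z'' \<in> Z k" "normalized (Suc m) z''" by auto
  have "(z - z') + (z' - z'') \<in> B k" using z'(1) z''(1) by (rule chain.subspace_add[OF subspace_B])
  with z'' show ?case by auto
qed

definition plane :: "nat set \<Rightarrow> (nat \<Rightarrow> nat) set" where
  "plane I = {v \<in> {..<d} \<rightarrow>\<^sub>E {..<N}. \<forall>l<d. l \<notin> I \<longrightarrow> v l = 0}"

definition subtorus :: "nat set \<Rightarrow> 'f::field chain" where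
  "subtorus I = (\<Sum>v\<in>plane I. cell_chain (v, I))"

definition axes :: "nat \<Rightarrow> nat set set" where
  "axes k = {I. I \<subseteq> {..<d} \<and> card I = k}"

lemma finite_plane: "finite (plane I)"
  by (simp add: plane_def finite_PiE)

text \<open>Consider the boundary of \<open>z\<close> at the common face \<open>\<rho>\<close> of
  the two neighbours. A cell with this face but other directions does not extend along
  \<open>j\<close>, so by normality it has coordinate 0 there, while \<open>\<rho>\<close> lies at
  the positive coordinate \<open>Suc (v j)\<close>. Only the two neighbours contribute, with
  opposite signs.\<close>

lemma coef_shift:
  fixes z :: "'f::field chain"
  assumes z: "z \<in> Z k" "normalized d z" and I: "I \<in> axes k" and v: "v \<in> plane I" and j: "j \<in> I" "Suc (v j) < N"
  shows "coef z (v(j := Suc (v j)), I) = coef z (v, I)"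
proof -
  define w where "w = v(j := Suc (v j))"
  define \<rho> where "\<rho> = (w, I - {j})"
  have jd: "j < d" "finite I" using I j finite_subset by (auto simp: axes_def)
  have vP: "v \<in> {..<d} \<rightarrow>\<^sub>E {..<N}" using v by (simp add: plane_def)
  have wP: "w \<in> {..<d} \<rightarrow>\<^sub>E {..<N}" unfolding w_def using vP jd(1) j(2) by (rule fun_upd_PiE)
  have vw: "(v, I) \<noteq> (w, I)" unfolding w_def by (metis fun_upd_same n_not_Suc_n prod.inject)
  have cells: "(v, I) \<in> cells k" "(w, I) \<in> cells k"
    using vP wP I by (auto simp: cells_of_dim_def cell_dim_def in_X_iff axes_def)
  have zC: "z \<in> supp (cells k)" "boundary N z = 0" using z by (auto simp: Z_def)
  have other: "coef z \<sigma> * incidence N \<sigma> \<rho> = 0" if \<sigma>: "\<sigma> \<in> cells k" "\<sigma> \<noteq> (v, I)" "\<sigma> \<noteq> (w, I)" for \<sigma>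
  proof (rule ccontr)
    assume ne: "coef z \<sigma> * incidence N \<sigma> \<rho> \<noteq> 0"
    obtain u D where uD: "\<sigma> = (u, D)" by (cases \<sigma>)
    have "\<exists>k\<in>D. front_face N k \<sigma> = \<rho> \<or> back_face k \<sigma> = \<rho>"
    proof (rule ccontr)
      assume "\<not> ?thesis"
      then have "incidence N \<sigma> \<rho> = (0::'f)"
        unfolding incidence_eq by (intro sum.neutral) (auto simp: uD)
      with ne show False by simp
    qed
    then obtain l where l: "l \<in> D" "front_face N l \<sigma> = \<rho> \<or> back_face l \<sigma> = \<rho>" by blast
    then have D: "D - {l} = I - {j}" and ul: "u(l := (u l + 1) mod N) = w \<or> u = w"
      by (auto simp: uD front_face_def back_face_def \<rho>_def)
    have key: "(u, D) \<in> key_set z" using ne by (auto simp: uD in_keys_iff)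
    have "l = j"
    proof (rule ccontr)
      assume "l \<noteq> j"
      then have "j \<notin> D" using D by auto
      then have "u j = 0" using z(2) key jd by (auto simp: normalized_def)
      moreover have "u j = w j" using ul \<open>l \<noteq> j\<close> by (metis fun_upd_other)
      ultimately show False by (simp add: w_def)
    qed
    then have DI: "D = I" using D l j by auto
    have "u(j := (u j + 1) mod N) = w" using ul \<sigma> \<open>l = j\<close> by (auto simp: uD DI)
    moreover have "u j < N" using \<sigma>(1) jd by (auto simp: cells_of_dim_def in_X_iff uD)
    ultimately have "(u j + 1) mod N = Suc (v j)" "\<And>x. x \<noteq> j \<Longrightarrow> u x = v x"
      by (metis fun_upd_same w_def, metis fun_upd_other w_def)
    moreover have "u j = v j"
    proof (cases "Suc (u j) = N")
      case True
      then show ?thesis using calculation by simp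
    next
      case False
      then show ?thesis using calculation \<open>u j < N\<close> by simp
    qed
    ultimately have "u = v" by (metis ext)
    then show False using \<sigma> by (simp add: uD DI)
  qed
  have "Suc (Suc (v j)) mod N \<noteq> Suc (v j)"
  proof (cases "Suc (Suc (v j)) = N")
    case False
    then show ?thesis using j(2) by simp
  qed simp
  then have faces: "front_face N j (v, I) = \<rho>" "back_face j (v, I) \<noteq> \<rho>" "front_face N j (w, I) \<noteq> \<rho>" "back_face j (w, I) = \<rho>"
    using j(2) by (auto simp: front_face_def back_face_def \<rho>_def w_def dest: fun_cong[of _ _ j])
  have off: "front_face N l (x, I) \<noteq> \<rho>" "back_face l (x, I) \<noteq> \<rho>" if "l \<noteq> j" for l x
    using that j by (auto simp: front_face_def back_face_def \<rho>_def)
  have inc: "incidence N (x, I) \<rho> = face_sign I j * (of_bool (front_face N j (x, I) = \<rho>) - of_bool (back_face j (x, I) = \<rho>) :: 'f)" for x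
  proof -
    have "incidence N (x, I) \<rho> = (\<Sum>l\<in>I. if l = j then face_sign I j * (of_bool (front_face N j (x, I) = \<rho>) - of_bool (back_face j (x, I) = \<rho>)) else 0 :: 'f)"
      unfolding incidence_eq by (intro sum.cong) (auto simp: off)
    then show ?thesis using jd j by simp
  qed
  have "0 = (\<Sum>\<sigma>\<in>cells k. coef z \<sigma> * incidence N \<sigma> \<rho>)"
    using coef_boundary[OF finite_cells zC(1), of N \<rho>] zC(2) by simp
  also have "\<dots> = (\<Sum>\<sigma>\<in>{(v, I), (w, I)}. coef z \<sigma> * incidence N \<sigma> \<rho>)"
    using cells other by (intro sum.mono_neutral_right finite_cells) auto
  also have "\<dots> = face_sign I j * (coef z (v, I) - coef z (w, I))"
    using vw by (simp add: inc faces algebra_simps)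
  finally have "coef z (v, I) - coef z (w, I) = 0"
    using face_sign_sq[of I j, where ?'a='f] by (metis mult_eq_0_iff zero_neq_one)
  then show ?thesis by (simp add: w_def)
qed

lemma coef_const_on_plane:
  fixes z :: "'f::field chain"
  assumes z: "z \<in> Z k" "normalized d z" and I: "I \<in> axes k" and v: "v \<in> plane I"
  shows "coef z (v, I) = coef z (\<lambda>l\<in>{..<d}. 0, I)"
  using v
proof (induction "\<Sum>l<d. v l" arbitrary: v rule: less_induct)
  case less
  have vP: "v \<in> {..<d} \<rightarrow>\<^sub>E {..<N}" using less.prems by (simp add: plane_def)
  show ?case
  proof (cases "\<exists>j<d. v j \<noteq> 0")
    case False
    then have "v = (\<lambda>l\<in>{..<d}. 0)" using vP by (auto simp: PiE_def extensional_def restrict_def)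
    then show ?thesis by simp
  next
    case True
    then obtain j where j: "j < d" "v j \<noteq> 0" by blast
    then have jI: "j \<in> I" using less.prems by (auto simp: plane_def)
    define u where "u = v(j := v j - 1)"
    have vj: "v j < N" using vP j by auto
    have "u \<in> {..<d} \<rightarrow>\<^sub>E {..<N}" unfolding u_def using vP j(1) vj by (intro fun_upd_PiE) auto
    then have u: "u \<in> plane I" using less.prems jI by (auto simp: plane_def u_def)
    have "(\<Sum>l<d. u l) < (\<Sum>l<d. v l)"
      using j by (intro sum_strict_mono_ex1) (auto simp: u_def)
    then have "coef z (u, I) = coef z (\<lambda>l\<in>{..<d}. 0, I)" using u by (rule less.hyps)
    moreover have "Suc (u j) < N" "u(j := Suc (u j)) = v" using j vj by (auto simp: u_def)
    ultimately show ?thesis using coef_shift[OF z I u jI] by simp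
  qed
qed

text \<open>A fully normalized cycle vanishes off the coordinate planes and is constant on each of
  them, so it is the combination of subtori whose coefficients are its values at the origin.\<close>

theorem torus_homology_generators:
  fixes z :: "'f::field chain"
  assumes "z \<in> Z k"
  shows "\<exists>a. z - (\<Sum>I\<in>axes k. scale_chain (a I) (subtorus I)) \<in> B k"
proof -
  from normalize[OF assms order_refl] obtain z' where z': "z - z' \<in> B k" "z' \<in> Z k" "normalized d z'" by blast
  have fin: "finite (axes k)" by (simp add: axes_def)
  have "z' = (\<Sum>I\<in>axes k. scale_chain (coef z' (\<lambda>l\<in>{..<d}. 0, I)) (subtorus I))" (is "_ = ?s")
  proof (rule poly_mapping_eqI)
    fix \<sigma> :: cell
    obtain v D where \<sigma>: "\<sigma> = (v, D)" by (cases \<sigma>)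
    have sub: "coef (subtorus I) (v, D) = (of_bool (D = I \<and> v \<in> plane I) :: 'f)" for I
    proof -
      have "coef (subtorus I) (v, D) = (\<Sum>u\<in>plane I. if u = v then of_bool (D = I) else 0 :: 'f)"
        unfolding subtorus_def coef_sum coef_cell_chain by (intro sum.cong) auto
      then show ?thesis using finite_plane by simp
    qed
    have s: "coef ?s \<sigma> = (\<Sum>I\<in>axes k. if I = D then coef z' (\<lambda>l\<in>{..<d}. 0, D) * of_bool (v \<in> plane D) else 0)"
      unfolding coef_sum lookup_scale_chain \<sigma> sub by (intro sum.cong) auto
    show "coef z' \<sigma> = coef ?s \<sigma>"
    proof (cases "D \<in> axes k \<and> v \<in> plane D")
      case True
      then show ?thesis using coef_const_on_plane[OF z'(2,3), of D v] fin unfolding s by (simp add: \<sigma>)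
    next
      case False
      have "coef z' \<sigma> = 0"
      proof (rule ccontr)
        assume "coef z' \<sigma> \<noteq> 0"
        then have key: "(v, D) \<in> key_set z'" by (simp add: in_keys_iff \<sigma>)
        then have "(v, D) \<in> cells k" using z'(2) supp_keysD by (auto simp: Z_def)
        then have "v \<in> {..<d} \<rightarrow>\<^sub>E {..<N}" "D \<in> axes k"
          by (auto simp: cells_of_dim_def cell_dim_def in_X_iff axes_def)
        moreover have "\<forall>l<d. l \<notin> D \<longrightarrow> v l = 0" using z'(3) key by (auto simp: normalized_def)
        ultimately show False using False by (simp add: plane_def)
      qed
      moreover have "coef ?s \<sigma> = 0" unfolding s using False by (intro sum.neutral) auto
      ultimately show ?thesis by simp
    qed
  qed
  with z'(1) show ?thesis by metis
qed

end

section \<open>Duality\<close>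

context torus_complex begin

text \<open>The dual cell with the same centre, moved by minus one half in every coordinate so that
  it becomes a cell of the same torus: hence the corner \<open>v j - 1\<close> in the new
  directions. Applied twice, this is the translation by -1 in every coordinate.\<close>

definition star :: "cell \<Rightarrow> cell" where
  "star = (\<lambda>(v, D). (\<lambda>j\<in>{..<d}. if j \<in> D then v j else (v j + N - 1) mod N, {..<d} - D))"

text \<open>Up to a factor depending only on the number of directions, this is the sign of the
  shuffle that lists \<open>D\<close> before its complement.\<close>

definition star_sign :: "cell \<Rightarrow> 'f::field" where
  "star_sign \<sigma> = (- 1) ^ (\<Sum>(snd \<sigma>))"

abbreviation "star_chain \<equiv> push star star_sign"

lemma star_sign_sq [simp]: "star_sign \<sigma> * star_sign \<sigma> = 1"
  by (simp add: star_sign_def flip: power_mult_distrib)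

lemma star_sign_nz [simp]: "star_sign \<sigma> \<noteq> 0"
  by (simp add: star_sign_def)

lemma pred_mod: "a < N \<Longrightarrow> (a + N - 1) mod N = (if a = 0 then N - 1 else a - 1)"
proof (cases "a = 0")
  case False
  then have "a + N - 1 = (a - 1) + N" by simp
  then have "(a + N - 1) mod N = (a - 1) mod N" by (metis mod_add_self2)
  moreover assume "a < N"
  ultimately show ?thesis using False by simp
qed (use N_pos in simp)

lemma pred_eq_iff: "a < N \<Longrightarrow> b < N \<Longrightarrow> (a + N - 1) mod N = b \<longleftrightarrow> (b + 1) mod N = a"
proof -
  assume ab: "a < N" "b < N"
  show ?thesis
  proof (cases "Suc b = N")
    case True
    then show ?thesis unfolding pred_mod[OF ab(1)] using ab by auto
  next
    case False
    then have "(b + 1) mod N = Suc b" using ab by simp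
    then show ?thesis unfolding pred_mod[OF ab(1)] using ab False by auto
  qed
qed

lemma pred_succ: "a < N \<Longrightarrow> ((a + N - 1) mod N + 1) mod N = a"
  using pred_eq_iff[of a "(a + N - 1) mod N"] N_pos by simp

lemma star_in_X: "\<sigma> \<in> X \<Longrightarrow> star \<sigma> \<in> X"
  using N_pos by (cases \<sigma>) (auto simp: star_def torus_def)

lemma star_inj: "inj_on star X"
proof (rule inj_onI)
  fix \<sigma> \<tau> assume X: "\<sigma> \<in> X" "\<tau> \<in> X" and eq: "star \<sigma> = star \<tau>"
  obtain v D u D' where vD: "\<sigma> = (v, D)" "\<tau> = (u, D')" by (cases \<sigma>, cases \<tau>)
  have D: "D = D'" using X eq by (auto simp: vD star_def in_X_iff)
  have "v j = u j" if "j < d" for j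
  proof -
    have "v j < N" "u j < N" using X that by (auto simp: vD in_X_iff)
    moreover have "(if j \<in> D then v j else (v j + N - 1) mod N) = (if j \<in> D then u j else (u j + N - 1) mod N)"
      using eq that D by (auto simp: vD star_def restrict_def dest: fun_cong[of _ _ j] split: if_splits)
    ultimately show ?thesis by (metis pred_succ)
  qed
  moreover have "v \<in> extensional {..<d}" "u \<in> extensional {..<d}" using X by (auto simp: vD in_X_iff PiE_def)
  ultimately have "v = u" by (intro extensionalityI[of _ "{..<d}"]) auto
  then show "\<sigma> = \<tau>" by (simp add: vD D)
qed

lemma star_image_X: "star ` X = X"
  using star_in_X by (intro endo_inj_surj finite_X star_inj) auto

lemma star_bij: "bij_betw star X X"
  by (simp add: bij_betw_def star_inj star_image_X)

lemma star_dim: "\<sigma> \<in> X \<Longrightarrow> cell_dim (star \<sigma>) = d - cell_dim \<sigma>"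
  by (cases \<sigma>) (auto simp: star_def cell_dim_def in_X_iff card_Diff_subset finite_subset)

lemma cell_dim_le: "\<sigma> \<in> X \<Longrightarrow> cell_dim \<sigma> \<le> d"
proof (cases \<sigma>)
  case (Pair v D)
  moreover assume "\<sigma> \<in> X"
  ultimately have "D \<subseteq> {..<d}" by (simp add: in_X_iff)
  then have "card D \<le> card {..<d}" by (intro card_mono) auto
  then show ?thesis by (simp add: Pair cell_dim_def)
qed

lemma star_cells: "k \<le> d \<Longrightarrow> star ` cells k = cells (d - k)"
proof
  assume k: "k \<le> d"
  show "star ` cells k \<subseteq> cells (d - k)" by (auto simp: cells_of_dim_def star_in_X star_dim)
  show "cells (d - k) \<subseteq> star ` cells k"
  proof
    fix \<tau> assume \<tau>: "\<tau> \<in> cells (d - k)"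
    then have "\<tau> \<in> star ` X" by (simp add: star_image_X cells_of_dim_def)
    then obtain \<sigma> where \<sigma>: "\<sigma> \<in> X" "\<tau> = star \<sigma>" by blast
    have "d - cell_dim \<sigma> = d - k" using \<tau> star_dim[OF \<sigma>(1)] by (simp add: cells_of_dim_def \<sigma>(2))
    then have "cell_dim \<sigma> = k" using cell_dim_le[OF \<sigma>(1)] k by linarith
    then show "\<tau> \<in> star ` cells k" using \<sigma> by (auto simp: cells_of_dim_def)
  qed
qed

lemma star_faces:
  assumes X: "(v, D) \<in> X" "(u, D') \<in> X" and j: "j < d" "j \<notin> D" and D': "D' = insert j D"
  shows "front_face N j (star (v, D)) = star (u, D') \<longleftrightarrow> back_face j (u, D') = (v, D)"
    and "back_face j (star (v, D)) = star (u, D') \<longleftrightarrow> front_face N j (u, D') = (v, D)"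
proof -
  define v' where "v' = (\<lambda>j\<in>{..<d}. if j \<in> D then v j else (v j + N - 1) mod N)"
  define u' where "u' = (\<lambda>j\<in>{..<d}. if j \<in> D' then u j else (u j + N - 1) mod N)"
  have dirs: "{..<d} - D - {j} = {..<d} - D'" "D' - {j} = D" using j D' by auto
  have lt: "v l < N" "u l < N" if "l < d" for l using X that by (auto simp: in_X_iff)
  have ext: "f = h \<longleftrightarrow> (\<forall>l<d. f l = h l)" if "f \<in> extensional {..<d}" "h \<in> extensional {..<d}" for f h :: "nat \<Rightarrow> nat"
    using that by (auto intro: extensionalityI)
  have exts: "v \<in> extensional {..<d}" "u \<in> extensional {..<d}" "v' \<in> extensional {..<d}" "u' \<in> extensional {..<d}"
    using X by (auto simp: in_X_iff PiE_def v'_def u'_def)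
  then have exts': "v'(j := a) \<in> extensional {..<d}" "u(j := a) \<in> extensional {..<d}" for a
    using j(1) by (auto simp: extensional_def)
  have off: "v' l = u' l \<longleftrightarrow> v l = u l" if "l < d" "l \<noteq> j" for l
    using that lt[OF that(1)] D' pred_succ by (auto simp: v'_def u'_def) metis
  have j': "v' j = (v j + N - 1) mod N" "u' j = u j" using j D' by (simp_all add: v'_def u'_def)
  have "v'(j := (v' j + 1) mod N) = u' \<longleftrightarrow> (\<forall>l<d. (v'(j := (v' j + 1) mod N)) l = u' l)"
    by (intro ext exts exts')
  also have "\<dots> \<longleftrightarrow> (\<forall>l<d. v l = u l)"
    using off j' lt[OF j(1)] pred_succ[of "v j"] by (auto simp: fun_upd_def)
  also have "\<dots> \<longleftrightarrow> u = v" using ext[OF exts(2,1)] by auto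
  finally show "front_face N j (star (v, D)) = star (u, D') \<longleftrightarrow> back_face j (u, D') = (v, D)"
    by (simp add: front_face_def back_face_def star_def dirs v'_def u'_def)
  have "v' = u' \<longleftrightarrow> (\<forall>l<d. v' l = u' l)"
    by (intro ext exts)
  also have "\<dots> \<longleftrightarrow> (\<forall>l<d. (u(j := (u j + 1) mod N)) l = v l)"
    using off j' j(1) pred_eq_iff[OF lt[OF j(1)]] by (auto simp: fun_upd_def) metis+
  also have "\<dots> \<longleftrightarrow> u(j := (u j + 1) mod N) = v" using ext[OF exts'(2) exts(1)] by auto
  finally show "back_face j (star (v, D)) = star (u, D') \<longleftrightarrow> front_face N j (u, D') = (v, D)"
    by (simp add: front_face_def back_face_def star_def dirs v'_def u'_def)
qed

text \<open>The numbers below \<open>j\<close> are shared out between \<open>D\<close> and its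
  complement, so the two exponents of the face signs add up to \<open>j\<close>, which is the change
  in the sum of the directions.\<close>

lemma star_sign_face:
  assumes "j < d" "j \<notin> D" "D \<subseteq> {..<d}"
  shows "star_sign (v, D) * face_sign ({..<d} - D) j = (star_sign (u, insert j D) * face_sign (insert j D) j :: 'f::field)"
proof -
  have fin: "finite D" using assms(3) finite_subset by blast
  let ?a = "card {k \<in> {..<d} - D. k < j}" and ?b = "card {k \<in> insert j D. k < j}"
  have "{k \<in> {..<d} - D. k < j} \<union> {k \<in> insert j D. k < j} = {..<j}" using assms by auto
  moreover have "card ({k \<in> {..<d} - D. k < j} \<union> {k \<in> insert j D. k < j}) = ?a + ?b"
    using fin by (intro card_Un_disjoint) auto
  ultimately have ab: "?a + ?b = j" by simp
  have "j + \<Sum>D + ?b = (\<Sum>D + ?a) + 2 * ?b" using ab by simp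
  then have "(- 1 :: 'f) ^ (\<Sum>D + ?a) = (- 1) ^ (j + \<Sum>D + ?b)"
    by (simp only: power_add power_mult power2_minus) simp
  then show ?thesis using fin assms(2) by (simp add: star_sign_def face_sign_def power_add)
qed

text \<open>In direction \<open>j\<close> the front face of the dual cell is dual to the back face, hence the sign.\<close>

lemma star_incidence:
  assumes X: "\<sigma> \<in> X" "\<tau> \<in> X"
  shows "star_sign \<sigma> * incidence N (star \<sigma>) (star \<tau>) = - (star_sign \<tau> * incidence N \<tau> \<sigma> :: 'f::field)"
proof -
  obtain v D u D' where vD: "\<sigma> = (v, D)" "\<tau> = (u, D')" by (cases \<sigma>, cases \<tau>)
  have sub: "D \<subseteq> {..<d}" "D' \<subseteq> {..<d}" using X by (auto simp: vD in_X_iff)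
  have sst: "snd (star (v, D)) = {..<d} - D" for v D by (simp add: star_def)
  show ?thesis
  proof (cases "\<exists>j<d. j \<notin> D \<and> D' = insert j D")
    case False
    have "incidence N (star \<sigma>) (star \<tau>) = (0::'f)"
      unfolding incidence_eq
    proof (intro sum.neutral ballI)
      fix j assume "j \<in> snd (star \<sigma>)"
      then have j: "j < d" "j \<notin> D" by (auto simp: vD star_def)
      have "{..<d} - D - {j} \<noteq> {..<d} - D'"
      proof
        assume "{..<d} - D - {j} = {..<d} - D'"
        then have "D' = insert j D" using j sub by blast
        with j False show False by blast
      qed
      then show "face_sign (snd (star \<sigma>)) j * (of_bool (front_face N j (star \<sigma>) = star \<tau>) -
           of_bool (back_face j (star \<sigma>) = star \<tau>)) = (0::'f)"
        by (simp add: front_face_def back_face_def star_def vD)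
    qed
    moreover have "incidence N \<tau> \<sigma> = (0::'f)"
      unfolding incidence_eq
    proof (intro sum.neutral ballI)
      fix j assume "j \<in> snd \<tau>"
      then have j: "j < d" "j \<in> D'" using sub by (auto simp: vD)
      have "D' - {j} \<noteq> D" using j False by blast
      then show "face_sign (snd \<tau>) j * (of_bool (front_face N j \<tau> = \<sigma>) - of_bool (back_face j \<tau> = \<sigma>)) = (0::'f)"
        by (simp add: front_face_def back_face_def vD)
    qed
    ultimately show ?thesis by simp
  next
    case True
    then obtain j where j: "j < d" "j \<notin> D" "D' = insert j D" by blast
    have fin: "finite D'" using sub finite_subset by blast
    have off: "front_face N l (star \<sigma>) \<noteq> star \<tau>" "back_face l (star \<sigma>) \<noteq> star \<tau>" if "l \<in> {..<d} - D" "l \<noteq> j" for l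
    proof -
      have "j \<in> {..<d} - D - {l}" "j \<notin> {..<d} - D'" using that j by auto
      then have "{..<d} - D - {l} \<noteq> {..<d} - D'" by blast
      then show "front_face N l (star \<sigma>) \<noteq> star \<tau>" "back_face l (star \<sigma>) \<noteq> star \<tau>"
        by (simp_all add: vD star_def front_face_def back_face_def)
    qed
    have off': "front_face N l \<tau> \<noteq> \<sigma>" "back_face l \<tau> \<noteq> \<sigma>" if "l \<in> D'" "l \<noteq> j" for l
      using that j by (auto simp: vD front_face_def back_face_def)
    have "incidence N (star \<sigma>) (star \<tau>) = (\<Sum>l\<in>{..<d} - D. if l = j then face_sign ({..<d} - D) j *
       (of_bool (front_face N j (star \<sigma>) = star \<tau>) - of_bool (back_face j (star \<sigma>) = star \<tau>)) else 0 :: 'f)"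
      unfolding incidence_eq by (intro sum.cong) (auto simp: vD sst off[unfolded vD])
    then have 1: "incidence N (star \<sigma>) (star \<tau>) = (face_sign ({..<d} - D) j *
       (of_bool (front_face N j (star \<sigma>) = star \<tau>) - of_bool (back_face j (star \<sigma>) = star \<tau>)) :: 'f)"
      using j by simp
    have "incidence N \<tau> \<sigma> = (\<Sum>l\<in>D'. if l = j then face_sign D' j *
       (of_bool (front_face N j \<tau> = \<sigma>) - of_bool (back_face j \<tau> = \<sigma>)) else 0 :: 'f)"
      unfolding incidence_eq by (intro sum.cong) (auto simp: vD off'[unfolded vD])
    then have 2: "incidence N \<tau> \<sigma> = (face_sign D' j *
       (of_bool (front_face N j \<tau> = \<sigma>) - of_bool (back_face j \<tau> = \<sigma>)) :: 'f)"
      using j fin by simp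
    have 3: "star_sign \<sigma> * face_sign ({..<d} - D) j = (star_sign \<tau> * face_sign D' j :: 'f)"
      using star_sign_face[OF j(1,2) sub(1), of v u, where ?'f = 'f] by (simp add: vD j(3))
    have "star_sign \<sigma> * incidence N (star \<sigma>) (star \<tau>) = (star_sign \<tau> * face_sign D' j *
       (of_bool (back_face j \<tau> = \<sigma>) - of_bool (front_face N j \<tau> = \<sigma>)) :: 'f)"
      unfolding 1 using star_faces[OF X[unfolded vD] j]
      by (simp add: mult.assoc[symmetric] 3) (simp add: vD)
    then show ?thesis unfolding 2 by (simp add: algebra_simps)
  qed
qed

lemma coef_star_chain: "c \<in> supp X \<Longrightarrow> \<sigma> \<in> X \<Longrightarrow> coef (star_chain c) (star \<sigma>) = star_sign \<sigma> * coef c \<sigma>"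
  using finite_X star_inj by (rule coef_push)

text \<open>Up to sign, \<open>star_chain\<close> intertwines coboundary and boundary.\<close>

lemma coef_boundary_star:
  fixes y :: "'f::field chain"
  assumes y: "y \<in> supp X" and \<tau>: "\<tau> \<in> X"
  shows "coef (boundary N (star_chain y)) (star \<tau>) = - (star_sign \<tau> * pairing (cell_boundary N \<tau>) y)"
proof -
  have sy: "star_chain y \<in> supp X" using push_supp[OF y, of star star_sign] by (simp add: star_image_X)
  have cb: "cell_boundary N \<tau> \<in> (supp X :: 'f chain set)"
    unfolding supp_iff incidence_def[symmetric] using incidence_outside[OF \<tau>] by blast
  have "coef (boundary N (star_chain y)) (star \<tau>) = (\<Sum>\<sigma>\<in>X. coef (star_chain y) \<sigma> * incidence N \<sigma> (star \<tau>))"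
    by (rule coef_boundary[OF finite_X sy])
  also have "\<dots> = (\<Sum>\<sigma>\<in>X. coef (star_chain y) (star \<sigma>) * incidence N (star \<sigma>) (star \<tau>))"
    by (rule sum.reindex_bij_betw[OF star_bij, symmetric])
  also have "\<dots> = (\<Sum>\<sigma>\<in>X. coef y \<sigma> * (star_sign \<sigma> * incidence N (star \<sigma>) (star \<tau>)))"
    by (intro sum.cong) (simp_all add: coef_star_chain[OF y] mult_ac)
  also have "\<dots> = (\<Sum>\<sigma>\<in>X. - star_sign \<tau> * (incidence N \<tau> \<sigma> * coef y \<sigma>))"
    by (intro sum.cong) (simp_all add: star_incidence[OF _ \<tau>] mult_ac)
  also have "\<dots> = - (star_sign \<tau> * pairing (cell_boundary N \<tau>) y)"
    by (simp add: pairing_superset[OF finite_X cb] incidence_def sum_distrib_left sum_negf)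
  finally show ?thesis .
qed

lemma star_chain_surj:
  fixes t :: "'f::field chain"
  assumes "P \<subseteq> X" "t \<in> supp (star ` P)"
  shows "\<exists>y\<in>supp P. star_chain y = t"
proof -
  have fin: "finite P" using assms(1) finite_X finite_subset by blast
  define y where "y = (\<Sum>\<sigma>\<in>P. scale_chain (star_sign \<sigma> * coef t (star \<sigma>)) (cell_chain \<sigma>))"
  have "star_chain y = (\<Sum>\<sigma>\<in>P. scale_chain (coef t (star \<sigma>)) (cell_chain (star \<sigma>)))"
    unfolding y_def push_def lin_sum lin_scale lin_cell_chain scale_chain_simps(3)
    by (intro sum.cong) (simp_all add: mult.assoc mult.left_commute[of "star_sign _"])
  also have "\<dots> = (\<Sum>\<tau>\<in>star ` P. scale_chain (coef t \<tau>) (cell_chain \<tau>))"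
    using inj_on_subset[OF star_inj assms(1)] by (simp add: sum.reindex)
  also have "\<dots> = t" using lin_superset[of "star ` P" t cell_chain] fin assms(2) by (simp add: lin_id)
  finally have "star_chain y = t" .
  moreover have "y \<in> supp P"
    unfolding y_def by (intro chain.subspace_sum chain.subspace_scale subspace_supp) (simp add: cell_chain_in_supp)
  ultimately show ?thesis by blast
qed

text \<open>The cycles of the torus that are homologous to a cycle in \<open>P\<close>, that is, the
  preimage in \<open>Z k\<close> of the image of the induced map. Working with it avoids quotients:
  \<open>B k\<close> means a zero map, \<open>Z k\<close> a surjective one.\<close>

definition W :: "nat \<Rightarrow> cell set \<Rightarrow> 'f::field chain set" where
  "W k P = {b + c | b c. b \<in> B k \<and> c \<in> Z k \<inter> supp P}"

lemma subspace_W: "chain.subspace (W k P)"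
  unfolding W_def by (intro chain.subspace_sums subspace_B chain.subspace_inter subspace_Z subspace_supp)

lemma W_mono: "P \<subseteq> Q \<Longrightarrow> W k P \<subseteq> W k Q"
  using supp_mono[of P Q] unfolding W_def by blast

lemma B_subset_W: "B k \<subseteq> W k P"
proof
  fix b :: "'f::field chain" assume "b \<in> B k"
  moreover have "0 \<in> Z k \<inter> (supp P :: 'f chain set)"
    using chain.subspace_0[OF subspace_Z] chain.subspace_0[OF subspace_supp] by blast
  ultimately have "b + 0 \<in> W k P" unfolding W_def by blast
  then show "b \<in> W k P" by simp
qed

lemma cycles_subset_W: "Z k \<inter> supp P \<subseteq> W k P"
proof
  fix c :: "'f::field chain" assume "c \<in> Z k \<inter> supp P"
  then have "0 + c \<in> W k P" unfolding W_def using chain.subspace_0[OF subspace_B] by blast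
  then show "c \<in> W k P" by simp
qed

lemma W_subset_Z: "W k P \<subseteq> Z k"
  unfolding W_def using B_subset_Z chain.subspace_add[OF subspace_Z] by blast

lemma W_eq_B_iff: "W k P = (B k :: 'f::field chain set) \<longleftrightarrow> Z k \<inter> supp P \<subseteq> (B k :: 'f chain set)"
proof
  assume "Z k \<inter> supp P \<subseteq> (B k :: 'f chain set)"
  then have "W k P \<subseteq> (B k :: 'f chain set)"
    unfolding W_def using chain.subspace_add[OF subspace_B] by blast
  then show "W k P = (B k :: 'f chain set)" using B_subset_W by blast
qed (use cycles_subset_W in blast)

end

section \<open>Poincare duality in the middle dimension\<close>

locale middle_torus = torus_complex N d for N d :: nat +
  fixes i :: nat
  assumes d_eq: "d = 2 * i" and i_pos: "1 \<le> i"
begin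

text \<open>Since \<open>star\<close> applied twice is a translation, \<open>dual\<close> applied
  twice to a set of plaquettes gives a translate of the set. Bijectivity is therefore a separate
  fact, \<open>dual_bij\<close>.\<close>

definition dual :: "cell set \<Rightarrow> cell set" where
  "dual P = {\<sigma> \<in> cells i. star \<sigma> \<notin> P}"

lemma star_cells_i: "star ` cells i = cells i"
  using star_cells[of i] d_eq by simp

text \<open>A chain orthogonal to all boundaries is a cocycle, and \<open>star_chain\<close> makes
  it a cycle of dimension d - i = i.\<close>

lemma perp_B_star:
  fixes y :: "'f::field chain"
  assumes y: "y \<in> supp (cells i)" "\<And>b. b \<in> B i \<Longrightarrow> pairing b y = 0"
  shows "star_chain y \<in> Z i"
proof -
  have sy: "star_chain y \<in> supp (cells i)"
    using push_supp[OF y(1), of star star_sign] by (simp add: star_cells_i)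
  have bC: "boundary N (star_chain y) \<in> supp (cells (i - 1))"
    using boundary_in_C[of "star_chain y" "i - 1"] sy i_pos by simp
  have "coef (boundary N (star_chain y)) \<rho> = 0" for \<rho>
  proof (cases "\<rho> \<in> cells (i - 1)")
    case True
    have "star ` cells (Suc i) = cells (i - 1)" using star_cells[of "Suc i"] d_eq i_pos by simp
    then obtain \<tau> where \<tau>: "\<tau> \<in> cells (Suc i)" "\<rho> = star \<tau>" using True by blast
    have "cell_boundary N \<tau> \<in> (B i :: 'f chain set)"
      unfolding B_def boundary_lin using \<tau>(1)
      by (intro image_eqI[of _ _ "cell_chain \<tau>"]) (simp_all add: lin_cell_chain cell_chain_in_supp)
    then show ?thesis
      using coef_boundary_star[OF C_supp_X[OF y(1)], of \<tau>] \<tau> cells_subset y(2) by auto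
  qed (use suppD[OF bC] in blast)
  then have "boundary N (star_chain y) = 0" by (intro poly_mapping_eqI) simp
  with sy show ?thesis by (simp add: Z_def)
qed

text \<open>The intersection number: a cell meets only its dual cell.\<close>

definition star_pairing :: "'f::field chain \<Rightarrow> 'f chain \<Rightarrow> 'f" where
  "star_pairing b z = (\<Sum>\<sigma>\<in>cells i. star_sign \<sigma> * coef b (star \<sigma>) * coef z \<sigma>)"

lemma star_pairing_add: "star_pairing (b + c) z = star_pairing b z + star_pairing c z"
  by (simp add: star_pairing_def algebra_simps sum.distrib)

lemma star_pairing_star_chain:
  assumes "y \<in> supp (cells i)" "z \<in> supp (cells i)"
  shows "star_pairing (star_chain y) z = pairing z y"
proof -
  have "star_pairing (star_chain y) z = (\<Sum>\<sigma>\<in>cells i. coef z \<sigma> * coef y \<sigma>)"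
    unfolding star_pairing_def
  proof (rule sum.cong)
    fix \<sigma> assume "\<sigma> \<in> cells i"
    then have "\<sigma> \<in> X" using cells_subset by blast
    then have "star_sign \<sigma> * coef (star_chain y) (star \<sigma>) = coef y \<sigma>"
      by (simp add: coef_star_chain[OF C_supp_X[OF assms(1)]] mult.assoc[symmetric])
    then show "star_sign \<sigma> * coef (star_chain y) (star \<sigma>) * coef z \<sigma> = coef z \<sigma> * coef y \<sigma>" by simp
  qed simp
  then show ?thesis using pairing_superset[OF finite_cells assms(2)] by simp
qed

text \<open>Poincare duality: boundaries are dual to coboundaries, which annihilate cycles.\<close>

lemma star_pairing_boundary:
  fixes b z :: "'f::field chain"
  assumes b: "b \<in> B i" and z: "z \<in> Z i"
  shows "star_pairing b z = 0"
proof -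
  obtain t :: "'f chain" where t: "t \<in> supp (cells (Suc i))" "b = boundary N t" using b by (auto simp: B_def)
  have "star ` cells (i - 1) = cells (Suc i)" using star_cells[of "i - 1"] d_eq i_pos
    by (simp add: Suc_diff_le numeral_2_eq_2)
  then obtain y :: "'f chain" where y: "y \<in> supp (cells (i - 1))" "star_chain y = t"
    using star_chain_surj[of "cells (i - 1)" t] t(1) cells_subset by auto
  have zC: "z \<in> supp (cells i)" "boundary N z = 0" using z by (auto simp: Z_def)
  have cb: "pairing (cell_boundary N \<sigma>) y = (\<Sum>\<rho>\<in>cells (i - 1). incidence N \<sigma> \<rho> * coef y \<rho>)" if "\<sigma> \<in> cells i" for \<sigma>
    unfolding incidence_def using that i_pos cell_boundary_supp[of \<sigma> "i - 1"]
    by (intro pairing_superset finite_cells) auto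
  have "star_pairing b z = (\<Sum>\<sigma>\<in>cells i. - (coef z \<sigma> * pairing (cell_boundary N \<sigma>) y))"
    unfolding star_pairing_def t(2) y(2)[symmetric]
  proof (rule sum.cong)
    fix \<sigma> assume "\<sigma> \<in> cells i"
    then have "\<sigma> \<in> X" using cells_subset by blast
    then have "star_sign \<sigma> * coef (boundary N (star_chain y)) (star \<sigma>) = - pairing (cell_boundary N \<sigma>) y"
      by (simp add: coef_boundary_star[OF C_supp_X[OF y(1)]] mult.assoc[symmetric])
    then show "star_sign \<sigma> * coef (boundary N (star_chain y)) (star \<sigma>) * coef z \<sigma>
       = - (coef z \<sigma> * pairing (cell_boundary N \<sigma>) y)" by simp
  qed simp
  also have "\<dots> = - (\<Sum>\<sigma>\<in>cells i. \<Sum>\<rho>\<in>cells (i - 1). coef z \<sigma> * incidence N \<sigma> \<rho> * coef y \<rho>)"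
    by (simp add: cb sum_negf sum_distrib_left mult.assoc)
  also have "\<dots> = - (\<Sum>\<rho>\<in>cells (i - 1). coef (boundary N z) \<rho> * coef y \<rho>)"
    by (subst sum.swap) (simp add: coef_boundary[OF finite_cells zC(1)] sum_distrib_right)
  also have "\<dots> = 0" by (simp add: zC)
  finally show ?thesis .
qed

lemma Z_C: "z \<in> Z i \<Longrightarrow> z \<in> supp (cells i)" by (simp add: Z_def)
lemma B_C: "z \<in> B i \<Longrightarrow> z \<in> supp (cells i)" using B_subset_Z Z_C by blast

lemma star_off_dual: "y \<in> supp (cells i - dual P) \<Longrightarrow> star_chain y \<in> supp P"
  using push_supp[of y "cells i - dual P" star star_sign] supp_mono[of "star ` (cells i - dual P)" P]
  by (auto simp: dual_def)

text \<open>A cycle \<open>z\<close> missed by the dual is separated by some \<open>y\<close> from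
  the boundaries and from all chains on the dual. Then \<open>star_chain y\<close> is a cycle in
  \<open>P\<close>, hence a boundary, hence has intersection number 0 with \<open>z\<close>; but
  that number is \<open>pairing z y\<close>.\<close>

theorem trivial_imp_dual_surjective:
  assumes triv: "W i P = (B i :: 'f::field chain set)"
  shows "W i (dual P) = (Z i :: 'f chain set)"
proof (rule ccontr)
  let ?Q = "dual P"
  assume "W i ?Q \<noteq> (Z i :: 'f chain set)"
  then obtain z :: "'f chain" where z: "z \<in> Z i" "z \<notin> W i ?Q" using W_subset_Z by blast
  define U :: "'f chain set" where "U = {b + c | b c. b \<in> B i \<and> c \<in> supp ?Q}"
  have "chain.subspace U" unfolding U_def by (intro chain.subspace_sums subspace_B subspace_supp)
  moreover have "U \<subseteq> supp (cells i)"
  proof -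
    have "supp ?Q \<subseteq> (supp (cells i) :: 'f chain set)" by (rule supp_mono) (auto simp: dual_def)
    then show ?thesis unfolding U_def using B_C chain.subspace_add[OF subspace_supp] by blast
  qed
  moreover have "z \<notin> U"
  proof
    assume "z \<in> U"
    then obtain b c where bc: "b \<in> B i" "c \<in> supp ?Q" "z = b + c" unfolding U_def by blast
    then have "c = z - b" by simp
    also have "\<dots> \<in> Z i" using z(1) bc(1) B_subset_Z by (intro chain.subspace_diff[OF subspace_Z]) auto
    finally show False using z(2) bc unfolding W_def by blast
  qed
  ultimately obtain y where y: "y \<in> supp (cells i)" "\<And>u. u \<in> U \<Longrightarrow> pairing u y = 0" "pairing z y \<noteq> 0"
    using separation[OF _ _ Z_C[OF z(1)] _ finite_cells, of U] by blast
  have BU: "b \<in> U" if "b \<in> B i" for b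
  proof -
    have "b + 0 \<in> U" unfolding U_def using that chain.subspace_0[OF subspace_supp] by blast
    then show ?thesis by simp
  qed
  have QU: "c \<in> U" if "c \<in> supp ?Q" for c
  proof -
    have "0 + c \<in> U" unfolding U_def using that chain.subspace_0[OF subspace_B] by blast
    then show ?thesis by simp
  qed
  have "coef y \<sigma> = 0" if "\<sigma> \<in> ?Q" for \<sigma>
  proof -
    have "pairing (cell_chain \<sigma>) y = 0" using that by (intro y(2) QU) (simp add: cell_chain_in_supp)
    moreover have "pairing (cell_chain \<sigma>) y = coef y \<sigma>" by (simp add: pairing_def cell_chain_def)
    ultimately show ?thesis by simp
  qed
  then have "y \<in> supp (cells i - ?Q)" using suppD[OF y(1)] by (auto simp only: supp_iff)
  then have "star_chain y \<in> supp P" by (rule star_off_dual)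
  moreover have "star_chain y \<in> Z i" by (rule perp_B_star[OF y(1) y(2)[OF BU]])
  ultimately have "star_chain y \<in> B i" using triv cycles_subset_W[of i P] by blast
  then have "star_pairing (star_chain y) z = 0" using z(1) by (rule star_pairing_boundary)
  then show False using star_pairing_star_chain[OF y(1) Z_C[OF z(1)]] y(3) by simp
qed

text \<open>A cycle on the dual that does not bound is detected by a cocycle. The cycle
  corresponding to the cocycle is homologous to one in \<open>P\<close>, and chains in
  \<open>P\<close> do not meet chains on the dual.\<close>

theorem surjective_imp_dual_trivial:
  assumes surj: "W i P = (Z i :: 'f::field chain set)"
  shows "W i (dual P) = (B i :: 'f chain set)"
  unfolding W_eq_B_iff
proof
  fix z :: "'f chain" assume z: "z \<in> Z i \<inter> supp (dual P)"
  show "z \<in> B i"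
  proof (rule ccontr)
    assume "z \<notin> B i"
    then obtain y where y: "y \<in> supp (cells i)" "\<And>b. b \<in> B i \<Longrightarrow> pairing b y = 0" "pairing z y \<noteq> 0"
      using separation[OF subspace_B _ _ _ finite_cells, of i i z] B_C Z_C z by blast
    have "star_chain y \<in> W i P" unfolding surj by (rule perp_B_star[OF y(1,2)])
    then obtain b c where bc: "star_chain y = b + c" "b \<in> B i" "c \<in> supp P" unfolding W_def by blast
    have "star_pairing c z = 0"
      unfolding star_pairing_def
    proof (intro sum.neutral ballI)
      fix \<sigma> assume "\<sigma> \<in> cells i"
      show "star_sign \<sigma> * coef c (star \<sigma>) * coef z \<sigma> = 0"
      proof (cases "\<sigma> \<in> dual P")
        case True
        then have "coef c (star \<sigma>) = 0" using bc(3) by (intro suppD) (auto simp: dual_def)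
        then show ?thesis by simp
      next
        case False
        then have "coef z \<sigma> = 0" using z suppD by blast
        then show ?thesis by simp
      qed
    qed
    moreover have "star_pairing b z = 0" using bc(2) z by (intro star_pairing_boundary) auto
    ultimately have "star_pairing (star_chain y) z = 0" by (simp add: bc(1) star_pairing_add)
    moreover have "z \<in> supp (cells i)" using z Z_C by blast
    ultimately show False using star_pairing_star_chain[OF y(1)] y(3) by simp
  qed
qed

end

section \<open>The rank of a set of plaquettes\<close>

context middle_torus begin

definition rank :: "'f::field itself \<Rightarrow> cell set \<Rightarrow> nat" where
  "rank F P = chain.dim (cell_boundary N ` (P \<inter> cells i) :: 'f chain set)"

text \<open>Adding \<open>e\<close> to \<open>P\<close> closes a cycle; under
  \<open>bounding\<close>, one that bounds in the torus. A new plaquette with the first property but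
  not the second is one that enlarges the image in homology.\<close>

definition cyclic :: "'f::field itself \<Rightarrow> cell set \<Rightarrow> cell \<Rightarrow> bool" where
  "cyclic F P e \<longleftrightarrow> (\<exists>z\<in>Z i \<inter> supp (insert e P) :: 'f chain set. coef z e \<noteq> 0)"

definition bounding :: "'f::field itself \<Rightarrow> cell set \<Rightarrow> cell \<Rightarrow> bool" where
  "bounding F P e \<longleftrightarrow> (\<exists>b\<in>B i \<inter> supp (insert e P) :: 'f chain set. coef b e \<noteq> 0)"

lemma rank_Int: "rank F (P \<inter> cells i) = rank F P"
  by (simp add: rank_def Int_assoc)

lemma rank_insert:
  "rank TYPE('f::field) (insert e P) =
    (if e \<in> cells i \<and> cell_boundary N e \<notin> chain.span (cell_boundary N ` (P \<inter> cells i) :: 'f chain set)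
     then Suc (rank TYPE('f) P) else rank TYPE('f) P)"
proof (cases "e \<in> cells i")
  case True
  then have "insert e P \<inter> cells i = insert e (P \<inter> cells i)" by auto
  then show ?thesis using True finite_cells by (simp add: rank_def chain.dim_insert_finite)
next
  case False
  then have "insert e P \<inter> cells i = P \<inter> cells i" by auto
  then show ?thesis using False by (simp add: rank_def)
qed

lemma rank_model: "1 \<le> q \<Longrightarrow> rank_model (cells i) (rank TYPE('f::field)) q"
proof
  fix A A' e
  show "rank TYPE('f) (insert e A) = rank TYPE('f) A \<or> rank TYPE('f) (insert e A) = Suc (rank TYPE('f) A)"
    by (simp add: rank_insert)
  assume A: "A \<subseteq> A'" "rank TYPE('f) (insert e A) = rank TYPE('f) A"
  have "chain.span (cell_boundary N ` (A \<inter> cells i)) \<subseteq> chain.span (cell_boundary N ` (A' \<inter> cells i) :: 'f chain set)"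
    using A(1) by (intro chain.span_mono) auto
  then show "rank TYPE('f) (insert e A') = rank TYPE('f) A'"
    using A(2) by (auto simp: rank_insert split: if_splits)
qed (use finite_cells rank_Int in auto)

lemma span_boundary:
  assumes "finite P"
  shows "chain.span (cell_boundary N ` P) = (boundary N ` supp P :: 'f::field chain set)"
proof
  have sub: "chain.subspace (boundary N ` supp P :: 'f chain set)"
    unfolding chain.subspace_def
  proof (intro conjI ballI allI)
    show "0 \<in> boundary N ` (supp P :: 'f chain set)"
      using chain.subspace_0[OF subspace_supp] by (metis boundary_0 imageI)
  next
    fix x y :: "'f chain" assume "x \<in> boundary N ` supp P" "y \<in> boundary N ` supp P"
    then obtain c c' where "x = boundary N c" "y = boundary N c'" "c \<in> supp P" "c' \<in> supp P" by blast
    then show "x + y \<in> boundary N ` supp P"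
      by (intro image_eqI[of _ _ "c + c'"] chain.subspace_add[OF subspace_supp]) (simp_all add: boundary_add)
  next
    fix a and x :: "'f chain" assume "x \<in> boundary N ` supp P"
    then obtain c where "x = boundary N c" "c \<in> supp P" by blast
    then show "scale_chain a x \<in> boundary N ` supp P"
      by (intro image_eqI[of _ _ "scale_chain a c"] chain.subspace_scale[OF subspace_supp]) (simp_all add: boundary_scale)
  qed
  have "cell_boundary N \<sigma> \<in> boundary N ` (supp P :: 'f chain set)" if "\<sigma> \<in> P" for \<sigma>
    using that by (intro image_eqI[of _ _ "cell_chain \<sigma>"]) (simp_all add: boundary_lin lin_cell_chain cell_chain_in_supp)
  then show "chain.span (cell_boundary N ` P) \<subseteq> (boundary N ` supp P :: 'f chain set)"
    by (intro chain.span_minimal sub) auto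
  show "(boundary N ` supp P :: 'f chain set) \<subseteq> chain.span (cell_boundary N ` P)"
  proof
    fix x :: "'f chain" assume "x \<in> boundary N ` supp P"
    then obtain c where c: "c \<in> supp P" "x = lin (cell_boundary N) c" by (auto simp: boundary_lin)
    show "x \<in> chain.span (cell_boundary N ` P)"
      unfolding c(2) by (intro lin_in_subspace chain.subspace_span chain.span_base imageI supp_keysD[OF c(1)])
  qed
qed

lemma span_iff_cyclic:
  assumes P: "P \<subseteq> cells i" and e: "e \<in> cells i" "e \<notin> P"
  shows "cell_boundary N e \<in> chain.span (cell_boundary N ` P :: 'f::field chain set) \<longleftrightarrow> cyclic TYPE('f) P e"
proof -
  have fin: "finite P" using P finite_cells finite_subset by blast
  have PE: "supp (insert e P) \<subseteq> (supp (cells i) :: 'f chain set)" using P e by (intro supp_mono) auto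
  have Pe: "supp P \<subseteq> (supp (insert e P) :: 'f chain set)" by (intro supp_mono) auto
  have be: "boundary N (cell_chain e) = (cell_boundary N e :: 'f chain)" by (simp add: boundary_lin lin_cell_chain)
  show ?thesis
  proof
    assume "cell_boundary N e \<in> chain.span (cell_boundary N ` P :: 'f chain set)"
    then obtain c :: "'f chain" where c: "c \<in> supp P" "cell_boundary N e = boundary N c"
      using span_boundary[OF fin] by blast
    let ?z = "cell_chain e - c"
    have "?z \<in> supp (insert e P)"
      using c(1) Pe by (intro chain.subspace_diff subspace_supp) (auto simp: cell_chain_in_supp)
    moreover have "boundary N ?z = 0" using c(2) be by (simp add: boundary_diff)
    moreover have "coef ?z e \<noteq> 0" using suppD[OF c(1) e(2)] by (simp add: coef_cell_chain)
    ultimately show "cyclic TYPE('f) P e" using PE unfolding cyclic_def Z_def by blast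
  next
    assume "cyclic TYPE('f) P e"
    then obtain z :: "'f chain" where z: "boundary N z = 0" "z \<in> supp (insert e P)" "coef z e \<noteq> 0"
      unfolding cyclic_def Z_def by blast
    define c where "c = cell_chain e - scale_chain (1 / coef z e) z"
    have "coef c \<sigma> = 0" if "\<sigma> \<notin> P" for \<sigma>
      using that suppD[OF z(2), of \<sigma>] z(3) by (cases "\<sigma> = e") (auto simp: c_def coef_cell_chain)
    then have "c \<in> supp P" unfolding supp_iff by blast
    moreover have "boundary N c = cell_boundary N e"
      using z(1) be by (simp add: c_def boundary_diff boundary_scale scale_chain_simps)
    ultimately show "cell_boundary N e \<in> chain.span (cell_boundary N ` P :: 'f chain set)"
      unfolding span_boundary[OF fin] by (metis imageI)
  qed
qed

lemma rank_insert_cyclic: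
  assumes "P \<subseteq> cells i" "e \<in> cells i" "e \<notin> P"
  shows "rank TYPE('f::field) (insert e P) = rank TYPE('f) P + (if cyclic TYPE('f) P e then 0 else 1)"
  using span_iff_cyclic[OF assms, where ?'f = 'f] assms by (simp add: rank_insert Int_absorb2)

lemma bounding_imp_cyclic: "bounding F P e \<Longrightarrow> cyclic F P e"
  unfolding bounding_def cyclic_def using B_subset_Z by blast

lemma dual_subset: "dual P \<subseteq> cells i"
  by (auto simp: dual_def)

lemma dual_insert: "f \<in> cells i \<Longrightarrow> dual (insert (star f) P) = dual P - {f}"
  unfolding dual_def using star_inj cells_subset by (auto dest: inj_onD)

text \<open>A boundary through \<open>e\<close> in \<open>insert e P\<close> and a cycle through
  \<open>f\<close> on the dual would meet exactly once, which \<open>star_pairing_boundary\<close>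
  forbids. If there is no such cycle, separation writes \<open>cell_chain f\<close> as a coboundary
  plus a chain off the dual; applying \<open>star_chain\<close> gives a boundary through
  \<open>e\<close> in \<open>insert e P\<close>.\<close>

lemma cyclic_dual:
  assumes P: "P \<subseteq> cells i" and f: "f \<in> cells i" and e: "e = star f" "e \<notin> P"
  shows "cyclic TYPE('f::field) (dual P - {f}) f \<longleftrightarrow> \<not> bounding TYPE('f) P e"
proof
  have fd: "f \<in> dual P" using f e by (simp add: dual_def)
  then have ins: "insert f (dual P - {f}) = dual P" by auto
  have eC: "e \<in> cells i" using f e star_cells_i by blast
  {
    assume "cyclic TYPE('f) (dual P - {f}) f"
    then obtain z :: "'f chain" where z: "z \<in> Z i" "z \<in> supp (dual P)" "coef z f \<noteq> 0"
      unfolding cyclic_def ins by blast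
    show "\<not> bounding TYPE('f) P e"
    proof
      assume "bounding TYPE('f) P e"
      then obtain b :: "'f chain" where b: "b \<in> B i" "b \<in> supp (insert e P)" "coef b e \<noteq> 0"
        unfolding bounding_def by blast
      have "star_pairing b z = (\<Sum>\<sigma>\<in>cells i. if \<sigma> = f then star_sign f * coef b e * coef z f else 0)"
        unfolding star_pairing_def
      proof (rule sum.cong)
        fix \<sigma> assume \<sigma>: "\<sigma> \<in> cells i"
        have "coef b (star \<sigma>) * coef z \<sigma> = 0" if "\<sigma> \<noteq> f"
        proof (cases "\<sigma> \<in> dual P")
          case True
          have "star \<sigma> \<noteq> e" using that \<sigma> f star_inj cells_subset unfolding e(1) by (meson inj_onD subsetD)
          with True have "coef b (star \<sigma>) = 0" using b(2) by (intro suppD[OF b(2)]) (simp add: dual_def)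
          then show ?thesis by simp
        next
          case False
          then show ?thesis using suppD[OF z(2) False] by simp
        qed
        then show "star_sign \<sigma> * coef b (star \<sigma>) * coef z \<sigma> = (if \<sigma> = f then star_sign f * coef b e * coef z f else 0)"
          using e(1) by (simp add: mult.assoc)
      qed simp
      also have "\<dots> = star_sign f * coef b e * coef z f" using f finite_cells by simp
      finally have "star_pairing b z \<noteq> 0" using b(3) z(3) by simp
      then show False using star_pairing_boundary[OF b(1) z(1)] by simp
    qed
  }
  assume nb: "\<not> bounding TYPE('f) P e"
  show "cyclic TYPE('f) (dual P - {f}) f"
  proof (rule ccontr)
    assume nc: "\<not> cyclic TYPE('f) (dual P - {f}) f"
    \<comment> \<open>The coboundaries, described through their images under
      \<open>star_chain\<close>.\<close>
    define B' :: "'f chain set" where "B' = {y \<in> supp (cells i). star_chain y \<in> B i}"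
    define U where "U = {b + c | b c. b \<in> B' \<and> c \<in> supp (cells i - dual P)}"
    have B': "chain.subspace B'"
      unfolding B'_def chain.subspace_def using chain.subspace_0[OF subspace_B]
      by (auto simp: push_def lin_add lin_scale chain.subspace_0[OF subspace_supp]
          intro: chain.subspace_add[OF subspace_supp] chain.subspace_add[OF subspace_B]
          chain.subspace_scale[OF subspace_supp] chain.subspace_scale[OF subspace_B])
    have subE: "supp (cells i - dual P) \<subseteq> (supp (cells i) :: 'f chain set)" by (rule supp_mono) auto
    have U: "chain.subspace U" "U \<subseteq> supp (cells i)"
      unfolding U_def using subE chain.subspace_add[OF subspace_supp]
      by (auto intro!: chain.subspace_sums B' subspace_supp) (auto simp: B'_def)
    have "cell_chain f \<in> U"
    proof (rule ccontr)
      assume "cell_chain f \<notin> U"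
      moreover have "cell_chain f \<in> (supp (cells i) :: 'f chain set)" using f by (simp add: cell_chain_in_supp)
      ultimately obtain y where y: "y \<in> supp (cells i)" "\<And>u. u \<in> U \<Longrightarrow> pairing u y = 0" "pairing (cell_chain f) y \<noteq> 0"
        using separation[OF U _ _ finite_cells, of "cell_chain f"] by blast
      have pc: "pairing (cell_chain \<sigma>) y = coef y \<sigma>" for \<sigma> by (simp add: pairing_def cell_chain_def)
      have "coef y \<sigma> = 0" if "\<sigma> \<in> cells i - dual P" for \<sigma>
      proof -
        have "0 + cell_chain \<sigma> \<in> U"
          unfolding U_def using that chain.subspace_0[OF B'] cell_chain_in_supp by blast
        then show ?thesis using y(2)[of "0 + cell_chain \<sigma>"] pc[of \<sigma>] by simp
      qed
      then have ydual: "y \<in> supp (dual P)" using suppD[OF y(1)] by (auto simp only: supp_iff)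
      \<comment> \<open>The coefficient of the boundary at \<open>\<rho>\<close> is, up to sign, the
        pairing of \<open>y\<close> with the coboundary of \<open>\<rho>\<close>, represented below
        by \<open>b'\<close>, and \<open>y\<close> annihilates coboundaries.\<close>
      have "boundary N y = 0"
      proof (rule poly_mapping_eqI)
        fix \<rho>
        show "coef (boundary N y) \<rho> = coef 0 \<rho>"
        proof (cases "\<rho> \<in> cells (i - 1)")
          case False
          then show ?thesis using suppD[OF boundary_in_C[of y "i - 1"]] y(1) i_pos by simp
        next
          case True
          let ?c = "cell_chain \<rho> :: 'f chain"
          have cC: "?c \<in> supp (cells (i - 1))" using True by (simp add: cell_chain_in_supp)
          have "star ` cells (i - 1) = cells (Suc i)" using star_cells[of "i - 1"] d_eq i_pos
            by (simp add: Suc_diff_le numeral_2_eq_2)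
          then have "star_chain ?c \<in> supp (cells (Suc i))" using push_supp[OF cC, of star star_sign] by simp
          then have bB: "boundary N (star_chain ?c) \<in> B i" by (simp add: B_def)
          obtain b' where b': "b' \<in> supp (cells i)" "star_chain b' = boundary N (star_chain ?c)"
            using star_chain_surj[OF cells_subset, of "boundary N (star_chain ?c)" i] B_C[OF bB] star_cells_i by auto
          have "b' + 0 \<in> U"
          proof -
            have "b' \<in> B'" unfolding B'_def using b' bB by simp
            then show ?thesis unfolding U_def using chain.subspace_0[OF subspace_supp] by blast
          qed
          then have "pairing b' y = 0" using y(2) by simp
          moreover have "coef b' \<sigma> = - incidence N \<sigma> \<rho>" if "\<sigma> \<in> cells i" for \<sigma>
          proof -
            have X: "\<sigma> \<in> X" using that cells_subset by blast
            have "pairing (cell_boundary N \<sigma>) ?c = incidence N \<sigma> \<rho>"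
            proof -
              have "pairing (cell_boundary N \<sigma>) ?c = (\<Sum>\<tau>\<in>cells (i - 1). coef (cell_boundary N \<sigma>) \<tau> * coef ?c \<tau>)"
                using that i_pos cell_boundary_supp[of \<sigma> "i - 1"] by (intro pairing_superset finite_cells) auto
              also have "\<dots> = (\<Sum>\<tau>\<in>cells (i - 1). if \<tau> = \<rho> then incidence N \<sigma> \<rho> else 0)"
                by (intro sum.cong) (auto simp: coef_cell_chain incidence_def)
              finally show ?thesis using True finite_cells by simp
            qed
            then have "star_sign \<sigma> * coef b' \<sigma> = star_sign \<sigma> * (- incidence N \<sigma> \<rho>)"
              using coef_boundary_star[OF C_supp_X[OF cC] X] coef_star_chain[OF C_supp_X[OF b'(1)] X] b'(2) by simp
            then show ?thesis using mult_left_cancel[OF star_sign_nz] by blast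
          qed
          ultimately have "(\<Sum>\<sigma>\<in>cells i. incidence N \<sigma> \<rho> * coef y \<sigma>) = 0"
            using pairing_superset[OF finite_cells b'(1), of y] by (simp add: sum_negf)
          then show ?thesis using coef_boundary[OF finite_cells y(1)] by (simp add: mult.commute)
        qed
      qed
      then have "y \<in> Z i" using y(1) by (simp add: Z_def)
      then show False using nc ydual y(3) pc unfolding cyclic_def ins by auto
    qed
    then obtain b' c where bc: "cell_chain f = b' + c" "b' \<in> B'" "c \<in> supp (cells i - dual P)"
      unfolding U_def by blast
    define b where "b = star_chain b'"
    have "star_chain (cell_chain f) = b + star_chain c"
      unfolding b_def bc(1) by (simp add: push_def lin_add)
    then have b: "b = scale_chain (star_sign f) (cell_chain e) - star_chain c"
      by (simp add: push_def lin_cell_chain e(1))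
    have cP: "star_chain c \<in> supp P" by (rule star_off_dual[OF bc(3)])
    have "coef b e \<noteq> 0" using suppD[OF cP e(2)] by (simp add: b coef_cell_chain)
    moreover have "b \<in> supp (insert e P)"
      unfolding b using cP supp_mono[of P "insert e P"]
      by (intro chain.subspace_diff chain.subspace_scale subspace_supp) (auto simp: cell_chain_in_supp)
    moreover have "b \<in> B i" using bc(2) by (simp add: B'_def b_def)
    ultimately show False using nb unfolding bounding_def by blast
  qed
qed

lemma W_in_span: "W i P \<subseteq> (chain.span (cell_chain ` cells i) :: 'f::field chain set)"
  unfolding supp_eq_span[OF finite_cells, symmetric] using W_subset_Z Z_C by blast

lemma dim_W_strict:
  "W i P \<subset> (W i Q :: 'f::field chain set) \<Longrightarrow> chain.dim (W i P :: 'f chain set) < chain.dim (W i Q :: 'f chain set)"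
  using finite_cells by (intro chain.dim_psubset_finite[OF subspace_W _ W_in_span]) auto

text \<open>Modulo boundaries the coordinate subtori span all cycles, and there are at most
  \<open>2 ^ d\<close> sets of directions. This is the source of bounds free of
  \<open>N\<close>.\<close>

lemma dim_W_le: "chain.dim (W i P :: 'f::field chain set) \<le> chain.dim (B i :: 'f chain set) + 2 ^ d"
proof -
  have fin: "finite (axes i)" by (simp add: axes_def)
  have "W i P \<subseteq> chain.span (B i \<union> subtorus ` axes i :: 'f chain set)"
  proof
    fix z :: "'f chain" assume "z \<in> W i P"
    then have "z \<in> Z i" using W_subset_Z by blast
    then obtain a where a: "z - (\<Sum>I\<in>axes i. scale_chain (a I) (subtorus I)) \<in> B i"
      using torus_homology_generators by blast
    have "(z - (\<Sum>I\<in>axes i. scale_chain (a I) (subtorus I))) + (\<Sum>I\<in>axes i. scale_chain (a I) (subtorus I))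
        \<in> chain.span (B i \<union> subtorus ` axes i)"
      using a by (intro chain.span_add chain.span_sum chain.span_scale chain.span_base) auto
    then show "z \<in> chain.span (B i \<union> subtorus ` axes i)" by simp
  qed
  then have "chain.dim (W i P :: 'f chain set) \<le> chain.dim (B i :: 'f chain set) + card (subtorus ` axes i :: 'f chain set)"
    using finite_cells B_subset_W[of i "{}"] W_in_span[of "{}"] fin
    by (intro chain.dim_le_add_card[of _ "cell_chain ` cells i"]) auto
  also have "card (subtorus ` axes i :: 'f chain set) \<le> card (axes i)" using fin by (rule card_image_le)
  also have "card (axes i) \<le> card (Pow {..<d})" by (intro card_mono) (auto simp: axes_def)
  also have "\<dots> = 2 ^ d" by (simp add: card_Pow)
  finally show ?thesis by simp
qed

lemma W_empty: "W i {} = (B i :: 'f::field chain set)"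
  unfolding W_eq_B_iff by (auto simp: supp_def chain.subspace_0[OF subspace_B])

text \<open>The defect in the rank formula that links a configuration with its dual. It would not
  vary with \<open>P\<close> if every cycle bounded.\<close>

definition excess :: "'f::field itself \<Rightarrow> cell set \<Rightarrow> int" where
  "excess F P = int (rank F (dual P)) + int (card P) - int (rank F P)"

text \<open>The cardinality grows by one, the rank of \<open>P\<close> grows unless \<open>e\<close>
  is cyclic, and by \<open>cyclic_dual\<close> the rank of the dual drops exactly when
  \<open>e\<close> is bounding. These changes cancel unless \<open>e\<close> is cyclic without being
  bounding.\<close>

lemma excess_insert:
  assumes P: "P \<subseteq> cells i" and e: "e \<in> cells i" "e \<notin> P"
  shows "excess TYPE('f::field) (insert e P) = excess TYPE('f) P +
     (if cyclic TYPE('f) P e \<and> \<not> bounding TYPE('f) P e then 1 else 0)"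
proof -
  obtain f where f: "f \<in> cells i" "e = star f" using e(1) star_cells_i by blast
  then have fd: "f \<in> dual P" using e by (simp add: dual_def)
  have fin: "finite P" using P finite_cells finite_subset by blast
  have d: "dual (insert e P) = dual P - {f}" using dual_insert[OF f(1)] f(2) by simp
  have "rank TYPE('f) (insert f (dual P - {f})) = rank TYPE('f) (dual P - {f}) + (if cyclic TYPE('f) (dual P - {f}) f then 0 else 1)"
    using dual_subset[of P] f by (intro rank_insert_cyclic) auto
  moreover have "insert f (dual P - {f}) = dual P" using fd by auto
  ultimately have "rank TYPE('f) (dual P) = rank TYPE('f) (dual (insert e P)) + (if bounding TYPE('f) P e then 1 else 0)"
    using cyclic_dual[OF P f e(2), where ?'f = 'f] d by simp
  then show ?thesis
    using rank_insert_cyclic[OF P e, where ?'f = 'f] bounding_imp_cyclic[of "TYPE('f)" P e] fin e(2)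
    by (simp add: excess_def)
qed

text \<open>The excess grows exactly when a new plaquette creates a homology class of the torus.\<close>

lemma W_grows:
  assumes e: "e \<notin> P" and c: "cyclic TYPE('f::field) P e" and b: "\<not> bounding TYPE('f) P e"
  shows "W i P \<subset> (W i (insert e P) :: 'f chain set)"
proof -
  obtain z :: "'f chain" where z: "z \<in> Z i" "z \<in> supp (insert e P)" "coef z e \<noteq> 0"
    using c unfolding cyclic_def by blast
  have "z \<in> W i (insert e P)" using cycles_subset_W[of i "insert e P"] z by blast
  moreover have "z \<notin> W i P"
  proof
    assume "z \<in> W i P"
    then obtain y x where yx: "z = y + x" "y \<in> B i" "x \<in> supp P" unfolding W_def by blast
    have "y = z - x" using yx by simp
    also have "\<dots> \<in> supp (insert e P)"
      using z(2) yx(3) supp_mono[of P "insert e P"] by (intro chain.subspace_diff subspace_supp) auto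
    finally have "y \<in> supp (insert e P)" .
    moreover have "coef y e \<noteq> 0" using z(3) yx suppD[OF yx(3) e] by simp
    ultimately show False using b yx(2) unfolding bounding_def by blast
  qed
  ultimately show ?thesis using W_mono[of P "insert e P" i] by blast
qed

text \<open>Every unit of excess gained is paid for by a strict growth of \<open>W\<close>, whose
  dimension exceeds that of \<open>B i\<close> by at most \<open>2 ^ d\<close>.\<close>

theorem excess_bounds:
  assumes "P \<subseteq> cells i"
  shows "excess TYPE('f::field) {} \<le> excess TYPE('f) P" "excess TYPE('f) P \<le> excess TYPE('f) {} + 2 ^ d"
proof -
  have "finite P" using assms finite_cells finite_subset by blast
  then have "excess TYPE('f) {} \<le> excess TYPE('f) P \<and>
    excess TYPE('f) P + int (chain.dim (B i :: 'f chain set)) \<le> excess TYPE('f) {} + int (chain.dim (W i P :: 'f chain set))"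
    using assms
  proof (induction P rule: finite_induct)
    case (insert e P)
    then have P: "P \<subseteq> cells i" "e \<in> cells i" by auto
    have "chain.dim (W i P :: 'f chain set) < chain.dim (W i (insert e P) :: 'f chain set)"
      if "cyclic TYPE('f) P e" "\<not> bounding TYPE('f) P e"
      using W_grows[OF insert(2) that] by (rule dim_W_strict)
    moreover have "chain.dim (W i P :: 'f chain set) \<le> chain.dim (W i (insert e P) :: 'f chain set)"
    proof (cases "W i P = (W i (insert e P) :: 'f chain set)")
      case False
      then have "W i P \<subset> (W i (insert e P) :: 'f chain set)" using W_mono[of P "insert e P" i] by blast
      from less_imp_le[OF dim_W_strict[OF this]] show ?thesis .
    qed simp
    ultimately show ?case
      using insert.IH[OF P(1)] excess_insert[OF P insert(2), where ?'f = 'f] by (auto split: if_splits)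
  qed (simp add: W_empty)
  moreover have "int (chain.dim (W i P :: 'f chain set)) \<le> int (chain.dim (B i :: 'f chain set)) + 2 ^ d"
    using dim_W_le[of P, where ?'f = 'f] by (metis (mono_tags, lifting) of_nat_add of_nat_le_iff of_nat_numeral of_nat_power)
  ultimately show "excess TYPE('f) {} \<le> excess TYPE('f) P" "excess TYPE('f) P \<le> excess TYPE('f) {} + 2 ^ d"
    by linarith+
qed

end

section \<open>Irreducibility of the homology\<close>

abbreviation adj :: "nat \<Rightarrow> nat \<Rightarrow> nat" where "adj j \<equiv> Transposition.transpose j (Suc j)"

context torus_complex begin

text \<open>A common frame for translations, reflections and swaps: \<open>\<pi>\<close> moves the
  directions, the sign depends on the directions only, and \<open>flip\<close> marks the directions
  in which front and back faces trade places. What is left is one sign identity per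
  direction.\<close>

lemma incidence_compatI:
  fixes s :: "cell \<Rightarrow> 'f::field"
  assumes g: "inj_on g X" and X: "\<sigma> \<in> X" "\<rho> \<in> X"
    and dirs: "snd (g \<sigma>) = \<pi> ` snd \<sigma>" "inj_on \<pi> (snd \<sigma>)"
    and s: "\<And>\<tau>. s \<tau> = s' (snd \<tau>)"
    and sign: "\<And>k. k \<in> snd \<sigma> \<Longrightarrow> s' (snd \<sigma>) * face_sign (\<pi> ` snd \<sigma>) (\<pi> k) * (if flip k then - 1 else 1)
        = s' (snd \<sigma> - {k}) * face_sign (snd \<sigma>) k"
    and faces: "\<And>k. k \<in> snd \<sigma> \<Longrightarrow> \<not> flip k \<Longrightarrow> front_face N (\<pi> k) (g \<sigma>) = g (front_face N k \<sigma>) \<and>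
        back_face (\<pi> k) (g \<sigma>) = g (back_face k \<sigma>)"
      "\<And>k. k \<in> snd \<sigma> \<Longrightarrow> flip k \<Longrightarrow> front_face N (\<pi> k) (g \<sigma>) = g (back_face k \<sigma>) \<and>
        back_face (\<pi> k) (g \<sigma>) = g (front_face N k \<sigma>)"
  shows "s \<sigma> * incidence N (g \<sigma>) (g \<rho>) = s \<rho> * incidence N \<sigma> \<rho>"
proof -
  have g_eq: "g \<tau> = g \<rho> \<longleftrightarrow> \<tau> = \<rho>" if "\<tau> \<in> X" for \<tau>
    using g that X by (auto dest: inj_onD)
  have "s \<sigma> * incidence N (g \<sigma>) (g \<rho>) = (\<Sum>k\<in>snd \<sigma>. s' (snd \<sigma>) * (face_sign (\<pi> ` snd \<sigma>) (\<pi> k) *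
     (of_bool (front_face N (\<pi> k) (g \<sigma>) = g \<rho>) - of_bool (back_face (\<pi> k) (g \<sigma>) = g \<rho>))))"
    unfolding incidence_eq dirs(1) s sum.reindex[OF dirs(2)] by (simp add: sum_distrib_left)
  also have "\<dots> = (\<Sum>k\<in>snd \<sigma>. s \<rho> * (face_sign (snd \<sigma>) k *
     (of_bool (front_face N k \<sigma> = \<rho>) - of_bool (back_face k \<sigma> = \<rho>))))"
  proof (rule sum.cong)
    fix k assume k: "k \<in> snd \<sigma>"
    have eq: "of_bool (front_face N (\<pi> k) (g \<sigma>) = g \<rho>) - of_bool (back_face (\<pi> k) (g \<sigma>) = g \<rho>)
      = (if flip k then - 1 else 1) * (of_bool (front_face N k \<sigma> = \<rho>) - of_bool (back_face k \<sigma> = \<rho>) :: 'f)"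
      using faces[OF k] faces_in_X[OF X(1) k] by (cases "flip k") (simp_all add: g_eq)
    show "s' (snd \<sigma>) * (face_sign (\<pi> ` snd \<sigma>) (\<pi> k) *
       (of_bool (front_face N (\<pi> k) (g \<sigma>) = g \<rho>) - of_bool (back_face (\<pi> k) (g \<sigma>) = g \<rho>)))
      = s \<rho> * (face_sign (snd \<sigma>) k * (of_bool (front_face N k \<sigma> = \<rho>) - of_bool (back_face k \<sigma> = \<rho>)))"
    proof (cases "front_face N k \<sigma> = \<rho> \<or> back_face k \<sigma> = \<rho>")
      case True
      then have "snd \<rho> = snd \<sigma> - {k}" by (auto simp: front_face_def back_face_def split: prod.splits)
      then have "s \<rho> = s' (snd \<sigma> - {k})" by (simp add: s)
      then show ?thesis unfolding eq using sign[OF k] by (simp add: mult.assoc[symmetric])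
    qed (simp add: eq)
  qed simp
  also have "\<dots> = s \<rho> * incidence N \<sigma> \<rho>" by (simp add: incidence_eq sum_distrib_left)
  finally show ?thesis .
qed

section \<open>Translations, reflections and swaps of coordinates\<close>

definition translate :: "(nat \<Rightarrow> nat) \<Rightarrow> cell \<Rightarrow> cell" where
  "translate t = (\<lambda>(v, D). (\<lambda>j\<in>{..<d}. (v j + t j) mod N, D))"

text \<open>Negation of coordinate \<open>j\<close>. A point goes to its negative modulo
  \<open>N\<close>, but the interval from \<open>v j\<close> to \<open>v j + 1\<close> has its new
  lower end at \<open>- v j - 1\<close>.\<close>

definition reflect :: "nat \<Rightarrow> cell \<Rightarrow> cell" where
  "reflect j = (\<lambda>(v, D). (v(j := if j \<in> D then N - 1 - v j else (N - v j) mod N), D))"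

definition reflect_sign :: "nat \<Rightarrow> cell \<Rightarrow> 'f::field" where
  "reflect_sign j \<sigma> = (if j \<in> snd \<sigma> then - 1 else 1)"

definition swap :: "nat \<Rightarrow> cell \<Rightarrow> cell" where
  "swap j = (\<lambda>(v, D). (v \<circ> adj j, adj j ` D))"

text \<open>Exchanging neighbouring coordinates reverses the product orientation exactly for cells
  that extend in both.\<close>

definition swap_sign :: "nat \<Rightarrow> cell \<Rightarrow> 'f::field" where
  "swap_sign j \<sigma> = (if j \<in> snd \<sigma> \<and> Suc j \<in> snd \<sigma> then - 1 else 1)"

lemma translate_in_X: "\<sigma> \<in> X \<Longrightarrow> translate t \<sigma> \<in> X"
  using N_pos by (cases \<sigma>) (auto simp: translate_def torus_def)

lemma translate_translate:
  assumes "\<sigma> \<in> X"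
  shows "translate (\<lambda>j. N - t j mod N) (translate t \<sigma>) = \<sigma>"
proof -
  obtain v D where vD: "\<sigma> = (v, D)" by (cases \<sigma>)
  have "((v j + t j) mod N + (N - t j mod N)) mod N = v j" if "j < d" for j
  proof -
    have "v j < N" using assms that by (auto simp: vD in_X_iff)
    have "((v j + t j) mod N + (N - t j mod N)) mod N = (v j + t j mod N + (N - t j mod N)) mod N"
      by (simp add: mod_add_left_eq mod_add_right_eq) (metis mod_add_left_eq mod_add_right_eq)
    also have "v j + t j mod N + (N - t j mod N) = v j + N"
      using mod_less_divisor[OF N_pos, of "t j"] by simp
    finally show ?thesis using \<open>v j < N\<close> by simp
  qed
  moreover have "v \<in> extensional {..<d}" using assms by (auto simp: vD in_X_iff PiE_def)
  ultimately show ?thesis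
    by (auto simp: vD translate_def intro!: extensionalityI[of _ "{..<d}"])
qed

lemma translate_bij: "bij_betw (translate t) X X"
proof -
  have inj: "inj_on (translate t) X"
    by (rule inj_on_inverseI[of _ "translate (\<lambda>j. N - t j mod N)"]) (rule translate_translate)
  have "translate t ` X = X" using translate_in_X by (intro endo_inj_surj finite_X inj) auto
  with inj show ?thesis by (simp add: bij_betw_def)
qed

lemma translate_symmetry: "cell_symmetry N d (translate t) (\<lambda>_. 1 :: 'f::field)"
proof
  fix \<sigma> \<rho> assume X: "\<sigma> \<in> X" "\<rho> \<in> X"
  show "1 * incidence N (translate t \<sigma>) (translate t \<rho>) = (1 * incidence N \<sigma> \<rho> :: 'f)"
  proof (rule incidence_compatI[where s' = "\<lambda>_. 1" and \<pi> = id and flip = "\<lambda>_. False"])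
    show "inj_on (translate t) X" using translate_bij by (rule bij_betw_imp_inj_on)
    fix k assume k: "k \<in> snd \<sigma>"
    obtain v D where vD: "\<sigma> = (v, D)" by (cases \<sigma>)
    have "k < d" using X k by (auto simp: vD in_X_iff)
    moreover have "((v k + t k) mod N + 1) mod N = ((v k + 1) mod N + t k) mod N"
      by (simp add: mod_simps add.commute add.left_commute)
    ultimately show "front_face N (id k) (translate t \<sigma>) = translate t (front_face N k \<sigma>) \<and>
        back_face (id k) (translate t \<sigma>) = translate t (back_face k \<sigma>)"
      by (auto simp: vD translate_def front_face_def back_face_def fun_eq_iff)
  qed (use X in \<open>auto simp: translate_def split: prod.splits\<close>)
next
  show "bij_betw (translate t) X X" by (rule translate_bij)
qed (auto simp: cell_dim_def translate_def)

lemma reflect_in_X: "\<sigma> \<in> X \<Longrightarrow> j < d \<Longrightarrow> reflect j \<sigma> \<in> X"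
proof -
  assume \<sigma>: "\<sigma> \<in> X" "j < d"
  obtain v D where vD: "\<sigma> = (v, D)" by (cases \<sigma>)
  have v: "v \<in> {..<d} \<rightarrow>\<^sub>E {..<N}" using \<sigma> by (simp add: vD in_X_iff)
  have "v(j := if j \<in> D then N - 1 - v j else (N - v j) mod N) \<in> {..<d} \<rightarrow>\<^sub>E {..<N}"
    using v \<sigma>(2) by (rule fun_upd_PiE) (use N_pos in auto)
  then show ?thesis using \<sigma> by (simp add: vD reflect_def in_X_iff)
qed

lemma reflect_reflect: "\<sigma> \<in> X \<Longrightarrow> j < d \<Longrightarrow> reflect j (reflect j \<sigma>) = \<sigma>"
proof -
  assume \<sigma>: "\<sigma> \<in> X" "j < d"
  obtain v D where vD: "\<sigma> = (v, D)" by (cases \<sigma>)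
  have "v j < N" using \<sigma> by (auto simp: vD in_X_iff)
  then have "(N - (N - v j) mod N) mod N = v j" "N - 1 - (N - 1 - v j) = v j"
    by (cases "v j = 0"; simp)+
  then show ?thesis by (auto simp: vD reflect_def)
qed

lemma reflect_bij: "j < d \<Longrightarrow> bij_betw (reflect j) X X"
  by (rule bij_betw_byWitness[of _ "reflect j"]) (auto simp: reflect_reflect reflect_in_X)

lemma reflect_symmetry:
  assumes j: "j < d"
  shows "cell_symmetry N d (reflect j) (reflect_sign j :: cell \<Rightarrow> 'f::field)"
proof
  fix \<sigma> \<rho> assume X: "\<sigma> \<in> X" "\<rho> \<in> X"
  obtain v D where vD: "\<sigma> = (v, D)" by (cases \<sigma>)
  have vj: "v j < N" using X j by (auto simp: vD in_X_iff)
  show "reflect_sign j \<sigma> * incidence N (reflect j \<sigma>) (reflect j \<rho>) = (reflect_sign j \<rho> * incidence N \<sigma> \<rho> :: 'f)"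
  proof (rule incidence_compatI[where s' = "\<lambda>D. if j \<in> D then - 1 else 1" and \<pi> = id and flip = "\<lambda>k. k = j"])
    show "inj_on (reflect j) X" using reflect_bij[OF j] by (rule bij_betw_imp_inj_on)
    fix k assume k: "k \<in> snd \<sigma>"
    {
      assume "k \<noteq> j"
      then show "front_face N (id k) (reflect j \<sigma>) = reflect j (front_face N k \<sigma>) \<and>
        back_face (id k) (reflect j \<sigma>) = reflect j (back_face k \<sigma>)"
        by (auto simp: vD reflect_def front_face_def back_face_def)
    next
      assume "k = j"
      moreover have "Suc (N - 1 - v j) = N - v j" using vj by simp
      moreover have "(N - (v j + 1) mod N) mod N = N - 1 - v j"
      proof (cases "Suc (v j) = N")
        case True
        then show ?thesis by auto
      next
        case False
        then show ?thesis using vj by simp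
      qed
      ultimately show "front_face N (id k) (reflect j \<sigma>) = reflect j (back_face k \<sigma>) \<and>
        back_face (id k) (reflect j \<sigma>) = reflect j (front_face N k \<sigma>)"
        using k by (simp add: vD reflect_def front_face_def back_face_def)
    }
  qed (use X in \<open>auto simp: reflect_def reflect_sign_def split: prod.splits\<close>)
next
  show "bij_betw (reflect j) X X" by (rule reflect_bij[OF j])
qed (auto simp: cell_dim_def reflect_def reflect_sign_def)

lemma swap_in_X: "\<sigma> \<in> X \<Longrightarrow> Suc j < d \<Longrightarrow> swap j \<sigma> \<in> X"
proof -
  assume \<sigma>: "\<sigma> \<in> X" "Suc j < d"
  obtain v D where vD: "\<sigma> = (v, D)" by (cases \<sigma>)
  have "adj j l < d \<longleftrightarrow> l < d" for l using \<sigma>(2) by (auto simp: Transposition.transpose_def)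
  then show ?thesis using \<sigma>(1) by (auto simp: vD swap_def torus_def PiE_def Pi_def extensional_def)
qed

lemma swap_swap [simp]: "swap j (swap j \<sigma>) = \<sigma>"
  by (cases \<sigma>) (simp add: swap_def comp_assoc image_comp)

lemma swap_bij: "Suc j < d \<Longrightarrow> bij_betw (swap j) X X"
  by (rule bij_betw_byWitness[of _ "swap j"]) (auto simp: swap_in_X)

text \<open>An adjacent transposition changes the relative order of the pair \<open>j\<close>,
  \<open>Suc j\<close> only, so the count of smaller directions changes only if both are in
  \<open>D\<close> and \<open>k\<close> is one of them.\<close>

lemma face_sign_transpose:
  assumes D: "finite D" "k \<in> D"
  shows "(if j \<in> D \<and> Suc j \<in> D then - 1 else 1) * face_sign (adj j ` D) (adj j k)
    = ((if j \<in> D - {k} \<and> Suc j \<in> D - {k} then - 1 else 1) * face_sign D k :: 'f::field)"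
proof -
  let ?\<pi> = "adj j"
  have "{l \<in> ?\<pi> ` D. l < ?\<pi> k} = ?\<pi> ` {m \<in> D. ?\<pi> m < ?\<pi> k}" by auto
  moreover have "card (?\<pi> ` {m \<in> D. ?\<pi> m < ?\<pi> k}) = card {m \<in> D. ?\<pi> m < ?\<pi> k}"
    by (intro card_image inj_on_subset[OF inj_on_transpose[of j "Suc j" UNIV]]) auto
  ultimately have c: "card {l \<in> ?\<pi> ` D. l < ?\<pi> k} = card {m \<in> D. ?\<pi> m < ?\<pi> k}" by simp
  consider "k = j" "Suc j \<in> D" | "k = j" "Suc j \<notin> D" | "k = Suc j" "j \<in> D" | "k = Suc j" "j \<notin> D" | "k \<noteq> j" "k \<noteq> Suc j"
    by blast
  then show ?thesis
  proof cases
    case 1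
    have "{m \<in> D. ?\<pi> m < ?\<pi> k} = insert (Suc j) {m \<in> D. m < k}"
      using 1 by (auto simp: Transposition.transpose_def split: if_splits)
    then have "card {l \<in> ?\<pi> ` D. l < ?\<pi> k} = Suc (card {m \<in> D. m < k})" unfolding c using 1 D by simp
    then show ?thesis using 1 D by (simp add: face_sign_def)
  next
    case 2
    have "{m \<in> D. ?\<pi> m < ?\<pi> k} = {m \<in> D. m < k}"
      using 2 by (auto simp: Transposition.transpose_def split: if_splits)
    then have "card {l \<in> ?\<pi> ` D. l < ?\<pi> k} = card {m \<in> D. m < k}" unfolding c by simp
    then show ?thesis using 2 D by (simp add: face_sign_def)
  next
    case 3
    have "{m \<in> D. m < k} = insert j {m \<in> D. ?\<pi> m < ?\<pi> k}"
      using 3 by (auto simp: Transposition.transpose_def split: if_splits)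
    then have "card {m \<in> D. m < k} = Suc (card {l \<in> ?\<pi> ` D. l < ?\<pi> k})" unfolding c using 3 D by simp
    then show ?thesis using 3 D by (simp add: face_sign_def)
  next
    case 4
    have "{m \<in> D. m < k} = {m \<in> D. ?\<pi> m < ?\<pi> k}"
      using 4 by (auto simp: Transposition.transpose_def split: if_splits)
    then have "card {l \<in> ?\<pi> ` D. l < ?\<pi> k} = card {m \<in> D. m < k}" unfolding c by simp
    then show ?thesis using 4 D by (simp add: face_sign_def)
  next
    case 5
    have "{m \<in> D. m < k} = {m \<in> D. ?\<pi> m < ?\<pi> k}"
      using 5 by (auto simp: Transposition.transpose_def split: if_splits)
    then have "card {l \<in> ?\<pi> ` D. l < ?\<pi> k} = card {m \<in> D. m < k}" unfolding c by simp
    then show ?thesis using 5 D by (simp add: face_sign_def)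
  qed
qed

lemma swap_symmetry:
  assumes j: "Suc j < d"
  shows "cell_symmetry N d (swap j) (swap_sign j :: cell \<Rightarrow> 'f::field)"
proof
  fix \<sigma> \<rho> assume X: "\<sigma> \<in> X" "\<rho> \<in> X"
  let ?\<pi> = "adj j"
  obtain v D where vD: "\<sigma> = (v, D)" by (cases \<sigma>)
  show "swap_sign j \<sigma> * incidence N (swap j \<sigma>) (swap j \<rho>) = (swap_sign j \<rho> * incidence N \<sigma> \<rho> :: 'f)"
  proof (rule incidence_compatI[where s' = "\<lambda>D. if j \<in> D \<and> Suc j \<in> D then - 1 else 1" and \<pi> = ?\<pi> and flip = "\<lambda>_. False"])
    show "inj_on (swap j) X" using swap_bij[OF j] by (rule bij_betw_imp_inj_on)
    fix k assume k: "k \<in> snd \<sigma>"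
    show "(if j \<in> snd \<sigma> \<and> Suc j \<in> snd \<sigma> then - 1 else 1) * face_sign (?\<pi> ` snd \<sigma>) (?\<pi> k) * (if False then - 1 else 1)
      = ((if j \<in> snd \<sigma> - {k} \<and> Suc j \<in> snd \<sigma> - {k} then - 1 else 1) * face_sign (snd \<sigma>) k :: 'f)"
      using face_sign_transpose[OF finite_dirs[OF X(1)] k, of j, where ?'f = 'f] by simp
    have "(v \<circ> ?\<pi>)(?\<pi> k := a) = (v(k := a)) \<circ> ?\<pi>" for a
      by (auto simp: fun_eq_iff transpose_eq_iff)
    moreover have "?\<pi> ` D - {?\<pi> k} = ?\<pi> ` (D - {k})" by (auto simp: transpose_eq_iff)
    ultimately show "front_face N (?\<pi> k) (swap j \<sigma>) = swap j (front_face N k \<sigma>) \<and>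
        back_face (?\<pi> k) (swap j \<sigma>) = swap j (back_face k \<sigma>)"
      by (simp add: vD swap_def front_face_def back_face_def)
  qed (use X in \<open>auto simp: swap_def swap_sign_def intro: inj_on_subset[OF inj_on_transpose[of j "Suc j" UNIV]] split: prod.splits\<close>)
next
  show "bij_betw (swap j) X X" by (rule swap_bij[OF j])
qed (auto simp: cell_dim_def swap_def swap_sign_def card_image)

lemma push_subtorus:
  fixes s :: "cell \<Rightarrow> 'f::field"
  assumes g: "\<And>v. v \<in> plane I \<Longrightarrow> g (v, I) = (\<gamma> v, J)" and \<gamma>: "bij_betw \<gamma> (plane I) (plane J)"
    and s: "\<And>v. s (v, I) = a"
  shows "push g s (subtorus I) = scale_chain a (subtorus J)"
proof -
  have "push g s (subtorus I) = (\<Sum>v\<in>plane I. scale_chain a (cell_chain (\<gamma> v, J)))"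
    unfolding push_def subtorus_def lin_sum lin_cell_chain s by (intro sum.cong) (simp_all add: g)
  also have "\<dots> = (\<Sum>v\<in>plane J. scale_chain a (cell_chain (v, J)))"
    by (rule sum.reindex_bij_betw[OF \<gamma>])
  finally show ?thesis by (simp add: subtorus_def scale_chain_sum)
qed

lemma plane_iff: "I \<subseteq> {..<d} \<Longrightarrow> v \<in> plane I \<longleftrightarrow> (v, I) \<in> X \<and> (\<forall>l<d. l \<notin> I \<longrightarrow> v l = 0)"
  by (simp add: plane_def in_X_iff)

lemma reflect_subtorus:
  assumes I: "I \<subseteq> {..<d}" and j: "j < d"
  shows "push (reflect j) (reflect_sign j) (subtorus I)
    = scale_chain (if j \<in> I then - 1 else 1) (subtorus I :: 'f::field chain)"
proof (rule push_subtorus)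
  let ?\<gamma> = "\<lambda>v. fst (reflect j (v, I))"
  have r: "reflect j (v, I) = (?\<gamma> v, I)" for v by (simp add: reflect_def)
  show "reflect j (v, I) = (?\<gamma> v, I)" for v by (rule r)
  have inv: "?\<gamma> (?\<gamma> v) = v" if "v \<in> plane I" for v
    using reflect_reflect[of "(v, I)" j] r[of v] that plane_iff[OF I] j by (metis fst_conv)
  have into: "?\<gamma> v \<in> plane I" if v: "v \<in> plane I" for v
  proof -
    have "(?\<gamma> v, I) \<in> X" using reflect_in_X[of "(v, I)" j] r[of v] v plane_iff[OF I] j by metis
    moreover have "?\<gamma> v l = 0" if "l < d" "l \<notin> I" for l
      using v that by (auto simp: reflect_def plane_def)
    ultimately show ?thesis using plane_iff[OF I] by blast
  qed
  show "bij_betw ?\<gamma> (plane I) (plane I)"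
    by (rule bij_betw_byWitness[of _ ?\<gamma>]) (use inv into in auto)
qed (simp add: reflect_sign_def)

lemma swap_subtorus:
  assumes I: "I \<subseteq> {..<d}" and j: "Suc j < d"
  shows "push (swap j) (swap_sign j) (subtorus I)
    = scale_chain (if j \<in> I \<and> Suc j \<in> I then - 1 else 1) (subtorus (adj j ` I) :: 'f::field chain)"
proof (rule push_subtorus)
  let ?\<pi> = "adj j"
  show "swap j (v, I) = (v \<circ> ?\<pi>, ?\<pi> ` I)" for v by (simp add: swap_def)
  have \<pi>d: "?\<pi> l < d \<longleftrightarrow> l < d" for l using j by (auto simp: Transposition.transpose_def)
  have sub: "?\<pi> ` I \<subseteq> {..<d}" using I \<pi>d by auto
  have into: "v \<circ> ?\<pi> \<in> plane (?\<pi> ` J)" if J: "J \<subseteq> {..<d}" and v: "v \<in> plane J" for v J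
  proof -
    have J': "?\<pi> ` J \<subseteq> {..<d}" using J \<pi>d by auto
    have "(v \<circ> ?\<pi>, ?\<pi> ` J) \<in> X" using swap_in_X[of "(v, J)" j] v plane_iff[OF J] j by (simp add: swap_def)
    moreover have "v (?\<pi> l) = 0" if "l < d" "l \<notin> ?\<pi> ` J" for l
    proof -
      have "?\<pi> l \<notin> J" using that(2) by (metis imageI transpose_involutory)
      then show ?thesis using v that \<pi>d by (simp add: plane_def)
    qed
    ultimately show ?thesis using plane_iff[OF J'] by simp
  qed
  have "?\<pi> ` ?\<pi> ` I = I" by (simp add: image_comp)
  then show "bij_betw (\<lambda>v. v \<circ> ?\<pi>) (plane I) (plane (?\<pi> ` I))"
    using into[OF I] into[OF sub] by (intro bij_betw_byWitness[of _ "\<lambda>v. v \<circ> ?\<pi>"]) (auto simp: comp_assoc)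
qed (simp add: swap_sign_def)

lemma initial_segment:
  assumes "finite (I :: nat set)" "\<And>j. Suc j \<in> I \<Longrightarrow> j \<in> I"
  shows "I = {..<card I}"
proof -
  define n where "n = (LEAST n. n \<notin> I)"
  have "\<exists>n. n \<notin> I" using assms(1) ex_new_if_finite infinite_UNIV_nat by blast
  then have n: "n \<notin> I" unfolding n_def by (rule LeastI_ex)
  have n': "\<And>m. m < n \<Longrightarrow> m \<in> I" unfolding n_def by (auto dest: not_less_Least)
  have "m \<notin> I" if "n \<le> m" for m
    using that by (induction m rule: dec_induct) (use n assms(2) in auto)
  then have "I = {..<n}" using n' by (auto simp: not_le[symmetric])
  then show ?thesis by simp
qed

text \<open>Adjacent transpositions sort the directions into an initial segment, lowering their sum
  each time, and carry subtori to subtori up to sign.\<close>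

lemma subtori_connected:
  fixes V :: "'f::field chain set"
  assumes V: "chain.subspace V" and swap: "\<And>j. Suc j < d \<Longrightarrow> push (swap j) (swap_sign j) ` V \<subseteq> V"
  shows "I \<in> axes k \<Longrightarrow> subtorus I \<in> V \<longleftrightarrow> subtorus {..<k} \<in> V"
proof (induction "\<Sum>I" arbitrary: I rule: less_induct)
  case less
  have I: "I \<subseteq> {..<d}" "card I = k" "finite I" using less.prems finite_subset by (auto simp: axes_def)
  show ?case
  proof (cases "\<forall>j. Suc j \<in> I \<longrightarrow> j \<in> I")
    case True
    then have "I = {..<k}" using initial_segment[of I] I by simp
    then show ?thesis by simp
  next
    case False
    then obtain j where j: "Suc j \<in> I" "j \<notin> I" by blast
    then have jd: "Suc j < d" using I by auto
    let ?\<pi> = "adj j"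
    have step: "subtorus (?\<pi> ` J) \<in> V" if J: "J \<subseteq> {..<d}" and V': "subtorus J \<in> V" for J
    proof -
      define a :: 'f where "a = (if j \<in> J \<and> Suc j \<in> J then - 1 else 1)"
      have "scale_chain a (subtorus (?\<pi> ` J)) \<in> V"
        using swap_subtorus[OF J jd, where ?'f = 'f] swap[OF jd] V' by (auto simp: a_def)
      from chain.subspace_scale[OF V this, of a] show ?thesis
        by (simp add: scale_chain_simps a_def split: if_splits)
    qed
    have sub: "?\<pi> ` I \<subseteq> {..<d}" using I jd by (auto simp: Transposition.transpose_def)
    have \<pi>I: "?\<pi> ` I = insert j (I - {Suc j})"
      using j by (auto simp: Transposition.transpose_def image_iff split: if_splits)
    have "card (?\<pi> ` I) = k" using I by (simp add: card_image)
    then have ax: "?\<pi> ` I \<in> axes k" using sub by (simp add: axes_def)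
    have "\<Sum>I = Suc j + \<Sum>(I - {Suc j})" using j I by (simp add: sum.remove)
    moreover have "\<Sum>(?\<pi> ` I) = j + \<Sum>(I - {Suc j})" unfolding \<pi>I using j I by (subst sum.insert) auto
    ultimately have "\<Sum>(?\<pi> ` I) < \<Sum>I" by simp
    from less.hyps[OF this ax] have "subtorus (?\<pi> ` I) \<in> V \<longleftrightarrow> subtorus {..<k} \<in> V" .
    moreover have "subtorus (?\<pi> ` I) \<in> V \<longleftrightarrow> subtorus I \<in> V"
      using step[OF I(1)] step[OF sub] by (auto simp: image_comp)
    ultimately show ?thesis by simp
  qed
qed

text \<open>The reflections act on the classes of the subtori by distinct characters (as \<open>2 \<noteq> 0\<close>), so an
  element of minimal support of an invariant subspace is a multiple of a single subtorus.\<close>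

theorem irreducible:
  fixes V :: "'f::field chain set"
  assumes two: "(2 :: 'f) \<noteq> 0" and V: "chain.subspace V" "B k \<subseteq> V" "V \<subseteq> Z k" "V \<noteq> B k"
    and reflect: "\<And>j. j < d \<Longrightarrow> push (reflect j) (reflect_sign j) ` V \<subseteq> V"
    and swap: "\<And>j. Suc j < d \<Longrightarrow> push (swap j) (swap_sign j) ` V \<subseteq> V"
  shows "V = Z k"
proof -
  define comb :: "(nat set \<Rightarrow> 'f) \<Rightarrow> 'f chain" where "comb = (\<lambda>a. \<Sum>I\<in>axes k. scale_chain (a I) (subtorus I))"
  define sz where "sz = (\<lambda>a :: nat set \<Rightarrow> 'f. card {I \<in> axes k. a I \<noteq> 0})"
  have fin: "finite (axes k)" by (simp add: axes_def)
  have comb_add: "comb a + comb b = comb (\<lambda>I. a I + b I)" for a b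
    by (simp add: comb_def sum.distrib[symmetric] scale_chain_simps)
  have comb_neg: "- comb a = comb (\<lambda>I. - a I)" for a
    by (rule minus_unique) (unfold comb_add, simp add: comb_def scale_chain_simps)
  have R: "push (reflect j) (reflect_sign j) (comb a) = comb (\<lambda>I. if j \<in> I then - a I else a I)" if "j < d" for j a
    unfolding comb_def push_def lin_sum lin_scale
  proof (rule sum.cong)
    fix I assume "I \<in> axes k"
    then have "I \<subseteq> {..<d}" by (simp add: axes_def)
    from reflect_subtorus[OF this that, where ?'f = 'f]
    show "scale_chain (a I) (lin (\<lambda>\<sigma>. scale_chain (reflect_sign j \<sigma>) (cell_chain (reflect j \<sigma>))) (subtorus I))
        = scale_chain (if j \<in> I then - a I else a I) (subtorus I)"
      by (simp add: push_def scale_chain_simps)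
  qed simp
  have ex: "\<exists>a. comb a \<in> V \<and> comb a \<notin> B k"
  proof -
    obtain w where w: "w \<in> V" "w \<notin> B k" using V by blast
    then obtain a where a: "w - comb a \<in> B k"
      using torus_homology_generators[of w k] V(3) unfolding comb_def by blast
    have "w - (w - comb a) \<in> V" by (rule chain.subspace_diff[OF V(1) w(1) subsetD[OF V(2) a]])
    moreover have "comb a \<notin> B k"
      using w(2) a chain.subspace_add[OF subspace_B, of "w - comb a" k "comb a"] by auto
    ultimately show ?thesis by auto
  qed
  then obtain a where a: "comb a \<in> V" "comb a \<notin> B k"
    and min: "\<And>b. comb b \<in> V \<Longrightarrow> comb b \<notin> B k \<Longrightarrow> sz a \<le> sz b"
    using ex_has_least_nat[of "\<lambda>a. comb a \<in> V \<and> comb a \<notin> B k" _ sz] by blast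
  have "\<exists>I\<in>axes k. a I \<noteq> 0"
  proof (rule ccontr)
    assume "\<not> ?thesis"
    then have "comb a = 0" by (simp add: comb_def scale_chain_simps)
    moreover have "0 \<in> (B k :: 'f chain set)" by (rule chain.subspace_0[OF subspace_B])
    ultimately show False using a(2) by simp
  qed
  then obtain I where I: "I \<in> axes k" "a I \<noteq> 0" by blast
  have single: "a J = 0" if J: "J \<in> axes k" "J \<noteq> I" for J
  proof (rule ccontr)
    assume aJ: "a J \<noteq> 0"
    have "finite I" "finite J" "card I = card J" using I J finite_subset by (auto simp: axes_def)
    then have "\<not> I \<subseteq> J" using J(2) card_subset_eq by metis
    then obtain j where j: "j \<in> I" "j \<notin> J" by blast
    then have jd: "j < d" using I by (auto simp: axes_def)
    \<comment> \<open>Twice the projections of \<open>comb a\<close> to the eigenspaces of the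
      reflection for -1 and 1. The first loses \<open>J\<close>, the second loses \<open>I\<close>,
      so by minimality both are boundaries, and then so is half their sum.\<close>
    define b c where "b = (\<lambda>I. if j \<in> I then 2 * a I else 0)" and "c = (\<lambda>I. if j \<in> I then 0 else 2 * a I)"
    let ?R = "push (reflect j) (reflect_sign j) (comb a)"
    have RV: "?R \<in> V" using reflect[OF jd] a(1) by blast
    have "comb b = comb a - ?R"
      unfolding R[OF jd] diff_conv_add_uminus comb_neg comb_add b_def by (intro arg_cong[of _ _ comb]) auto
    then have bV: "comb b \<in> V" using RV a(1) V(1) by (simp add: chain.subspace_diff)
    have "comb c = comb a + ?R"
      unfolding R[OF jd] comb_add c_def by (intro arg_cong[of _ _ comb]) auto
    then have cV: "comb c \<in> V" using RV a(1) V(1) by (simp add: chain.subspace_add)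
    have "{I \<in> axes k. b I \<noteq> 0} \<subseteq> {I \<in> axes k. a I \<noteq> 0}" by (auto simp: b_def split: if_splits)
    moreover have "J \<in> {I \<in> axes k. a I \<noteq> 0}" "J \<notin> {I \<in> axes k. b I \<noteq> 0}"
      using J aJ j by (simp_all add: b_def)
    ultimately have "{I \<in> axes k. b I \<noteq> 0} \<subset> {I \<in> axes k. a I \<noteq> 0}" by blast
    then have "sz b < sz a" unfolding sz_def using fin by (intro psubset_card_mono) simp_all
    then have b: "comb b \<in> B k" using min[OF bV] by (meson not_less)
    have "{I \<in> axes k. c I \<noteq> 0} \<subseteq> {I \<in> axes k. a I \<noteq> 0}" by (auto simp: c_def split: if_splits)
    moreover have "I \<in> {I \<in> axes k. a I \<noteq> 0}" "I \<notin> {I \<in> axes k. c I \<noteq> 0}"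
      using I j by (simp_all add: c_def)
    ultimately have "{I \<in> axes k. c I \<noteq> 0} \<subset> {I \<in> axes k. a I \<noteq> 0}" by blast
    then have "sz c < sz a" unfolding sz_def using fin by (intro psubset_card_mono) simp_all
    then have c: "comb c \<in> B k" using min[OF cV] by (meson not_less)
    have "comb a = scale_chain (1 / 2) (comb b + comb c)"
      unfolding comb_add using two
      by (simp add: comb_def scale_chain_sum scale_chain_simps) (intro sum.cong, auto simp: b_def c_def)
    moreover have "scale_chain (1 / 2) (comb b + comb c) \<in> B k"
      using b c by (intro chain.subspace_scale[OF subspace_B] chain.subspace_add[OF subspace_B])
    ultimately show False using a(2) by simp
  qed
  have "comb a = (\<Sum>J\<in>axes k. if J = I then scale_chain (a I) (subtorus I) else 0)"
    unfolding comb_def by (intro sum.cong) (auto simp: single scale_chain_simps)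
  then have "comb a = scale_chain (a I) (subtorus I)" using I fin by simp
  then have "subtorus I \<in> V"
    using chain.subspace_scale[OF V(1) a(1), of "1 / a I"] I(2) by (simp add: scale_chain_simps)
  then have all: "subtorus J \<in> V" if "J \<in> axes k" for J
    using subtori_connected[OF V(1) swap] I(1) that by blast
  show ?thesis
  proof
    show "Z k \<subseteq> V"
    proof
      fix z :: "'f chain" assume "z \<in> Z k"
      then obtain b where b: "z - comb b \<in> B k" using torus_homology_generators unfolding comb_def by blast
      have "comb b \<in> V" unfolding comb_def using all by (intro chain.subspace_sum chain.subspace_scale V(1))
      then have "(z - comb b) + comb b \<in> V" using b V(2) by (intro chain.subspace_add[OF V(1)]) auto
      then show "z \<in> V" by simp
    qed
  qed (rule V(3))
qed

end

section \<open>Dimension of the homology quotient\<close>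

lemma homology_class_eq_iff:
  fixes x y :: "'f::field chain"
  shows "homology_class N P k x = homology_class N P k y \<longleftrightarrow> x - y \<in> boundaries N P k"
proof
  assume "homology_class N P k x = homology_class N P k y"
  moreover have "x + 0 \<in> homology_class N P k x"
    unfolding homology_class_def using boundaries_closed(1) by blast
  ultimately obtain b where "x = y + b" "b \<in> boundaries N P k" by (auto simp: homology_class_def)
  then show "x - y \<in> boundaries N P k" by simp
next
  assume xy: "x - y \<in> boundaries N P k"
  show "homology_class N P k x = homology_class N P k y"
  proof (rule Set.set_eqI)
    fix w :: "'f chain"
    have "w \<in> homology_class N P k x \<longleftrightarrow> w - x \<in> boundaries N P k" for x :: "'f chain"
      unfolding homology_class_def by (auto intro: exI[of _ "w - x"])
    moreover have "w - y = (w - x) + (x - y)" "w - x = (w - y) + - (x - y)" by simp_all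
    then have "w - x \<in> boundaries N P k \<longleftrightarrow> w - y \<in> boundaries N P k"
      using xy boundaries_closed(2) boundaries_neg by metis
    ultimately show "w \<in> homology_class N P k x \<longleftrightarrow> w \<in> homology_class N P k y" by simp
  qed
qed

lemma homology_finsum:
  fixes f :: "'b \<Rightarrow> 'f::field chain"
  assumes "finite S" "\<And>x. x \<in> S \<Longrightarrow> f x \<in> cycles N P k"
  shows "finsum (homology N P k) (\<lambda>x. homology_class N P k (f x)) S = homology_class N P k (\<Sum>x\<in>S. f x)"
  using assms
proof (induction S rule: finite_induct)
  case empty
  interpret vectorspace class_ring "homology N P k :: ('f, 'f chain set) module" by (rule vectorspace_homology)
  show ?case by (simp add: homology_ops)
next
  case (insert x S)
  interpret vectorspace class_ring "homology N P k :: ('f, 'f chain set) module" by (rule vectorspace_homology)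
  have "finsum (homology N P k) (\<lambda>x. homology_class N P k (f x)) (insert x S)
    = homology_class N P k (f x) \<oplus>\<^bsub>homology N P k\<^esub> finsum (homology N P k) (\<lambda>x. homology_class N P k (f x)) S"
    using insert by (intro finsum_insert) (auto simp: homology_ops)
  then show ?case using insert by (simp add: homology_ops)
qed

text \<open>\<open>vectorspace.dim\<close> is the least size of a finite generating set.
  Representatives of a generating set together with the boundaries span the cycles, which gives the
  lower bound. Conversely a basis of the boundaries extends to one of the cycles, and the classes of
  the added elements generate.\<close>

lemma dim_homology:
  fixes N P k
  defines "Zk \<equiv> cycles N P k :: 'f::field chain set" and "Bk \<equiv> boundaries N P k :: 'f chain set"
  assumes sub: "Bk \<subseteq> Zk" and fin: "Zk \<subseteq> chain.span T" "finite T"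
  shows "vectorspace.dim class_ring (homology N P k :: ('f, 'f chain set) module) + chain.dim Bk = chain.dim Zk"
proof -
  let ?H = "homology N P k :: ('f, 'f chain set) module"
  let ?h = "homology_class N P k :: 'f chain \<Rightarrow> _"
  interpret H: vectorspace class_ring ?H by (rule vectorspace_homology)
  have Z: "chain.subspace Zk" and B: "chain.subspace Bk"
    by (simp_all add: chain.subspace_def Zk_def Bk_def cycles_closed boundaries_closed)
  have lincomb: "H.lincomb a A = ?h (\<Sum>v\<in>A. scale_chain (a v) (\<rho> v))"
    if A: "finite A" "\<And>v. v \<in> A \<Longrightarrow> \<rho> v \<in> Zk \<and> ?h (\<rho> v) = v" for a A \<rho>
  proof -
    have eq: "a v \<odot>\<^bsub>?H\<^esub> v = ?h (scale_chain (a v) (\<rho> v))" if "v \<in> A" for v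
      using A(2)[OF that] homology_ops(2)[of N P k "a v" "\<rho> v"] by simp
    have "?h (scale_chain (a v) (\<rho> v)) \<in> carrier ?H" if "v \<in> A" for v
      unfolding homology_ops(4) using A(2)[OF that] by (intro imageI cycles_closed(3)) (simp add: Zk_def)
    then have "H.lincomb a A = finsum ?H (\<lambda>v. ?h (scale_chain (a v) (\<rho> v))) A"
      unfolding H.lincomb_def by (intro H.finsum_cong' eq) auto
    also have "\<dots> = ?h (\<Sum>v\<in>A. scale_chain (a v) (\<rho> v))"
      using A by (intro homology_finsum) (auto simp: Zk_def intro: cycles_closed)
    finally show ?thesis .
  qed
  have lower: "chain.dim Zk \<le> chain.dim Bk + card A" if A: "finite A" "A \<subseteq> carrier ?H" "H.gen_set A" for A
  proof -
    have "\<forall>v\<in>A. \<exists>z. z \<in> Zk \<and> ?h z = v" using A(2) by (auto simp: homology_ops Zk_def)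
    then obtain \<rho> where \<rho>: "\<And>v. v \<in> A \<Longrightarrow> \<rho> v \<in> Zk \<and> ?h (\<rho> v) = v" by metis
    have "Zk \<subseteq> chain.span (Bk \<union> \<rho> ` A)"
    proof
      fix z assume "z \<in> Zk"
      then have "?h z \<in> H.span A" using A(3) by (simp add: homology_ops Zk_def)
      then obtain a where "?h z = H.lincomb a A" using H.finite_in_span[OF A(1,2)] by metis
      then have "?h z = ?h (\<Sum>v\<in>A. scale_chain (a v) (\<rho> v))" using lincomb[OF A(1) \<rho>, of a] by simp
      then have "z - (\<Sum>v\<in>A. scale_chain (a v) (\<rho> v)) \<in> Bk"
        unfolding homology_class_eq_iff Bk_def .
      then have "(z - (\<Sum>v\<in>A. scale_chain (a v) (\<rho> v))) + (\<Sum>v\<in>A. scale_chain (a v) (\<rho> v)) \<in> chain.span (Bk \<union> \<rho> ` A)"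
        by (intro chain.span_add chain.span_sum chain.span_scale chain.span_base) auto
      then show "z \<in> chain.span (Bk \<union> \<rho> ` A)" by simp
    qed
    then have "chain.dim Zk \<le> chain.dim Bk + card (\<rho> ` A)"
      using sub fin A(1) by (intro chain.dim_le_add_card[of _ T]) auto
    also have "card (\<rho> ` A) \<le> card A" using A(1) by (rule card_image_le)
    finally show ?thesis by simp
  qed
  have BT: "Bk \<subseteq> chain.span T" using sub fin by blast
  obtain B0 where B0: "B0 \<subseteq> Bk" "chain.independent B0" "Bk \<subseteq> chain.span B0" "card B0 = chain.dim Bk" "finite B0"
    using BT fin(2) by (rule chain.finite_basis_exists)
  have "B0 \<subseteq> Zk" using B0(1) sub by blast
  from chain.maximal_independent_subset_extend[OF this B0(2)] obtain C where
    C: "B0 \<subseteq> C" "C \<subseteq> Zk" "chain.independent C" "Zk \<subseteq> chain.span C" by blast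
  have finC: "finite C" using chain.independent_span_bound[OF fin(2) C(3)] C(2) fin(1) by blast
  have cardC: "card C = chain.dim Zk" using C by (intro chain.basis_card_eq_dim)
  define A where "A = ?h ` (C - B0)"
  have A: "finite A" "A \<subseteq> carrier ?H" using finC C(2) by (auto simp: A_def homology_ops Zk_def)
  have cardA: "card A + chain.dim Bk \<le> chain.dim Zk"
    using card_image_le[of "C - B0" ?h] finC C(1) B0 cardC card_mono[OF finC C(1)]
    by (simp add: A_def card_Diff_subset)
  have "H.gen_set A"
  proof
    show "H.span A \<subseteq> carrier ?H" using H.span_is_subset2[OF A(2)] .
    have S: "H.span A \<subseteq> carrier ?H" using H.span_is_subset2[OF A(2)] .
    have "submodule class_ring (H.span A) ?H" using H.span_is_submodule[OF A(2)] .
    note sm = this[unfolded submodule_def]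
    have "chain.subspace {z \<in> Zk. ?h z \<in> H.span A}"
      unfolding chain.subspace_def
    proof (intro conjI ballI allI)
      show "0 \<in> {z \<in> Zk. ?h z \<in> H.span A}"
        using chain.subspace_0[OF Z] sm by (auto simp: homology_ops(3)[symmetric])
      show "x + y \<in> {z \<in> Zk. ?h z \<in> H.span A}" if "x \<in> {z \<in> Zk. ?h z \<in> H.span A}" "y \<in> {z \<in> Zk. ?h z \<in> H.span A}" for x y
        using that sm chain.subspace_add[OF Z] by (auto simp: homology_ops(1)[symmetric])
      show "scale_chain a x \<in> {z \<in> Zk. ?h z \<in> H.span A}" if "x \<in> {z \<in> Zk. ?h z \<in> H.span A}" for a x
        using that sm chain.subspace_scale[OF Z] by (auto simp: homology_ops(2)[symmetric] class_ring_simps)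
    qed
    moreover have "C \<subseteq> {z \<in> Zk. ?h z \<in> H.span A}"
    proof
      fix c assume c: "c \<in> C"
      show "c \<in> {z \<in> Zk. ?h z \<in> H.span A}"
      proof (cases "c \<in> B0")
        case True
        then have "?h c = ?h 0" using B0(1) by (simp add: homology_class_eq_iff) (auto simp: Bk_def)
        then show ?thesis using c C(2) sm by (auto simp: homology_ops(3)[symmetric])
      next
        case False
        then show ?thesis using c C(2) H.in_own_span[OF A(2)] by (auto simp: A_def)
      qed
    qed
    ultimately have "chain.span C \<subseteq> {z \<in> Zk. ?h z \<in> H.span A}" by (rule chain.span_minimal[rotated])
    then show "carrier ?H \<subseteq> H.span A" using C(4) by (auto simp: homology_ops Zk_def)
  qed
  have "H.dim = card A"
    unfolding H.dim_def
  proof (rule Least_equality)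
    show "\<exists>A'. finite A' \<and> card A' = card A \<and> A' \<subseteq> carrier ?H \<and> H.gen_set A'"
      using A \<open>H.gen_set A\<close> by blast
    fix n assume "\<exists>A'. finite A' \<and> card A' = n \<and> A' \<subseteq> carrier ?H \<and> H.gen_set A'"
    then obtain A' where A': "finite A'" "card A' = n" "A' \<subseteq> carrier ?H" "H.gen_set A'" by blast
    then show "card A \<le> n" using lower[of A'] cardA by simp
  qed
  then show ?thesis using lower[OF A \<open>H.gen_set A\<close>] cardA by simp
qed

section \<open>The plaquette model\<close>

context cell_symmetry begin

lemma pull_lin: "pull (scale_chain a c) = scale_chain a (pull c)"
  by (simp add: pull_def lin_scale)

lemma G_W: "P \<subseteq> X \<Longrightarrow> W k (g ` P) = G ` W k P"
proof -
  assume P: "P \<subseteq> X"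
  have Zs: "Z k \<inter> supp (g ` P) = G ` (Z k \<inter> supp P)"
  proof -
    have "supp P \<subseteq> (supp X :: 'f chain set)" using P by (rule supp_mono)
    moreover have "Z k \<subseteq> (supp X :: 'f chain set)" using C_supp_X by (auto simp: Z_def)
    ultimately have "G ` (Z k \<inter> supp P) = G ` Z k \<inter> G ` supp P" using inj_G by (intro inj_on_image_Int)
    then show ?thesis using G_Z G_supp[OF P] by simp
  qed
  have add: "G (a + b) = G a + G b" for a b by (simp add: push_def lin_add)
  show ?thesis
  proof
    show "W k (g ` P) \<subseteq> G ` W k P"
    proof
      fix x :: "'f chain" assume "x \<in> W k (g ` P)"
      then obtain b c where "x = b + c" "b \<in> B k" "c \<in> Z k \<inter> supp (g ` P)" unfolding W_def by blast
      moreover then obtain b' c' where "b = G b'" "b' \<in> B k" "c = G c'" "c' \<in> Z k \<inter> supp P"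
        using Zs G_B[of k] by blast
      ultimately have "x = G (b' + c')" "b' + c' \<in> W k P" unfolding W_def using add by auto
      then show "x \<in> G ` W k P" by blast
    qed
    show "G ` W k P \<subseteq> W k (g ` P)"
    proof
      fix x :: "'f chain" assume "x \<in> G ` W k P"
      then obtain b c where bc: "x = G (b + c)" "b \<in> B k" "c \<in> Z k \<inter> supp P" unfolding W_def by blast
      then have "G b \<in> B k" "G c \<in> Z k \<inter> supp (g ` P)" using Zs G_B[of k] by blast+
      then show "x \<in> W k (g ` P)" unfolding W_def bc(1) add by blast
    qed
  qed
qed

lemma W_supp_X: "W k P \<subseteq> (supp X :: 'f chain set)"
  using W_subset_Z[of k P] C_supp_X by (auto simp: Z_def)

lemma G_W_eq_Z: "P \<subseteq> X \<Longrightarrow> W k (g ` P) = (Z k :: 'f chain set) \<longleftrightarrow> W k P = (Z k :: 'f chain set)"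
proof -
  assume P: "P \<subseteq> X"
  have "Z k \<subseteq> (supp X :: 'f chain set)" using C_supp_X by (auto simp: Z_def)
  then have "G ` W k P = G ` Z k \<longleftrightarrow> W k P = (Z k :: 'f chain set)"
    using inj_on_image_eq_iff[OF inj_G W_supp_X] by blast
  then show ?thesis using G_W[OF P] G_Z by simp
qed

text \<open>Signs do not affect spans, so the boundaries of the moved cells are spanned by the image
  under \<open>G\<close> of the old ones, and conversely with \<open>pull\<close>; linear maps do
  not raise dimension.\<close>

lemma dim_boundary_image:
  assumes P: "P \<subseteq> X"
  shows "chain.dim (cell_boundary N ` g ` P :: 'f chain set) = chain.dim (cell_boundary N ` P :: 'f chain set)"
proof (rule antisym)
  have fin: "finite P" using P finite_X finite_subset by blast
  have "cell_boundary N ` g ` P \<subseteq> chain.span (G ` cell_boundary N ` P)"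
  proof
    fix c :: "'f chain" assume "c \<in> cell_boundary N ` g ` P"
    then obtain \<sigma> where \<sigma>: "\<sigma> \<in> P" "c = cell_boundary N (g \<sigma>)" by blast
    then have "\<sigma> \<in> X" using P by blast
    then show "c \<in> chain.span (G ` cell_boundary N ` P)"
      unfolding \<sigma>(2) using \<sigma>(1) by (simp add: G_cell_boundary chain.span_scale chain.span_base)
  qed
  then have "chain.dim (cell_boundary N ` g ` P :: 'f chain set) \<le> chain.dim (G ` cell_boundary N ` P)"
    using fin by (intro chain.dim_mono_finite[OF _ chain.span_superset]) auto
  also have "\<dots> \<le> chain.dim (cell_boundary N ` P :: 'f chain set)"
    unfolding push_def using fin by (intro dim_lin_image_le) auto
  finally show "chain.dim (cell_boundary N ` g ` P :: 'f chain set) \<le> chain.dim (cell_boundary N ` P :: 'f chain set)" .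
  have "cell_boundary N \<sigma> = scale_chain (s \<sigma>) (pull (cell_boundary N (g \<sigma>)))" if "\<sigma> \<in> P" for \<sigma>
  proof -
    have "\<sigma> \<in> X" using that P by blast
    have "cell_boundary N \<sigma> \<in> (supp X :: 'f chain set)"
      unfolding supp_iff incidence_def[symmetric] using incidence_outside[OF \<open>\<sigma> \<in> X\<close>] by blast
    then show ?thesis unfolding G_cell_boundary[OF \<open>\<sigma> \<in> X\<close>] pull_lin
      by (simp add: pull_G scale_chain_simps s_sq)
  qed
  then have "cell_boundary N ` P \<subseteq> chain.span (pull ` cell_boundary N ` g ` P)"
    by (metis (no_types, lifting) chain.span_base chain.span_scale image_subsetI imageI)
  then have "chain.dim (cell_boundary N ` P :: 'f chain set) \<le> chain.dim (pull ` cell_boundary N ` g ` P)"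
    using fin by (intro chain.dim_mono_finite[OF _ chain.span_superset]) auto
  also have "\<dots> \<le> chain.dim (cell_boundary N ` g ` P :: 'f chain set)"
    unfolding pull_def using fin by (intro dim_lin_image_le) auto
  finally show "chain.dim (cell_boundary N ` P :: 'f chain set) \<le> chain.dim (cell_boundary N ` g ` P :: 'f chain set)" .
qed

end

context middle_torus begin

definition inessential :: "'f::field itself \<Rightarrow> cell set \<Rightarrow> bool" where
  "inessential F P \<longleftrightarrow> W i P = (B i :: 'f chain set)"

definition spanning :: "'f::field itself \<Rightarrow> cell set \<Rightarrow> bool" where
  "spanning F P \<longleftrightarrow> W i P = (Z i :: 'f chain set)"

lemma rank_image:
  assumes "cell_symmetry N d g (s :: cell \<Rightarrow> 'f::field)" "P \<subseteq> cells i"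
  shows "rank TYPE('f) (g ` P) = rank TYPE('f) P"
proof -
  interpret S: cell_symmetry N d g s by (rule assms(1))
  have "g ` P \<subseteq> cells i" using assms(2) S.cells_image[of i] by blast
  then show ?thesis
    using S.dim_boundary_image[of P] assms(2) cells_subset[of i] by (simp add: rank_def Int_absorb2)
qed

lemma cells_bij: "cell_symmetry N d g (s :: cell \<Rightarrow> 'f::field) \<Longrightarrow> bij_betw g (cells i) (cells i)"
proof -
  assume "cell_symmetry N d g s"
  then interpret S: cell_symmetry N d g s .
  show ?thesis using S.cells_image[of i] inj_on_subset[OF S.g_inj cells_subset] by (simp add: bij_betw_def)
qed

lemma dual_bij: "bij_betw dual (Pow (cells i)) (Pow (cells i))"
proof -
  have inj: "inj_on dual (Pow (cells i))"
  proof (rule inj_onI)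
    fix P Q assume PQ: "P \<in> Pow (cells i)" "Q \<in> Pow (cells i)" "dual P = dual Q"
    have "\<tau> \<in> P \<longleftrightarrow> \<tau> \<in> Q" if \<tau>: "\<tau> \<in> cells i" for \<tau>
    proof -
      obtain \<sigma> where "\<sigma> \<in> cells i" "\<tau> = star \<sigma>" using \<tau> star_cells_i by blast
      moreover have "\<sigma> \<in> dual P \<longleftrightarrow> \<sigma> \<in> dual Q" using PQ(3) by simp
      ultimately show ?thesis by (simp add: dual_def)
    qed
    then show "P = Q" using PQ(1,2) by (intro Set.set_eqI) (metis PowD subsetD)
  qed
  moreover have "dual ` Pow (cells i) = Pow (cells i)"
    using finite_cells dual_subset by (intro endo_inj_surj inj) auto
  ultimately show ?thesis by (simp add: bij_betw_def)
qed

lemma card_dual: "P \<subseteq> cells i \<Longrightarrow> card (dual P) = card (cells i) - card P"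
proof -
  assume P: "P \<subseteq> cells i"
  have inj: "inj_on star (cells i)" using star_inj cells_subset by (rule inj_on_subset)
  have "star ` dual P = cells i - P"
  proof
    show "star ` dual P \<subseteq> cells i - P" using star_cells_i by (auto simp: dual_def)
    show "cells i - P \<subseteq> star ` dual P"
    proof
      fix \<tau> assume \<tau>: "\<tau> \<in> cells i - P"
      then obtain \<sigma> where "\<sigma> \<in> cells i" "\<tau> = star \<sigma>" using star_cells_i by blast
      with \<tau> show "\<tau> \<in> star ` dual P" by (auto simp: dual_def)
    qed
  qed
  moreover have "card (star ` dual P) = card (dual P)"
    using inj dual_subset by (intro card_image) (rule inj_on_subset)
  ultimately show ?thesis using P finite_cells finite_subset by (metis card_Diff_subset)
qed

end

text \<open>\<open>1 / (1 + q ^ 2 ^ d)\<close> bounds the probability of a non-zero map at the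
  self-dual odds, and the heights in the amplification run from 0 to \<open>2 ^ d\<close>. The
  minimum with 1 covers the case \<open>B i = Z i\<close> in
  \<open>critical_lower_bound\<close>.\<close>

definition critical_bound :: "nat \<Rightarrow> real \<Rightarrow> real" where
  "critical_bound d q = min 1 (amplified (Suc (2 ^ d)) (1 / (1 + q ^ 2 ^ d)))"

lemma critical_bound_pos:
  assumes "1 \<le> q"
  shows "0 < critical_bound d q"
proof -
  have "0 < 1 / (1 + q ^ 2 ^ d)" using assms by (intro divide_pos_pos add_pos_pos) auto
  then show ?thesis unfolding critical_bound_def by (simp only: min_less_iff_conj amplified_pos) simp
qed

locale plaquette_model = middle_torus N d i for N d i :: nat +
  fixes F :: "'f::field itself" and q :: real
  assumes F: "F = TYPE('f)" and q_ge_1: "1 \<le> q" and two_nz: "(2 :: 'f) \<noteq> 0"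
begin

sublocale M: rank_model "cells i" "rank TYPE('f)" q
  using q_ge_1 by (rule rank_model)

text \<open>Passing to the dual complements the cardinality, and the definition of
  \<open>excess\<close> trades \<open>rank (dual P)\<close> for the rank of \<open>P\<close> minus
  its cardinality, which turns the odds \<open>x\<close> into \<open>q / x\<close>. The leftover
  exponent \<open>e\<close> is the excess of \<open>P\<close> over that of the empty set.\<close>

lemma weight_dual:
  assumes x: "0 < x"
  obtains c where "0 < c"
    "\<And>P. P \<subseteq> cells i \<Longrightarrow> \<exists>e \<le> 2 ^ d. M.weight x (dual P) = c * (1 / q) ^ e * M.weight (q / x) P"
proof -
  define R0 where "R0 = rank TYPE('f) (dual {})"
  define n where "n = card (cells i)"
  define c where "c = x ^ n * (1 / q) ^ R0"
  have "0 < c" using x q_ge_1 by (simp add: c_def)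
  moreover have "\<exists>e \<le> 2 ^ d. M.weight x (dual P) = c * (1 / q) ^ e * M.weight (q / x) P" if P: "P \<subseteq> cells i" for P
  proof -
    have "chain.dim ({} :: 'f chain set) = 0" using chain.dim_le_card[of "{}" "{}"] by simp
    then have ex0: "excess TYPE('f) {} = int R0" by (simp add: excess_def R0_def rank_def)
    define e where "e = nat (excess TYPE('f) P - int R0)"
    have "excess TYPE('f) P = int R0 + int e" using excess_bounds(1)[OF P, where ?'f = 'f] ex0 by (simp add: e_def)
    then have e: "rank TYPE('f) (dual P) + card P = R0 + e + rank TYPE('f) P" by (simp add: excess_def)
    have "int e \<le> 2 ^ d" using excess_bounds[OF P, where ?'f = 'f] ex0 by (simp add: e_def)
    then have "e \<le> 2 ^ d" by (metis of_nat_le_iff of_nat_numeral of_nat_power)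
    have cP: "card P \<le> n" using P finite_cells by (simp add: n_def card_mono)
    have q0: "q \<noteq> 0" using q_ge_1 by simp
    have "(1 / q) ^ rank TYPE('f) (dual P) = (1 / q) ^ (rank TYPE('f) (dual P) + card P) * q ^ card P"
      using q0 by (simp add: power_add power_divide)
    also have "\<dots> = (1 / q) ^ R0 * (1 / q) ^ e * (1 / q) ^ rank TYPE('f) P * q ^ card P"
      unfolding e by (simp add: power_add)
    finally have r: "(1 / q) ^ rank TYPE('f) (dual P) = (1 / q) ^ R0 * (1 / q) ^ e * (1 / q) ^ rank TYPE('f) P * q ^ card P" .
    have "M.weight x (dual P) = x ^ (n - card P) * (1 / q) ^ rank TYPE('f) (dual P)"
      using dual_subset[of P] card_dual[OF P] by (simp add: M.weight_def Int_absorb2 n_def)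
    also have "x ^ (n - card P) = x ^ n / x ^ card P" using x cP by (simp add: power_diff)
    also have "x ^ n / x ^ card P * (1 / q) ^ rank TYPE('f) (dual P) = c * (1 / q) ^ e * ((q / x) ^ card P * (1 / q) ^ rank TYPE('f) P)"
      unfolding r c_def by (simp add: power_divide)
    also have "(q / x) ^ card P * (1 / q) ^ rank TYPE('f) P = M.weight (q / x) P"
      using P by (simp add: M.weight_def Int_absorb2)
    finally show ?thesis using \<open>e \<le> 2 ^ d\<close> by blast
  qed
  ultimately show ?thesis using that by blast
qed

lemma prob_eq: "0 < x \<Longrightarrow> M.prob x Q = (\<Sum>P\<in>Pow (cells i). of_bool (Q P) * M.weight x P) / (\<Sum>P\<in>Pow (cells i). M.weight x P)"
  using M.fkg_weight[of x] by (simp add: fkg_weight.pr_def fkg_weight.ex_def)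

text \<open>After the substitution \<open>dual\<close>, numerators and normalizations are compared
  by \<open>weight_dual\<close>. Each of the two bounds there is used once, so only one factor
  \<open>q ^ 2 ^ d\<close> is lost.\<close>

lemma prob_dual:
  assumes x: "0 < x"
  shows "M.prob x Q \<le> q ^ 2 ^ d * M.prob (q / x) (\<lambda>P. Q (dual P))"
    and "M.prob (q / x) (\<lambda>P. Q (dual P)) \<le> q ^ 2 ^ d * M.prob x Q"
proof -
  define T where "T = q ^ 2 ^ d"
  have T: "1 \<le> T" using q_ge_1 by (simp add: T_def)
  have qx: "0 < q / x" using x q_ge_1 by simp
  obtain c where c: "0 < c"
    "\<And>P. P \<subseteq> cells i \<Longrightarrow> \<exists>e \<le> 2 ^ d. M.weight x (dual P) = c * (1 / q) ^ e * M.weight (q / x) P"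
    using weight_dual[OF x] by blast
  have w0: "0 < M.weight (q / x) P" "0 < M.weight x P" for P
    using fkg_weight.w_pos[OF M.fkg_weight] qx x by blast+
  have bounds: "M.weight x (dual P) \<le> c * M.weight (q / x) P" "c * M.weight (q / x) P \<le> T * M.weight x (dual P)" if "P \<subseteq> cells i" for P
  proof -
    obtain e where e: "e \<le> 2 ^ d" "M.weight x (dual P) = c * (1 / q) ^ e * M.weight (q / x) P" using c(2) \<open>P \<subseteq> cells i\<close> by blast
    have "(1 / q) ^ e \<le> 1" using q_ge_1 by (intro power_le_one) auto
    then have "(1 / q) ^ e * (c * M.weight (q / x) P) \<le> 1 * (c * M.weight (q / x) P)"
      using c(1) w0 by (intro mult_right_mono) (auto simp: less_imp_le)
    then show "M.weight x (dual P) \<le> c * M.weight (q / x) P" by (simp add: e(2) mult_ac)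
    have "q ^ e \<le> T" unfolding T_def using q_ge_1 e(1) by (intro power_increasing) auto
    then have "1 \<le> T * (1 / q) ^ e" using q_ge_1 by (simp add: power_divide field_simps)
    then have "1 * (c * M.weight (q / x) P) \<le> (T * (1 / q) ^ e) * (c * M.weight (q / x) P)"
      using c(1) w0 by (intro mult_right_mono) (auto simp: less_imp_le)
    then show "c * M.weight (q / x) P \<le> T * M.weight x (dual P)" by (simp add: e(2) mult_ac)
  qed
  define A where "A = (\<Sum>P\<in>Pow (cells i). of_bool (Q P) * M.weight x P)"
  define Y where "Y = (\<Sum>P\<in>Pow (cells i). M.weight x P)"
  define A' where "A' = (\<Sum>P\<in>Pow (cells i). of_bool (Q (dual P)) * M.weight (q / x) P)"
  define Y' where "Y' = (\<Sum>P\<in>Pow (cells i). M.weight (q / x) P)"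
  have Y0: "0 < Y" "0 < Y'" unfolding Y_def Y'_def
    using fkg_weight.norm_pos[OF M.fkg_weight] x qx by blast+
  have A0: "0 \<le> A" "0 \<le> A'" unfolding A_def A'_def using w0 by (auto intro!: sum_nonneg simp: less_imp_le)
  have A: "A = (\<Sum>P\<in>Pow (cells i). of_bool (Q (dual P)) * M.weight x (dual P))"
    unfolding A_def by (rule sum.reindex_bij_betw[OF dual_bij, symmetric])
  have Y: "Y = (\<Sum>P\<in>Pow (cells i). M.weight x (dual P))"
    unfolding Y_def by (rule sum.reindex_bij_betw[OF dual_bij, symmetric])
  have a: "A \<le> c * A'" "c * A' \<le> T * A"
    unfolding A A'_def sum_distrib_left using bounds by (auto intro!: sum_mono simp: mult.left_commute)
  have y: "Y \<le> c * Y'" "c * Y' \<le> T * Y"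
    unfolding Y Y'_def sum_distrib_left using bounds by (auto intro!: sum_mono)
  have p: "M.prob x Q = A / Y" "M.prob (q / x) (\<lambda>P. Q (dual P)) = A' / Y'"
    using prob_eq x qx by (simp_all add: A_def Y_def A'_def Y'_def)
  have "A * (c * Y') \<le> (c * A') * (T * Y)" using A0 c(1) Y0 T by (intro mult_mono[OF a(1) y(2)]) auto
  then have "c * (A * Y') \<le> c * (T * A' * Y)" by (simp add: mult_ac)
  then have "A * Y' \<le> T * A' * Y" using c(1) by simp
  then have "A / Y \<le> T * A' / Y'" using Y0 by (simp add: frac_le_eq divide_le_eq le_divide_eq mult_ac)
  then show "M.prob x Q \<le> q ^ 2 ^ d * M.prob (q / x) (\<lambda>P. Q (dual P))" by (simp add: p T_def)
  have "(c * A') * Y \<le> (T * A) * (c * Y')" using A0 c(1) Y0 T by (intro mult_mono[OF a(2) y(1)]) auto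
  then have "c * (A' * Y) \<le> c * (T * A * Y')" by (simp add: mult_ac)
  then have "A' * Y \<le> T * A * Y'" using c(1) by simp
  then have "A' / Y' \<le> T * A / Y" using Y0 by (simp add: divide_le_eq le_divide_eq mult_ac)
  then show "M.prob (q / x) (\<lambda>P. Q (dual P)) \<le> q ^ 2 ^ d * M.prob x Q" by (simp add: p T_def)
qed

lemma weight_image:
  assumes "cell_symmetry N d g (s :: cell \<Rightarrow> 'f)" "P \<subseteq> cells i"
  shows "M.weight x (g ` P) = M.weight x P"
proof -
  have "card (g ` P) = card P"
    using cells_bij[OF assms(1)] assms(2) by (meson bij_betw_imp_inj_on card_image inj_on_subset)
  moreover have "g ` P \<subseteq> cells i" using bij_betw_imp_surj_on[OF cells_bij[OF assms(1)]] assms(2) by blast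
  ultimately show ?thesis using rank_image[OF assms] assms(2) by (simp add: M.weight_def Int_absorb2)
qed

text \<open>If all reflections and swaps mapped \<open>W i A\<close> into itself,
  \<open>irreducible\<close> would make it equal to \<open>Z i\<close>. A symmetry that does not
  supplies \<open>U\<close>, and invariance of the weight gives the comparison of
  probabilities.\<close>

lemma moved:
  assumes x: "0 < x" and A: "A \<subseteq> cells i" "\<not> inessential TYPE('f) A" "\<not> spanning TYPE('f) A"
  shows "\<exists>U. \<not> U \<subseteq> (W i A :: 'f chain set) \<and> M.prob x (\<lambda>C. W i A \<subseteq> (W i C :: 'f chain set)) \<le> M.prob x (\<lambda>C. U \<subseteq> (W i C :: 'f chain set))"
proof -
  have "\<exists>g (s :: cell \<Rightarrow> 'f). cell_symmetry N d g s \<and> \<not> push g s ` W i A \<subseteq> W i A"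
  proof (rule ccontr)
    assume "\<not> ?thesis"
    then have "W i A = (Z i :: 'f chain set)"
      using A(2) reflect_symmetry swap_symmetry unfolding inessential_def
      by (intro irreducible[OF two_nz subspace_W B_subset_W W_subset_Z]) blast+
    with A(3) show False by (simp add: spanning_def)
  qed
  then obtain g and s :: "cell \<Rightarrow> 'f" where gs: "cell_symmetry N d g s" "\<not> push g s ` W i A \<subseteq> W i A" by blast
  interpret S: cell_symmetry N d g s by (rule gs(1))
  interpret fkg_weight "cells i" "M.weight x" by (rule M.fkg_weight[OF x])
  let ?U = "push g s ` W i A"
  have "M.prob x (\<lambda>C. W i A \<subseteq> (W i C :: 'f chain set)) \<le> M.prob x (\<lambda>C. ?U \<subseteq> (W i (g ` C) :: 'f chain set))"
  proof (rule pr_mono)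
    fix C assume "C \<subseteq> cells i" "W i A \<subseteq> (W i C :: 'f chain set)"
    moreover then have "C \<subseteq> X" using cells_subset by blast
    ultimately show "?U \<subseteq> W i (g ` C)" by (simp only: S.G_W image_mono)
  qed
  also have "\<dots> = M.prob x (\<lambda>C. ?U \<subseteq> (W i C :: 'f chain set))"
    by (rule pr_reindex[OF bij_betw_Pow[OF cells_bij[OF gs(1)]] weight_image[OF gs(1)]])
  finally show ?thesis using gs(2) by (intro exI[of _ ?U] conjI)
qed

text \<open>At \<open>sqrt q\<close> the dual odds are the same. Hence a zero map is at most
  \<open>q ^ 2 ^ d\<close> times as likely as a surjective one, and so as a non-zero one; this
  starts the amplification.\<close>

lemma critical_lower_bound: "critical_bound d q \<le> M.prob (sqrt q) (spanning TYPE('f))"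
proof -
  have x: "0 < sqrt q" "q / sqrt q = sqrt q" using q_ge_1 by (simp_all add: real_div_sqrt)
  interpret fkg_weight "cells i" "M.weight (sqrt q)" by (rule M.fkg_weight[OF x(1)])
  define T where "T = q ^ 2 ^ d"
  have T: "1 \<le> T" using q_ge_1 by (simp add: T_def)
  show ?thesis
  proof (cases "B i = (Z i :: 'f chain set)")
    \<comment> \<open>With vanishing homology a surjective map could be zero and the comparison of
      the other case would break down, but then \<open>spanning\<close> is certain.\<close>
    case True
    then have "spanning TYPE('f) P" for P using B_subset_W[of i P] W_subset_Z[of i P] unfolding spanning_def by blast
    then have "pr (spanning TYPE('f)) = 1" unfolding pr_def by simp
    then show ?thesis by (simp add: critical_bound_def)
  next
    case False
    have "pr (inessential TYPE('f)) \<le> pr (\<lambda>P. spanning TYPE('f) (dual P))"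
      unfolding inessential_def spanning_def by (rule pr_mono) (rule trivial_imp_dual_surjective)
    also have "\<dots> \<le> T * pr (spanning TYPE('f))" using prob_dual(2)[OF x(1), of "spanning TYPE('f)"] x(2) by (simp add: T_def)
    also have "\<dots> \<le> T * pr (\<lambda>P. \<not> inessential TYPE('f) P)" using T False by (intro mult_left_mono pr_mono) (auto simp: spanning_def inessential_def)
    finally have "1 \<le> (1 + T) * pr (\<lambda>P. \<not> inessential TYPE('f) P)" by (simp add: pr_not algebra_simps)
    then have \<epsilon>: "1 / (1 + T) \<le> pr (\<lambda>P. \<not> inessential TYPE('f) P)" using T by (simp add: divide_le_eq mult.commute)
    define ht where "ht = (\<lambda>U :: 'f chain set. chain.dim U - chain.dim (B i :: 'f chain set))"
    have dimB: "chain.dim (B i :: 'f chain set) \<le> chain.dim (W i A :: 'f chain set)" for A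
      using B_subset_W[of i A] chain.span_superset finite_cells
      by (intro chain.dim_mono_finite[OF _ W_in_span]) auto
    have "amplified (Suc (2 ^ d)) (1 / (1 + T)) \<le> pr (spanning TYPE('f))"
      unfolding spanning_def
    proof (rule amplify[where Bot = "B i" and ht = ht])
      fix A C assume "W i A \<subset> (W i C :: 'f chain set)"
      from dim_W_strict[OF this] show "ht (W i A) < ht (W i C)" using dimB[of A] by (simp add: ht_def)
    next
      fix A show "ht (W i A :: 'f chain set) \<le> 2 ^ d" using dim_W_le[of A, where ?'f = 'f] by (simp add: ht_def)
    next
      fix A assume "A \<subseteq> cells i" "W i A \<noteq> (B i :: 'f chain set)" "W i A \<noteq> (Z i :: 'f chain set)"
      then show "\<exists>U. \<not> U \<subseteq> (W i A :: 'f chain set) \<and> pr (\<lambda>C. W i A \<subseteq> (W i C :: 'f chain set)) \<le> pr (\<lambda>C. U \<subseteq> (W i C :: 'f chain set))"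
        using moved[OF x(1), of A] unfolding inessential_def spanning_def by blast
    next
      show "0 < 1 / (1 + T)" using T by simp
      show "1 / (1 + T) \<le> pr (\<lambda>A. W i A \<noteq> (B i :: 'f chain set))" using \<epsilon> by (simp add: inessential_def)
    qed (rule W_mono B_subset_W, assumption?)+
    then show ?thesis by (simp add: critical_bound_def T_def)
  qed
qed

text \<open>Translations carry a plaquette to every one of the \<open>N ^ d\<close> corners and keep
  its directions.\<close>

lemma orbit_size:
  assumes x: "0 < x" and e: "e \<in> cells i"
  shows "N ^ d \<le> card {e' \<in> cells i. M.covariance x (\<lambda>P. of_bool (spanning TYPE('f) P)) e'
     = M.covariance x (\<lambda>P. of_bool (spanning TYPE('f) P)) e}"
proof -
  obtain v D where vD: "e = (v, D)" by (cases e)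
  have v: "v \<in> {..<d} \<rightarrow>\<^sub>E {..<N}" using e by (simp add: vD cells_of_dim_def in_X_iff)
  let ?f = "\<lambda>P. of_bool (spanning TYPE('f) P) :: real"
  have "(u, D) \<in> {e' \<in> cells i. M.covariance x ?f e' = M.covariance x ?f e}" if u: "u \<in> {..<d} \<rightarrow>\<^sub>E {..<N}" for u
  proof -
    let ?t = "\<lambda>j. u j + (N - v j)"
    have "(v j + (u j + (N - v j))) mod N = u j" if "j < d" for j
    proof -
      have "v j < N" "u j < N" using u v that by auto
      then have "v j + (u j + (N - v j)) = u j + N" by simp
      then show ?thesis using \<open>u j < N\<close> by simp
    qed
    moreover have "u \<in> extensional {..<d}" using u by (simp add: PiE_def)
    ultimately have "(\<lambda>j\<in>{..<d}. (v j + ?t j) mod N) = u"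
      by (intro extensionalityI[of _ "{..<d}"]) auto
    then have tr: "translate ?t e = (u, D)" by (simp add: vD translate_def)
    note sym = translate_symmetry[of ?t, where ?'f = 'f]
    interpret S: cell_symmetry N d "translate ?t" "\<lambda>_. 1 :: 'f" by (rule sym)
    have "M.covariance x ?f (translate ?t e) = M.covariance x ?f e"
    proof (intro M.covariance_symmetric x cells_bij[OF sym] rank_image[OF sym] e)
      fix A assume "A \<subseteq> cells i"
      then have "A \<subseteq> X" using cells_subset by blast
      then show "?f (translate ?t ` A) = ?f A" using S.G_W_eq_Z[of A i] by (simp add: spanning_def)
    qed
    moreover have "translate ?t e \<in> cells i" using cells_bij[OF sym] e by (meson bij_betw_apply)
    ultimately show ?thesis by (simp add: tr)
  qed
  then have "(\<lambda>u. (u, D)) ` ({..<d} \<rightarrow>\<^sub>E {..<N}) \<subseteq> {e' \<in> cells i. M.covariance x ?f e' = M.covariance x ?f e}"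
    by blast
  then have "card ((\<lambda>u. (u, D)) ` ({..<d} \<rightarrow>\<^sub>E {..<N})) \<le> card {e' \<in> cells i. M.covariance x ?f e' = M.covariance x ?f e}"
    using finite_cells by (intro card_mono) auto
  moreover have "card ((\<lambda>u. (u, D)) ` ({..<d} \<rightarrow>\<^sub>E {..<N})) = N ^ d"
    by (subst card_image) (auto simp: inj_on_def card_PiE)
  ultimately show ?thesis by simp
qed

text \<open>\<open>sharp_threshold\<close> started at \<open>sqrt q\<close>, with the orbit size
  \<open>N ^ d\<close> bounded below by \<open>N\<close>.\<close>

lemma supercritical:
  assumes x: "sqrt q < x" and \<epsilon>: "0 < \<epsilon>" "\<epsilon> \<le> critical_bound d q" and L: "L = x / (x - sqrt q)"
    and N: "((1 + x) ^ 4 * L\<^sup>2 / \<epsilon>\<^sup>2) * exp (4 * (1 + x)\<^sup>2 * L / \<epsilon>\<^sup>2) < real N"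
  shows "1 - \<epsilon> < M.prob x (spanning TYPE('f))"
proof -
  have x0: "0 < sqrt q" "0 < x" using x q_ge_1 by (auto intro: less_trans[of 0 "sqrt q"])
  have "N \<le> N ^ d" using N_pos d_eq i_pos by (intro self_le_power) auto
  then have N': "((1 + x) ^ 4 * L\<^sup>2 / \<epsilon>\<^sup>2) * exp (4 * (1 + x)\<^sup>2 * L / \<epsilon>\<^sup>2) < real (N ^ d)"
    using N by (meson less_le_trans of_nat_le_iff)
  have mono: "of_bool (spanning TYPE('f) P) \<le> (of_bool (spanning TYPE('f) Q) :: real)" if "P \<subseteq> Q" for P Q
    using W_mono[OF that, of i] W_subset_Z[of i Q] by (auto simp: spanning_def)
  have "\<epsilon> \<le> M.expectation (sqrt q) (\<lambda>P. of_bool (spanning TYPE('f) P))"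
    using critical_lower_bound \<epsilon>(2) fkg_weight.pr_def[OF M.fkg_weight[OF x0(1)]] by simp
  from M.sharp_threshold[OF _ mono order_refl x \<epsilon>(1) this L orbit_size N']
  show ?thesis using fkg_weight.pr_def[OF M.fkg_weight[OF x0(2)]] by simp
qed

text \<open>\<open>prob_dual\<close> moves to the odds \<open>q / x\<close>, where a non-zero map
  for the dual excludes a surjective one for the configuration itself.\<close>

lemma subcritical: "0 < x \<Longrightarrow> M.prob x (\<lambda>P. \<not> inessential TYPE('f) P) \<le> q ^ 2 ^ d * (1 - M.prob (q / x) (spanning TYPE('f)))"
proof -
  assume x: "0 < x"
  have qx: "0 < q / x" using x q_ge_1 by simp
  interpret fkg_weight "cells i" "M.weight (q / x)" by (rule M.fkg_weight[OF qx])
  have "M.prob x (\<lambda>P. \<not> inessential TYPE('f) P) \<le> q ^ 2 ^ d * pr (\<lambda>P. \<not> inessential TYPE('f) (dual P))"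
    by (rule prob_dual(1)[OF x])
  also have "pr (\<lambda>P. \<not> inessential TYPE('f) (dual P)) \<le> pr (\<lambda>P. \<not> spanning TYPE('f) P)"
    using surjective_imp_dual_trivial unfolding spanning_def inessential_def by (intro pr_mono) blast
  finally show ?thesis using q_ge_1 by (simp add: pr_not)
qed

end

section \<open>From the plaquette measure to weights on sets of plaquettes\<close>

lemma prob_prc_measure:
  assumes "finite X" "0 \<le> p" "p \<le> 1" "0 < q"
  shows "\<P>(P in prc_measure F N X p q i. Q P) =
    (\<Sum>P\<in>plaquette_configs X i. of_bool (Q P) * prc_weight F N X p q i P)
      / (\<Sum>P\<in>plaquette_configs X i. prc_weight F N X p q i P)"
proof -
  let ?C = "plaquette_configs X i" and ?w = "prc_weight F N X p q i"
  let ?Z = "\<Sum>P\<in>?C. ?w P"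
  have fin: "finite ?C"
    using assms(1) by (auto simp: plaquette_configs_def intro: finite_subset[of _ "Pow X"])
  have nn: "0 \<le> ?w P" for P using assms by (simp add: prc_weight_def)
  then have nnZ: "0 \<le> ?w P / ?Z" for P by (simp add: sum_nonneg)
  have "\<P>(P in prc_measure F N X p q i. Q P) = measure (prc_measure F N X p q i) {P \<in> ?C. Q P}"
    by (simp add: prc_measure_def space_point_measure)
  also have "\<dots> = enn2real (\<Sum>P\<in>{P \<in> ?C. Q P}. ennreal (?w P / ?Z))"
    unfolding measure_def prc_measure_def using fin by (subst emeasure_point_measure_finite) auto
  also have "\<dots> = (\<Sum>P\<in>{P \<in> ?C. Q P}. ?w P / ?Z)"
    using nnZ by (subst sum_ennreal) (auto intro!: enn2real_ennreal sum_nonneg)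
  also have "\<dots> = (\<Sum>P\<in>?C. of_bool (Q P) * (?w P / ?Z))"
    unfolding sum.inter_filter[OF fin] by (intro sum.cong) auto
  finally show ?thesis by (simp add: sum_divide_distrib)
qed

text \<open>The bound on the orbit size in \<open>sharp_threshold\<close> for
  \<open>x0 = sqrt q\<close> and \<open>x1 = x\<close>.\<close>

definition size_bound :: "real \<Rightarrow> real \<Rightarrow> real \<Rightarrow> real" where
  "size_bound q x \<epsilon> = ((1 + x) ^ 4 * (x / (x - sqrt q))\<^sup>2 / \<epsilon>\<^sup>2) * exp (4 * (1 + x)\<^sup>2 * (x / (x - sqrt q)) / \<epsilon>\<^sup>2)"

context plaquette_model begin

text \<open>Adds the lower skeleton, so that sums over configurations become sums over sets of
  \<open>i\<close>-cells; see \<open>config_bij\<close>.\<close>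

definition config :: "cell set \<Rightarrow> cell set" where
  "config P = {\<sigma> \<in> X. cell_dim \<sigma> < i} \<union> P"

lemma config_bij: "bij_betw config (Pow (cells i)) (plaquette_configs X i)"
proof (rule bij_betw_byWitness[of _ "\<lambda>P. cells_of_dim P i"])
  show "\<forall>P\<in>Pow (cells i). cells_of_dim (config P) i = P"
    by (auto simp: config_def cells_of_dim_def)
  show "\<forall>P\<in>plaquette_configs X i. config (cells_of_dim P i) = P"
  proof
    fix P assume "P \<in> plaquette_configs X i"
    then have P: "P \<subseteq> X" "{\<sigma> \<in> X. cell_dim \<sigma> < i} \<subseteq> P" "\<And>\<sigma>. \<sigma> \<in> P \<Longrightarrow> cell_dim \<sigma> \<le> i"
      unfolding plaquette_configs_def by blast+
    show "config (cells_of_dim P i) = P"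
    proof
      show "config (cells_of_dim P i) \<subseteq> P" using P(2) unfolding config_def cells_of_dim_def by blast
      show "P \<subseteq> config (cells_of_dim P i)"
      proof
        fix \<sigma> assume "\<sigma> \<in> P"
        then show "\<sigma> \<in> config (cells_of_dim P i)"
          using P(1) P(3)[of \<sigma>] unfolding config_def cells_of_dim_def
          by (cases "cell_dim \<sigma> = i") auto
      qed
    qed
  qed
  show "config ` Pow (cells i) \<subseteq> plaquette_configs X i"
    by (auto simp: config_def plaquette_configs_def cells_of_dim_def)
  show "(\<lambda>P. cells_of_dim P i) ` plaquette_configs X i \<subseteq> Pow (cells i)"
    by (auto simp: plaquette_configs_def cells_of_dim_def)
qed

lemma config_cells: "P \<subseteq> cells i \<Longrightarrow> cells_of_dim (config P) i = P"
  by (auto simp: config_def cells_of_dim_def)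

lemma config_cells_below: "P \<subseteq> cells i \<Longrightarrow> cells_of_dim (config P) (i - 1) = cells (i - 1)"
  using i_pos by (auto simp: config_def cells_of_dim_def)

lemma config_cycles: "P \<subseteq> cells i \<Longrightarrow> cycles N (config P) i = (Z i \<inter> supp P :: 'f chain set)"
  using supp_mono[of P "cells i"] by (auto simp: cycles_def chains_eq config_cells Z_def)

text \<open>All cells of dimension \<open>i - 1\<close> are present, so the cycles of that dimension
  do not depend on \<open>P\<close>, while the dimension of the boundaries is the rank.\<close>

lemma betti_config:
  assumes P: "P \<subseteq> cells i"
  shows "betti TYPE('f) N (config P) (i - 1) + rank TYPE('f) P = chain.dim (Z (i - 1) :: 'f chain set)"
proof -
  have cyc: "cycles N (config P) (i - 1) = (Z (i - 1) :: 'f chain set)"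
    unfolding cycles_def chains_eq config_cells_below[OF P] Z_def ..
  have bnd: "boundaries N (config P) (i - 1) = (boundary N ` supp P :: 'f chain set)"
    using i_pos by (simp add: boundaries_def chains_eq config_cells[OF P])
  have fin: "finite P" using P finite_cells finite_subset by blast
  have "chain.dim (boundaries N (config P) (i - 1) :: 'f chain set) = rank TYPE('f) P"
    unfolding bnd span_boundary[OF fin, symmetric] using P by (simp add: rank_def Int_absorb2)
  moreover have "boundaries N (config P) (i - 1) \<subseteq> (cycles N (config P) (i - 1) :: 'f chain set)"
  proof -
    have "boundary N ` supp P \<subseteq> (B (i - 1) :: 'f chain set)"
      using supp_mono[OF P] i_pos by (auto simp: B_def)
    then show ?thesis unfolding bnd cyc using B_subset_Z by blast
  qed
  moreover have "cycles N (config P) (i - 1) \<subseteq> (chain.span (cell_chain ` cells (i - 1)) :: 'f chain set)"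
    unfolding cyc supp_eq_span[OF finite_cells, symmetric] by (auto simp: Z_def)
  ultimately show ?thesis
    using dim_homology[of N "config P" "i - 1" "cell_chain ` cells (i - 1) :: 'f chain set"] finite_cells
    unfolding betti_def cyc by simp
qed

lemma incl_nontrivial_config:
  assumes P: "P \<subseteq> cells i"
  shows "incl_nontrivial TYPE('f) N X i (config P) \<longleftrightarrow> \<not> inessential TYPE('f) P"
proof -
  have sub: "config P \<subseteq> X" using P cells_subset by (auto simp: config_def)
  have "incl_nontrivial TYPE('f) N X i (config P) \<longleftrightarrow>
    (\<exists>z\<in>Z i \<inter> supp P :: 'f chain set. homology_class N X i z \<noteq> homology_class N X i 0)"
    unfolding incl_nontrivial_def homology_ops config_cycles[OF P]
    by (simp add: incl_homology_class[OF sub])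
  also have "\<dots> \<longleftrightarrow> \<not> Z i \<inter> supp P \<subseteq> (B i :: 'f chain set)"
    unfolding homology_class_eq_iff B_eq_boundaries[symmetric] by auto
  finally show ?thesis unfolding inessential_def W_eq_B_iff .
qed

lemma incl_surjective_config:
  assumes P: "P \<subseteq> cells i"
  shows "incl_surjective TYPE('f) N X i (config P) \<longleftrightarrow> spanning TYPE('f) P"
proof -
  have sub: "config P \<subseteq> X" using P cells_subset by (auto simp: config_def)
  let ?h = "homology_class N X i :: 'f chain \<Rightarrow> _"
  have "incl_surjective TYPE('f) N X i (config P) \<longleftrightarrow> ?h ` (Z i \<inter> supp P) = ?h ` Z i"
    unfolding incl_surjective_def homology_ops config_cycles[OF P] Z_eq_cycles[symmetric] image_image
    by (simp add: incl_homology_class[OF sub])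
  also have "\<dots> \<longleftrightarrow> (\<forall>z\<in>Z i. \<exists>c\<in>Z i \<inter> supp P. z - c \<in> (B i :: 'f chain set))"
  proof -
    have "?h ` (Z i \<inter> supp P) = ?h ` Z i \<longleftrightarrow> (\<forall>z\<in>Z i. \<exists>c\<in>Z i \<inter> supp P. ?h z = ?h c)" by blast
    then show ?thesis unfolding homology_class_eq_iff B_eq_boundaries[symmetric] .
  qed
  also have "\<dots> \<longleftrightarrow> Z i \<subseteq> (W i P :: 'f chain set)"
  proof
    assume *: "\<forall>z\<in>Z i. \<exists>c\<in>Z i \<inter> supp P. z - c \<in> (B i :: 'f chain set)"
    show "Z i \<subseteq> (W i P :: 'f chain set)"
    proof
      fix z :: "'f chain" assume "z \<in> Z i"
      then obtain c where c: "c \<in> Z i \<inter> supp P" "z - c \<in> B i" using * by blast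
      then have "(z - c) + c \<in> W i P" unfolding W_def by blast
      then show "z \<in> W i P" by simp
    qed
  next
    assume *: "Z i \<subseteq> (W i P :: 'f chain set)"
    show "\<forall>z\<in>Z i. \<exists>c\<in>Z i \<inter> supp P. z - c \<in> (B i :: 'f chain set)"
    proof
      fix z :: "'f chain" assume "z \<in> Z i"
      then obtain b c where "z = b + c" "b \<in> B i" "c \<in> Z i \<inter> supp P" using * unfolding W_def by blast
      then show "\<exists>c\<in>Z i \<inter> supp P. z - c \<in> B i" by (intro bexI[of _ c]) auto
    qed
  qed
  finally show ?thesis unfolding spanning_def using W_subset_Z by blast
qed

lemma prc_weight_config:
  assumes P: "P \<subseteq> cells i"
  shows "prc_weight TYPE('f) N X p q i (config P) = p ^ card P * (1 - p) ^ (card (cells i) - card P)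
    * (q ^ chain.dim (Z (i - 1) :: 'f chain set) * (1 / q) ^ rank TYPE('f) P)"
proof -
  have "q ^ betti TYPE('f) N (config P) (i - 1) = q ^ chain.dim (Z (i - 1) :: 'f chain set) * (1 / q) ^ rank TYPE('f) P"
    unfolding betti_config[OF P, symmetric] using q_ge_1 by (simp add: power_add power_divide)
  then show ?thesis by (simp only: prc_weight_def config_cells[OF P])
qed

lemma prob_prc_config:
  assumes "0 \<le> p" "p \<le> 1"
  shows "\<P>(P in prc_measure TYPE('f) N X p q i. Q P) =
    (\<Sum>P\<in>Pow (cells i). of_bool (Q (config P)) * prc_weight TYPE('f) N X p q i (config P))
      / (\<Sum>P\<in>Pow (cells i). prc_weight TYPE('f) N X p q i (config P))"
  using q_ge_1 assms
  by (subst prob_prc_measure) (auto simp: finite_X sum.reindex_bij_betw[OF config_bij, symmetric])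

text \<open>The powers of 1 - p and q that do not depend on the configuration cancel in the
  quotient, and what is left is the weight with odds p / (1 - p).\<close>

lemma prob_prc_eq:
  assumes p: "0 < p" "p < 1"
  shows "\<P>(P in prc_measure TYPE('f) N X p q i. Q P) = M.prob (p / (1 - p)) (\<lambda>P. Q (config P))"
proof -
  define c where "c = (1 - p) ^ card (cells i) * q ^ chain.dim (Z (i - 1) :: 'f chain set)"
  have c: "c \<noteq> 0" using p q_ge_1 by (simp add: c_def)
  have w: "prc_weight TYPE('f) N X p q i (config P) = c * M.weight (p / (1 - p)) P" if P: "P \<subseteq> cells i" for P
  proof -
    have "card P \<le> card (cells i)" using P finite_cells by (simp add: card_mono)
    then have "(1 - p) ^ (card (cells i) - card P) = (1 - p) ^ card (cells i) / (1 - p) ^ card P"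
      using p by (simp add: power_diff)
    then show ?thesis using P
      by (simp add: prc_weight_config M.weight_def c_def Int_absorb2 power_divide)
  qed
  have "\<P>(P in prc_measure TYPE('f) N X p q i. Q P) =
    (\<Sum>P\<in>Pow (cells i). c * (of_bool (Q (config P)) * M.weight (p / (1 - p)) P))
      / (\<Sum>P\<in>Pow (cells i). c * M.weight (p / (1 - p)) P)"
    using p by (subst prob_prc_config) (auto simp: w mult.left_commute intro!: arg_cong2[of _ _ _ _ "(/)"] sum.cong)
  also have "\<dots> = M.prob (p / (1 - p)) (\<lambda>P. Q (config P))"
    using p c by (simp add: prob_eq sum_distrib_left[symmetric])
  finally show ?thesis .
qed

lemma prob_eq_cong:
  assumes "0 < x" "\<And>P. P \<subseteq> cells i \<Longrightarrow> Q P \<longleftrightarrow> R P"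
  shows "M.prob x Q = M.prob x R"
proof -
  interpret fkg_weight "cells i" "M.weight x" by (rule M.fkg_weight[OF assms(1)])
  show ?thesis unfolding pr_def by (rule ex_cong) (simp add: assms(2))
qed

lemma prob_nontrivial:
  assumes "0 < p" "p < 1"
  shows "\<P>(P in prc_measure TYPE('f) N X p q i. incl_nontrivial TYPE('f) N X i P)
    = M.prob (p / (1 - p)) (\<lambda>P. \<not> inessential TYPE('f) P)"
  unfolding prob_prc_eq[OF assms] using assms by (intro prob_eq_cong incl_nontrivial_config) auto

lemma prob_surjective:
  assumes "0 < p" "p < 1"
  shows "\<P>(P in prc_measure TYPE('f) N X p q i. incl_surjective TYPE('f) N X i P)
    = M.prob (p / (1 - p)) (spanning TYPE('f))"
  unfolding prob_prc_eq[OF assms] using assms by (intro prob_eq_cong incl_surjective_config) auto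

text \<open>The odds would be 0. By \<open>0 ^ 0 = 1\<close> all mass lies on the bare skeleton,
  where the map is zero.\<close>

lemma prob_nontrivial_0:
  "\<P>(P in prc_measure TYPE('f) N X 0 q i. incl_nontrivial TYPE('f) N X i P) = 0"
proof -
  have "of_bool (incl_nontrivial TYPE('f) N X i (config P)) * prc_weight TYPE('f) N X 0 q i (config P) = 0"
    if P: "P \<subseteq> cells i" for P
  proof (cases "P = {}")
    case True
    then show ?thesis by (simp add: incl_nontrivial_config inessential_def W_empty)
  next
    case False
    then have "card P \<noteq> 0" using finite_subset[OF P finite_cells] by simp
    then show ?thesis by (simp add: prc_weight_config[OF P])
  qed
  then have "(\<Sum>P\<in>Pow (cells i). of_bool (incl_nontrivial TYPE('f) N X i (config P)) * prc_weight TYPE('f) N X 0 q i (config P)) = 0"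
    by (intro sum.neutral) auto
  then show ?thesis by (subst prob_prc_config) simp_all
qed

text \<open>The odds would be infinite. By \<open>0 ^ 0 = 1\<close> all mass lies on the
  configuration with every plaquette, which carries all cycles.\<close>

lemma prob_surjective_1:
  "\<P>(P in prc_measure TYPE('f) N X 1 q i. incl_surjective TYPE('f) N X i P) = 1"
proof -
  let ?w = "\<lambda>P. prc_weight TYPE('f) N X 1 q i (config P)"
  have "of_bool (incl_surjective TYPE('f) N X i (config P)) * ?w P = ?w P" if P: "P \<subseteq> cells i" for P
  proof (cases "P = cells i")
    case True
    have "Z i \<subseteq> (W i (cells i) :: 'f chain set)"
      using cycles_subset_W[of i "cells i"] Z_C by blast
    then have "spanning TYPE('f) P" unfolding spanning_def True using W_subset_Z by blast
    then show ?thesis by (simp add: incl_surjective_config[OF P])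
  next
    case False
    then have "card P < card (cells i)" using P finite_cells by (intro psubset_card_mono) auto
    then show ?thesis by (simp add: prc_weight_config[OF P])
  qed
  then have eq: "(\<Sum>P\<in>Pow (cells i). of_bool (incl_surjective TYPE('f) N X i (config P)) * ?w P) = (\<Sum>P\<in>Pow (cells i). ?w P)"
    by (intro sum.cong) auto
  have "0 < (\<Sum>P\<in>Pow (cells i). ?w P)"
  proof (rule sum_pos2[of _ "cells i"])
    show "0 < ?w (cells i)" using q_ge_1 by (simp add: prc_weight_config)
    show "0 \<le> ?w P" for P using q_ge_1 by (simp add: prc_weight_def)
  qed (use finite_cells in auto)
  then show ?thesis using eq by (subst prob_prc_config) simp_all
qed

lemma surjective_bound:
  assumes p: "0 < p" "p < 1" and x: "sqrt q < p / (1 - p)"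
    and \<epsilon>: "0 < \<epsilon>" "\<epsilon> \<le> critical_bound d q" and N: "size_bound q (p / (1 - p)) \<epsilon> < real N"
  shows "1 - \<epsilon> < \<P>(P in prc_measure TYPE('f) N X p q i. incl_surjective TYPE('f) N X i P)"
  unfolding prob_surjective[OF p] by (rule supercritical[OF x \<epsilon> refl N[unfolded size_bound_def]])

text \<open>The dual odds lie above \<open>sqrt q\<close>, so \<open>supercritical\<close> applies
  there and \<open>subcritical\<close> carries the bound back.\<close>

lemma nontrivial_bound:
  assumes p: "0 < p" "p < 1" and x: "p / (1 - p) < sqrt q"
    and \<epsilon>: "0 < \<epsilon>" "\<epsilon> \<le> critical_bound d q" and N: "size_bound q (q / (p / (1 - p))) \<epsilon> < real N"
  shows "\<P>(P in prc_measure TYPE('f) N X p q i. incl_nontrivial TYPE('f) N X i P) < q ^ 2 ^ d * \<epsilon>"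
proof -
  define y where "y = p / (1 - p)"
  have y: "0 < y" "y < sqrt q" using p x by (simp_all add: y_def)
  have "sqrt q * y < sqrt q * sqrt q" using y q_ge_1 by (intro mult_strict_left_mono) auto
  then have "sqrt q < q / y" using y q_ge_1 by (simp add: pos_less_divide_eq)
  from supercritical[OF this \<epsilon> refl N[folded y_def, unfolded size_bound_def]]
  have "1 - M.prob (q / y) (spanning TYPE('f)) < \<epsilon>" by simp
  then have "q ^ 2 ^ d * (1 - M.prob (q / y) (spanning TYPE('f))) < q ^ 2 ^ d * \<epsilon>"
    using q_ge_1 by (intro mult_strict_left_mono) auto
  then show ?thesis unfolding prob_nontrivial[OF p] using subcritical[OF y(1)] by (simp add: y_def)
qed

end

lemma odds_less_iff:
  fixes p s :: real
  assumes "p < 1" "0 < s"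
  shows "s < p / (1 - p) \<longleftrightarrow> s / (1 + s) < p" "p / (1 - p) < s \<longleftrightarrow> p < s / (1 + s)"
proof -
  have "0 < 1 - p" "0 < 1 + s" using assms by auto
  then show "s < p / (1 - p) \<longleftrightarrow> s / (1 + s) < p" "p / (1 - p) < s \<longleftrightarrow> p < s / (1 + s)"
    by (simp_all add: pos_less_divide_eq pos_divide_less_eq algebra_simps)
qed

theorem theorem8:
  fixes i d :: nat and p q :: real
  assumes "i \<ge> 1" and "d = 2 * i"
    and "0 \<le> p" and "p \<le> 1" and "q \<ge> 1"
    and "CHAR('f::field) \<noteq> 2"
  shows "(p < p_sd q \<longrightarrow>
           (\<lambda>N. \<P>(P in prc_measure TYPE('f) N (torus d N) p q i.
              incl_nontrivial TYPE('f) N (torus d N) i P)) \<longlonglongrightarrow> 0)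
       \<and> (p > p_sd q \<longrightarrow>
           (\<lambda>N. \<P>(P in prc_measure TYPE('f) N (torus d N) p q i.
              incl_surjective TYPE('f) N (torus d N) i P)) \<longlonglongrightarrow> 1)"
proof -
  \<comment> \<open>If 2 = 0, the characteristic divides 2; being neither 0 nor 1, it would be
    2.\<close>
  have two: "(2 :: 'f) \<noteq> 0"
  proof
    assume "(2 :: 'f) = 0"
    then have "of_nat 2 = (0 :: 'f)" by simp
    then have "CHAR('f) dvd 2" by (simp only: of_nat_eq_0_iff_char_dvd)
    then have "CHAR('f) \<le> 2" "CHAR('f) \<noteq> 0"
      using dvd_imp_le[of "CHAR('f)" 2] by (simp, metis dvd_0_left_iff zero_neq_numeral)
    moreover have "CHAR('f) \<noteq> 1" by simp
    ultimately show False using assms(6) by linarith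
  qed
  have model: "plaquette_model N d i TYPE('f) q" if "0 < N" for N
    using that assms two by unfold_locales auto
  have s: "0 < sqrt q" "p_sd q = sqrt q / (1 + sqrt q)" using assms(5) by (auto simp: p_sd_def)
  have p_sd: "0 < p_sd q" "p_sd q < 1"
    unfolding s(2) using s(1) by (auto intro!: divide_pos_pos add_pos_pos simp: divide_less_eq simp del: real_sqrt_gt_0_iff)
  have crit: "0 < critical_bound d q" using assms(5) by (rule critical_bound_pos)
  have le_1: "measure (prc_measure TYPE('f) N (torus d N) p q i) A \<le> 1" for N A
    using assms(3-5) by (intro prob_space.prob_le_1 prob_space_prc_measure finite_torus) auto
  show ?thesis
  proof (intro conjI impI)
    assume sub: "p < p_sd q"
    show "(\<lambda>N. \<P>(P in prc_measure TYPE('f) N (torus d N) p q i.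
       incl_nontrivial TYPE('f) N (torus d N) i P)) \<longlonglongrightarrow> 0"
    proof (rule LIMSEQ_I)
      fix \<delta> :: real assume \<delta>: "0 < \<delta>"
      \<comment> \<open>The factor that duality costs in \<open>nontrivial_bound\<close> is divided
        out in advance.\<close>
      define \<epsilon> where "\<epsilon> = min (\<delta> / q ^ 2 ^ d) (critical_bound d q)"
      have \<epsilon>: "0 < \<epsilon>" "\<epsilon> \<le> critical_bound d q" "q ^ 2 ^ d * \<epsilon> \<le> \<delta>"
        using \<delta> crit assms(5) by (auto simp: \<epsilon>_def min_def field_simps)
      obtain N0 where N0: "size_bound q (q / (p / (1 - p))) \<epsilon> < real N0"
        using reals_Archimedean2 by blast
      have "\<P>(P in prc_measure TYPE('f) N (torus d N) p q i. incl_nontrivial TYPE('f) N (torus d N) i P) < \<delta>"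
        if N: "Suc N0 \<le> N" for N
      proof -
        have "0 < N" using N by simp
        interpret plaquette_model N d i "TYPE('f)" q by (rule model[OF \<open>0 < N\<close>])
        show ?thesis
        proof (cases "p = 0")
          case True
          show ?thesis unfolding True prob_nontrivial_0 by (rule \<delta>)
        next
          case False
          then have p: "0 < p" "p < 1" using False assms(3) sub p_sd by auto
          then have "p / (1 - p) < sqrt q" using odds_less_iff(2) s sub by simp
          from nontrivial_bound[OF p this \<epsilon>(1,2)] N0 N \<epsilon>(3) show ?thesis by simp
        qed
      qed
      then show "\<exists>N1. \<forall>N\<ge>N1. norm (\<P>(P in prc_measure TYPE('f) N (torus d N) p q i.
          incl_nontrivial TYPE('f) N (torus d N) i P) - 0) < \<delta>"
        by (intro exI[of _ "Suc N0"]) simp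
    qed
  next
    assume super: "p_sd q < p"
    show "(\<lambda>N. \<P>(P in prc_measure TYPE('f) N (torus d N) p q i.
       incl_surjective TYPE('f) N (torus d N) i P)) \<longlonglongrightarrow> 1"
    proof (rule LIMSEQ_I)
      fix \<delta> :: real assume \<delta>: "0 < \<delta>"
      define \<epsilon> where "\<epsilon> = min \<delta> (critical_bound d q)"
      have \<epsilon>: "0 < \<epsilon>" "\<epsilon> \<le> critical_bound d q" "\<epsilon> \<le> \<delta>"
        using \<delta> crit by (auto simp: \<epsilon>_def)
      obtain N0 where N0: "size_bound q (p / (1 - p)) \<epsilon> < real N0"
        using reals_Archimedean2 by blast
      have "1 - \<delta> < \<P>(P in prc_measure TYPE('f) N (torus d N) p q i. incl_surjective TYPE('f) N (torus d N) i P)"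
        if N: "Suc N0 \<le> N" for N
      proof -
        have "0 < N" using N by simp
        interpret plaquette_model N d i "TYPE('f)" q by (rule model[OF \<open>0 < N\<close>])
        show ?thesis
        proof (cases "p = 1")
          case True
          show ?thesis unfolding True prob_surjective_1 using \<delta> by simp
        next
          case False
          then have p: "0 < p" "p < 1" using False assms(4) super p_sd by auto
          then have "sqrt q < p / (1 - p)" using odds_less_iff(1) s super by simp
          from surjective_bound[OF p this \<epsilon>(1,2)] N0 N \<epsilon>(3) show ?thesis by simp
        qed
      qed
      then show "\<exists>N1. \<forall>N\<ge>N1. norm (\<P>(P in prc_measure TYPE('f) N (torus d N) p q i.
          incl_surjective TYPE('f) N (torus d N) i P) - 1) < \<delta>"
        using le_1 by (intro exI[of _ "Suc N0"]) (simp add: abs_less_iff less_diff_eq le_imp_diff_is_add, smt (verit) \<delta>)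
    qed
  qed
qed

end
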